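(* Suppose that $f(x,u)=|u|^{p-2}u$ with $p\in(2,2^* )$. If $C_1(N)<a^{\frac{N-4}{2}}b<C_2(N)$, then there exists $\varepsilon>0$ such that for each $\lambda$ with $\lambda_0^*-\varepsilon<\lambda<\lambda_0^*$, problem $(\mathcal P_\lambda)$ has a non-zero solution $u_\lambda$, which is a local minimizer of $\Phi_\lambda$ with positive energy (i.e. $\Phi_\lambda(u_\lambda)>0$). Moreover $\Phi_\lambda(u)>0$ for all $u\in H_0^1(\Omega)\setminus\{0\}$ (for these $\lambda$).
   Context: $N>4$ is an integer, $2^*=\frac{2N}{N-2}$, $\Omega\subseteq\mathbb R^N$ is a bounded domain, $a,b$ are positive numbers, $\lambda>0$ is a (positive) parameter. $H_0^1(\Omega)$ has norm $\|u\|=(\int_\Omega|\nabla u|^2dx)^{1/2}$ and $\|u\|_q$ is the $L^q(\Omega)$ norm. $S_N=\inf_{u\in H_0^1(\Omega)\setminus\{0\}}\|u\|^2/\|u\|_{2^*}^2$, $C_1(N)=\frac{4(N-4)^{\frac{N-4}{2}}}{N^{\frac{N-2}{2}}S_N^{\frac N2}}$, $C_2(N)=\frac{2(N-4)^{\frac{N-4}{2}}}{(N-2)^{\frac{N-2}{2}}S_N^{\frac N2}}$. Problem $(\mathcal P_\lambda)$: $-\left(a+b\int_\Omega|\nabla u|^2dx\right)\Delta u=|u|^{2^*-2}u+\lambda|u|^{p-2}u$ in $\Omega$, $u=0$ on $\partial\Omega$. Solutions are weak solutions, i.e. critical points in $H_0^1(\Omega)$ of the energy functional $\Phi_\lambda(u)=\frac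 a2\|u\|^2+\frac b4\|u\|^4-\frac1{2^*}\|u\|_{2^*}^{2^*}-\frac\lambda p\|u\|_p^p$. Definition of $\lambda_0^*$: for $u\in H_0^1(\Omega)\setminus\{0\}$ let $\psi_{\lambda,u}(t)=\Phi_\lambda(tu)$, $t>0$. When $a^{\frac{N-4}{2}}b\ge C_1(N)$, for every such $u$ there is a unique $\lambda_0(u)>0$ for which, with $\lambda=\lambda_0(u)$, there exists $t>0$ with $\psi_{\lambda,u}(t)=0$, $\psi_{\lambda,u}'(t)=0$ and $\psi_{\lambda,u}(t)=\inf_{s>0}\psi_{\lambda,u}(s)$. Then $\lambda_0^*=\lambda_0^*(a,b)=\inf_{u\in H_0^1(\Omega)\setminus\{0\}}\lambda_0(u)$, which is positive if $a^{\frac{N-4}{2}}b>C_1(N)$. *)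

theory Defs
  imports "HOL-Analysis.Analysis"
begin

section \<open>The Sobolev space of functions vanishing on the boundary\<close>

text \<open>
  The ambient Euclidean space is a type of class \<^class>\<open>euclidean_space\<close>, so the dimension \<open>N\<close> is
  \<open>DIM('a)\<close>. Elements of Lebesgue and Sobolev spaces over \<open>\<Omega>\<close> are represented by functions on the
  whole type; only their values in \<open>\<Omega>\<close>, up to a null set, matter.
\<close>

definition bounded_domain :: "'a::euclidean_space set \<Rightarrow> bool" where
  "bounded_domain \<Omega> \<longleftrightarrow> open \<Omega> \<and> connected \<Omega> \<and> \<Omega> \<noteq> {} \<and> bounded \<Omega>"

primrec C_k :: "nat \<Rightarrow> ('a::euclidean_space \<Rightarrow> real) \<Rightarrow> bool" where
  "C_k 0 f \<longleftrightarrow> continuous_on UNIV f"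
| "C_k (Suc k) f \<longleftrightarrow> (\<forall>x. f differentiable (at x)) \<and>
     (\<forall>i\<in>Basis. C_k k (\<lambda>x. frechet_derivative f (at x) i))"

definition test_functions :: "'a::euclidean_space set \<Rightarrow> ('a \<Rightarrow> real) set" where
  "test_functions \<Omega> = {\<phi>. (\<forall>k. C_k k \<phi>) \<and>
     compact (closure {x. \<phi> x \<noteq> 0}) \<and> closure {x. \<phi> x \<noteq> 0} \<subseteq> \<Omega>}"

definition L2 :: "'a::euclidean_space set \<Rightarrow> ('a \<Rightarrow> 'b::euclidean_space) set" where
  "L2 \<Omega> = {f. f \<in> borel_measurable (lebesgue_on \<Omega>) \<and>
     integrable (lebesgue_on \<Omega>) (\<lambda>x. (norm (f x))\<^sup>2)}"

definition is_weak_gradient ::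
  "'a::euclidean_space set \<Rightarrow> ('a \<Rightarrow> real) \<Rightarrow> ('a \<Rightarrow> 'a) \<Rightarrow> bool" where
  "is_weak_gradient \<Omega> u g \<longleftrightarrow> (\<forall>\<phi>\<in>test_functions \<Omega>. \<forall>i\<in>Basis.
     (LINT x|lebesgue_on \<Omega>. u x * frechet_derivative \<phi> (at x) i)
       = - (LINT x|lebesgue_on \<Omega>. (g x \<bullet> i) * \<phi> x))"

definition H1 :: "'a::euclidean_space set \<Rightarrow> ('a \<Rightarrow> real) set" where
  "H1 \<Omega> = {u \<in> L2 \<Omega>. \<exists>g\<in>L2 \<Omega>. is_weak_gradient \<Omega> u g}"

text \<open>The weak gradient is unique up to a null set, so the choice does not affect any integral.\<close>

definition weak_grad :: "'a::euclidean_space set \<Rightarrow> ('a \<Rightarrow> real) \<Rightarrow> 'a \<Rightarrow> 'a" where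
  "weak_grad \<Omega> u = (SOME g. g \<in> L2 \<Omega> \<and> is_weak_gradient \<Omega> u g)"

definition H1_norm :: "'a::euclidean_space set \<Rightarrow> ('a \<Rightarrow> real) \<Rightarrow> real" where
  "H1_norm \<Omega> u = sqrt ((LINT x|lebesgue_on \<Omega>. (u x)\<^sup>2) +
     (LINT x|lebesgue_on \<Omega>. (norm (weak_grad \<Omega> u x))\<^sup>2))"

definition H01 :: "'a::euclidean_space set \<Rightarrow> ('a \<Rightarrow> real) set" where
  "H01 \<Omega> = {u \<in> H1 \<Omega>. \<forall>e>0. \<exists>\<phi>\<in>test_functions \<Omega>. H1_norm \<Omega> (\<lambda>x. u x - \<phi> x) < e}"

definition H01_nonzero :: "'a::euclidean_space set \<Rightarrow> ('a \<Rightarrow> real) set" where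
  "H01_nonzero \<Omega> = {u \<in> H01 \<Omega>. \<not> (AE x in lebesgue_on \<Omega>. u x = 0)}"

definition H01_norm :: "'a::euclidean_space set \<Rightarrow> ('a \<Rightarrow> real) \<Rightarrow> real" where
  "H01_norm \<Omega> u = sqrt (LINT x|lebesgue_on \<Omega>. (norm (weak_grad \<Omega> u x))\<^sup>2)"

definition Lq_norm :: "'a::euclidean_space set \<Rightarrow> real \<Rightarrow> ('a \<Rightarrow> real) \<Rightarrow> real" where
  "Lq_norm \<Omega> q u = (LINT x|lebesgue_on \<Omega>. \<bar>u x\<bar> powr q) powr (1 / q)"


section \<open>The constants\<close>

definition crit_exp :: "nat \<Rightarrow> real" where
  "crit_exp N = 2 * real N / (real N - 2)"

definition sobolev_const :: "'a::euclidean_space set \<Rightarrow> real" where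
  "sobolev_const \<Omega> =
     (INF u\<in>H01_nonzero \<Omega>. (H01_norm \<Omega> u)\<^sup>2 / (Lq_norm \<Omega> (crit_exp DIM('a)) u)\<^sup>2)"

text \<open>In both constants, \<open>S\<close> stands for the best Sobolev constant.\<close>

definition C1 :: "nat \<Rightarrow> real \<Rightarrow> real" where
  "C1 N S = 4 * (real N - 4) powr ((real N - 4) / 2) /
     (real N powr ((real N - 2) / 2) * S powr (real N / 2))"

definition C2 :: "nat \<Rightarrow> real \<Rightarrow> real" where
  "C2 N S = 2 * (real N - 4) powr ((real N - 4) / 2) /
     ((real N - 2) powr ((real N - 2) / 2) * S powr (real N / 2))"


section \<open>The energy functional and its critical points\<close>

definition energy ::
  "'a::euclidean_space set \<Rightarrow> real \<Rightarrow> real \<Rightarrow> real \<Rightarrow> real \<Rightarrow> ('a \<Rightarrow> real) \<Rightarrow> real" where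
  "energy \<Omega> a b p \<mu> u =
     a / 2 * (H01_norm \<Omega> u)\<^sup>2 + b / 4 * (H01_norm \<Omega> u) ^ 4
     - 1 / crit_exp DIM('a) * Lq_norm \<Omega> (crit_exp DIM('a)) u powr crit_exp DIM('a)
     - \<mu> / p * Lq_norm \<Omega> p u powr p"

text \<open>\<open>F\<close> has Frechet derivative zero at \<open>u\<close>, as a functional on the normed space \<open>H01 \<Omega>\<close>.\<close>

definition H01_critical_point ::
  "'a::euclidean_space set \<Rightarrow> (('a \<Rightarrow> real) \<Rightarrow> real) \<Rightarrow> ('a \<Rightarrow> real) \<Rightarrow> bool" where
  "H01_critical_point \<Omega> F u \<longleftrightarrow> u \<in> H01 \<Omega> \<and>
     (\<forall>e>0. \<exists>d>0. \<forall>h\<in>H01 \<Omega>. H01_norm \<Omega> h < d \<longrightarrow>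
        \<bar>F (\<lambda>x. u x + h x) - F u\<bar> \<le> e * H01_norm \<Omega> h)"

definition H01_local_minimizer ::
  "'a::euclidean_space set \<Rightarrow> (('a \<Rightarrow> real) \<Rightarrow> real) \<Rightarrow> ('a \<Rightarrow> real) \<Rightarrow> bool" where
  "H01_local_minimizer \<Omega> F u \<longleftrightarrow> u \<in> H01 \<Omega> \<and>
     (\<exists>r>0. \<forall>v\<in>H01 \<Omega>. H01_norm \<Omega> (\<lambda>x. v x - u x) < r \<longrightarrow> F u \<le> F v)"

text \<open>
  Weak solutions of
  \<open>- (a + b \<integral>\<bar>\<nabla>u\<bar>\<^sup>2) \<Delta>u = \<bar>u\<bar> powr (2* - 2) u + \<lambda> \<bar>u\<bar> powr (p - 2) u\<close> in \<open>\<Omega>\<close>, \<open>u = 0\<close> on the boundary,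
  where \<open>2*\<close> is the critical exponent. The parameter \<open>\<lambda>\<close> is written \<open>\<mu>\<close> in the formal text.
\<close>

definition solves_P ::
  "'a::euclidean_space set \<Rightarrow> real \<Rightarrow> real \<Rightarrow> real \<Rightarrow> real \<Rightarrow> ('a \<Rightarrow> real) \<Rightarrow> bool" where
  "solves_P \<Omega> a b p \<mu> u \<longleftrightarrow> H01_critical_point \<Omega> (energy \<Omega> a b p \<mu>) u"


section \<open>The extremal parameter\<close>

definition fiber ::
  "'a::euclidean_space set \<Rightarrow> real \<Rightarrow> real \<Rightarrow> real \<Rightarrow> real \<Rightarrow> ('a \<Rightarrow> real) \<Rightarrow> real \<Rightarrow> real" where
  "fiber \<Omega> a b p \<mu> u t = energy \<Omega> a b p \<mu> (\<lambda>x. t * u x)"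

definition lambda0 ::
  "'a::euclidean_space set \<Rightarrow> real \<Rightarrow> real \<Rightarrow> real \<Rightarrow> ('a \<Rightarrow> real) \<Rightarrow> real" where
  "lambda0 \<Omega> a b p u = (THE \<mu>. \<mu> > 0 \<and> (\<exists>t>0.
     fiber \<Omega> a b p \<mu> u t = 0 \<and>
     (fiber \<Omega> a b p \<mu> u has_real_derivative 0) (at t) \<and>
     fiber \<Omega> a b p \<mu> u t = (INF s\<in>{0<..}. fiber \<Omega> a b p \<mu> u s)))"

definition lambda0_star :: "'a::euclidean_space set \<Rightarrow> real \<Rightarrow> real \<Rightarrow> real \<Rightarrow> real" where
  "lambda0_star \<Omega> a b p = (INF u\<in>H01_nonzero \<Omega>. lambda0 \<Omega> a b p u)"

end

theory Submission
  imports Defs "HOL-Complex_Analysis.Great_Picard" "HOL-Library.Diagonal_Subsequence"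
begin

text \<open>
  A positive \<open>C2\<close> forces a positive Sobolev constant, so the Sobolev inequality is available, and
  \<open>C1\<close> is the threshold above which the quadratic and quartic terms of the energy strictly dominate
  the critical one. A bounded sequence \<open>u\<^sub>n\<close> has a subsequence with \<open>u\<^sub>n \<rightarrow> v\<close> in \<open>L\<^sup>2\<close> and almost
  everywhere (Rellich), \<open>v\<close> in the Sobolev space and \<open>\<parallel>u\<^sub>n\<parallel>\<^sup>2 \<ge> \<parallel>v\<parallel>\<^sup>2 + \<parallel>u\<^sub>n - v\<parallel>\<^sup>2 - o(1)\<close>; with the upper
  half of the Brezis-Lieb identity this gives \<open>\<Phi>(u\<^sub>n) \<ge> \<Phi>(v) + 2 c \<parallel>u\<^sub>n - v\<parallel>\<^sup>2 - o(1)\<close> for some \<open>c > 0\<close>.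

  For \<open>\<lambda>\<close> below the extremal value every nonzero energy is positive, since the energy vanishes at a
  minimum of a fibre only for the larger parameter \<open>\<lambda>\<^sub>0(u)\<close>. The fibres with \<open>\<lambda>\<^sub>0(u)\<close> close to the
  extremal value show that the infimum of \<open>\<Phi>\<close> outside a small ball of radius \<open>\<rho>\<close> tends to \<open>0\<close>, whereas
  \<open>\<Phi> \<ge> c \<parallel>u\<parallel>\<^sup>2\<close> inside. Hence a minimizing sequence outside the ball stays close to its weak limit, which
  therefore lies strictly outside the ball and is a local minimizer.
\<close>

subsection \<open>Calculus of the classes C_k\<close>

text \<open>The embedding at the critical exponent is not compact, so a minimizing sequence may lose
  mass by concentration and need not converge strongly. Strong convergence is replaced by
  \<open>base_estimate\<close>: it applies to the defect \<open>u_n - v\<close> itself, so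
  concentration costs at least a fixed multiple of the squared norm of the defect. This is why only
  one-sided limits are proved: a lower bound for the squared norm and upper bounds for the two
  Lebesgue terms, each in the direction that bounds the energy of \<open>u_n\<close> from below.

  Below the extremal parameter the global minimizer is 0, with energy 0; hence the minimization
  outside a ball. The danger is a constrained minimizer on the bounding sphere. There the energy is
  at least \<open>c * \<rho>^2\<close>, and the parameter is taken so close to the extremal one that
  the constrained infimum is at most an eighth of that. The competitor with small energy comes from
  a zero of a fibre for a parameter slightly above the extremal one, so the small-ball and
  coercivity bounds have to be uniform in the parameter there.\<close>

lemma C_k_Suc_imp: "C_k (Suc k) f \<Longrightarrow> C_k k f"
proof (induction k arbitrary: f)
  case 0
  then show ?case
    by (auto simp: continuous_on_eq_continuous_at differentiable_imp_continuous_within)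
next
  case (Suc k)
  then show ?case by (metis C_k.simps(2))
qed

lemma C_k_continuous: "C_k k f \<Longrightarrow> continuous_on UNIV f"
  by (induction k) (use C_k_Suc_imp in \<open>auto simp del: C_k.simps(2)\<close>)

lemma C_k_const: "C_k k (\<lambda>x. c)"
  by (induction k arbitrary: c) (auto simp: frechet_derivative_const)

lemma C_k_add: "C_k k f \<Longrightarrow> C_k k g \<Longrightarrow> C_k k (\<lambda>x. f x + g x)"
proof (induction k arbitrary: f g)
  case 0 then show ?case by (auto intro: continuous_intros)
next
  case (Suc k)
  then have d: "f differentiable at x" "g differentiable at x" for x by auto
  have e: "frechet_derivative (\<lambda>x. f x + g x) (at x) i
     = frechet_derivative f (at x) i + frechet_derivative g (at x) i" for x i
    using frechet_derivative_at[OF has_derivative_add[OF d[of x, unfolded frechet_derivative_works]], THEN fun_cong, of i]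
    by simp
  show ?case using Suc d by (auto simp: e)
qed

lemma C_k_mult: "C_k k f \<Longrightarrow> C_k k g \<Longrightarrow> C_k k (\<lambda>x. f x * g x)"
proof (induction k arbitrary: f g)
  case 0 then show ?case by (auto intro: continuous_intros)
next
  case (Suc k)
  then have d: "f differentiable at x" "g differentiable at x" for x by auto
  have e: "frechet_derivative (\<lambda>x. f x * g x) (at x) i
     = f x * frechet_derivative g (at x) i + frechet_derivative f (at x) i * g x" for x i
    using frechet_derivative_at[OF has_derivative_mult[OF d[of x, unfolded frechet_derivative_works]], THEN fun_cong, of i]
    by simp
  have "C_k k f" "C_k k g" using Suc.prems by (auto intro: C_k_Suc_imp simp del: C_k.simps)
  then show ?case using Suc d by (auto simp: e intro!: C_k_add)
qed

lemma C_k_cmult: "C_k k f \<Longrightarrow> C_k k (\<lambda>x. c * f x)"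
  by (rule C_k_mult[OF C_k_const])

lemma C_k_diff: "C_k k f \<Longrightarrow> C_k k g \<Longrightarrow> C_k k (\<lambda>x. f x - g x)"
  using C_k_add[OF _ C_k_cmult[of k g "-1"], of f] by simp

lemma C_k_power: "C_k k f \<Longrightarrow> C_k k (\<lambda>x. f x ^ n)"
  by (induction n) (auto intro: C_k_const C_k_mult)

lemma C_k_prod: "finite I \<Longrightarrow> (\<And>i. i \<in> I \<Longrightarrow> C_k k (f i)) \<Longrightarrow> C_k k (\<lambda>x. \<Prod>i\<in>I. f i x)"
  by (induction I rule: finite_induct) (auto intro: C_k_const C_k_mult)

text \<open>The family \<open>G\<close> is closed under differentiation: the derivative in direction
  \<open>i\<close> is a scalar times the ridge function of \<open>G (Suc j)\<close>. Induction on
  \<open>k\<close> with \<open>j\<close> arbitrary then gives every order at once.\<close>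

lemma C_k_ridge:
  assumes "\<And>j s. (G j has_real_derivative G (Suc j) s) (at s)"
  shows "C_k k (\<lambda>x::'a::euclidean_space. G j (x \<bullet> v - c))"
proof (induction k arbitrary: j)
  case 0
  have "continuous_on UNIV (G j)"
    using DERIV_isCont[OF assms] by (simp add: continuous_on_eq_continuous_at)
  then have "continuous_on UNIV (G j \<circ> (\<lambda>x. x \<bullet> v - c))"
    by (intro continuous_on_compose) (auto intro!: continuous_intros intro: continuous_on_subset)
  then show ?case by (simp add: o_def)
next
  case (Suc k)
  have d: "((\<lambda>x. G j (x \<bullet> v - c)) has_derivative (\<lambda>h. (h \<bullet> v) * G (Suc j) (x \<bullet> v - c))) (at x)" for x
    by (rule has_derivative_eq_rhs[OF has_derivative_compose[where g = "G j" and f = "\<lambda>x. x \<bullet> v - c" and f' = "\<lambda>h. h \<bullet> v",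
        OF _ assms[of j "x \<bullet> v - c", unfolded has_field_derivative_def]]])
      (auto intro!: derivative_eq_intros simp: mult.commute)
  have e: "frechet_derivative (\<lambda>x. G j (x \<bullet> v - c)) (at x) = (\<lambda>h. (h \<bullet> v) * G (Suc j) (x \<bullet> v - c))" for x
    by (rule frechet_derivative_at[OF d, symmetric])
  show ?case unfolding C_k.simps e
    using d Suc by (auto simp: differentiable_def intro!: C_k_cmult)
qed

subsection \<open>A smooth bump\<close>

text \<open>Every derivative of exp(-1/s) is a polynomial in 1/s times exp(-1/s). The recursion is
  the product rule in the variable 1/s, whose derivative -1/s^2 supplies the factor
  \<open>[:0,0,1:]\<close>.\<close>

primrec bump_poly :: "nat \<Rightarrow> real poly" where
  "bump_poly 0 = 1"
| "bump_poly (Suc j) = [:0,0,1:] * (bump_poly j - pderiv (bump_poly j))"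

definition bump_deriv :: "nat \<Rightarrow> real \<Rightarrow> real" where
  "bump_deriv j s = (if s > 0 then poly (bump_poly j) (1/s) * exp (- (1/s)) else 0)"

lemma poly_times_exp_tendsto_0: "((\<lambda>x. poly p x * exp (- x)) \<longlongrightarrow> (0::real)) at_top"
proof -
  have "((\<lambda>x. \<Sum>i\<le>degree p. coeff p i * (x ^ i / exp x)) \<longlongrightarrow> (\<Sum>i\<le>degree p. coeff p i * 0)) at_top"
    by (intro tendsto_intros tendsto_power_div_exp_0)
  then show ?thesis
    by (simp add: poly_altdef exp_minus divide_inverse sum_distrib_right mult.assoc)
qed

text \<open>Only s = 0 needs an argument. The right difference quotient there is again a polynomial
  in 1/h times exp(-1/h), now with an extra factor 1/h, and the exponential wins; the left one is
  zero.\<close>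

lemma DERIV_bump_deriv: "(bump_deriv j has_real_derivative bump_deriv (Suc j) s) (at s)"
proof -
  consider "s > 0" | "s < 0" | "s = 0" by linarith
  then show ?thesis
  proof cases
    case 1
    have "((\<lambda>s. poly (bump_poly j) (1/s) * exp (- (1/s))) has_real_derivative bump_deriv (Suc j) s) (at s)"
      using 1 by (auto intro!: derivative_eq_intros simp: bump_deriv_def field_simps power2_eq_square)
    moreover have "eventually (\<lambda>s. poly (bump_poly j) (1/s) * exp (- (1/s)) = bump_deriv j s) (nhds s)"
      using eventually_nhds_in_open[of "{0<..}" s] 1 by (auto simp: bump_deriv_def elim: eventually_mono)
    ultimately show ?thesis by (subst (asm) DERIV_cong_ev[OF refl _ refl]) auto
  next
    case 2
    have "eventually (\<lambda>s. 0 = bump_deriv j s) (nhds s)"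
      using eventually_nhds_in_open[of "{..<0}" s] 2 by (auto simp: bump_deriv_def elim: eventually_mono)
    then have "(bump_deriv j has_real_derivative 0) (at s)"
      using DERIV_cong_ev[OF refl _ refl, of "\<lambda>s. 0" "bump_deriv j" s 0] by auto
    then show ?thesis using 2 by (simp add: bump_deriv_def)
  next
    case 3
    have "((\<lambda>h. bump_deriv j h / h) \<longlongrightarrow> 0) (at_right 0)"
    proof -
      have "((\<lambda>h. poly ([:0,1:] * bump_poly j) (inverse h) * exp (- inverse h)) \<longlongrightarrow> 0) (at_right (0::real))"
        by (rule filterlim_compose[OF poly_times_exp_tendsto_0 filterlim_inverse_at_top_right])
      moreover have "eventually (\<lambda>h::real. h > 0) (at_right 0)" by (simp add: eventually_at_right_less)
      ultimately show ?thesis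
        by (elim Lim_transform_eventually) (auto elim!: eventually_mono simp: bump_deriv_def divide_inverse)
    qed
    moreover have "((\<lambda>h. bump_deriv j h / h) \<longlongrightarrow> 0) (at_left 0)"
    proof -
      have "eventually (\<lambda>h::real. h < 0) (at_left 0)" using eventually_at_left_real[of "-1" 0] by (auto elim: eventually_mono)
      then show ?thesis
        by (intro Lim_transform_eventually[OF tendsto_const]) (auto elim!: eventually_mono simp: bump_deriv_def)
    qed
    ultimately have "((\<lambda>h. bump_deriv j h / h) \<longlongrightarrow> 0) (at 0)" by (simp add: filterlim_split_at)
    then show ?thesis using 3 by (simp add: DERIV_def bump_deriv_def)
  qed
qed

definition bump :: "real \<Rightarrow> real" where "bump = bump_deriv 0"

lemma bump_pos_iff: "bump s > 0 \<longleftrightarrow> s > 0" and bump_nonneg: "bump s \<ge> 0" and bump_le_1: "bump s \<le> 1"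
  by (auto simp: bump_def bump_deriv_def)

lemma C_k_bump_ridge: "C_k k (\<lambda>x::'a::euclidean_space. bump (x \<bullet> v - c))"
  unfolding bump_def by (rule C_k_ridge[where G = bump_deriv and j = 0]) (rule DERIV_bump_deriv)

definition box_bump :: "'a::euclidean_space \<Rightarrow> 'a \<Rightarrow> 'a \<Rightarrow> real" where
  "box_bump a b x = (\<Prod>i\<in>Basis. bump (x \<bullet> i - a \<bullet> i) * bump (b \<bullet> i - x \<bullet> i))"

lemma C_k_box_bump: "C_k k (box_bump a b)"
proof -
  have "C_k k (\<lambda>x. bump (b \<bullet> i - x \<bullet> i))" for i
    using C_k_bump_ridge[of k "-i" "- (b \<bullet> i)"] by (simp add: add.commute)
  then show ?thesis unfolding box_bump_def[abs_def]
    by (intro C_k_prod C_k_mult C_k_bump_ridge) auto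
qed

lemma box_bump_nonneg: "box_bump a b x \<ge> 0" and box_bump_le_1: "box_bump a b x \<le> 1"
  unfolding box_bump_def
  by (intro prod_nonneg mult_nonneg_nonneg bump_nonneg)
    (intro prod_le_1 conjI mult_nonneg_nonneg mult_le_one bump_nonneg bump_le_1)

lemma box_bump_pos_iff: "box_bump a b x > 0 \<longleftrightarrow> x \<in> box a b"
proof
  assume "x \<in> box a b" then show "box_bump a b x > 0"
    by (auto simp: box_bump_def mem_box bump_pos_iff intro!: prod_pos mult_pos_pos)
next
  assume p: "box_bump a b x > 0"
  then have "box_bump a b x \<noteq> 0" by simp
  then have nz: "\<forall>i\<in>Basis. bump (x \<bullet> i - a \<bullet> i) * bump (b \<bullet> i - x \<bullet> i) \<noteq> 0"
    unfolding box_bump_def by (simp add: prod_zero_iff)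
  { fix i :: 'a assume i: "i \<in> Basis"
    have "bump (x \<bullet> i - a \<bullet> i) * bump (b \<bullet> i - x \<bullet> i) \<noteq> 0"
      using nz i by blast
    then have "bump (x \<bullet> i - a \<bullet> i) > 0 \<and> bump (b \<bullet> i - x \<bullet> i) > 0"
      by (metis bump_nonneg less_eq_real_def mult_eq_0_iff)
    then have "a \<bullet> i < x \<bullet> i \<and> x \<bullet> i < b \<bullet> i" by (auto simp: bump_pos_iff) }
  then show "x \<in> box a b" by (auto simp: mem_box)
qed

subsection \<open>Test functions\<close>

abbreviation pd :: "'a::euclidean_space \<Rightarrow> ('a \<Rightarrow> real) \<Rightarrow> 'a \<Rightarrow> real" where
  "pd i \<phi> x \<equiv> frechet_derivative \<phi> (at x) i"

lemma test_functionsI: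
  assumes "\<And>k. C_k k \<phi>" "compact K" "K \<subseteq> \<Omega>" "\<And>x. x \<notin> K \<Longrightarrow> \<phi> x = 0"
  shows "\<phi> \<in> test_functions \<Omega>"
proof -
  have "closure {x. \<phi> x \<noteq> 0} \<subseteq> K"
    using assms by (intro closure_minimal) (auto simp: compact_imp_closed)
  then show ?thesis using assms
    by (auto simp: test_functions_def compact_eq_bounded_closed bounded_subset)
qed

lemma test_functions_support:
  assumes "\<phi> \<in> test_functions \<Omega>"
  shows "\<exists>K. compact K \<and> K \<subseteq> \<Omega> \<and> (\<forall>x. x \<notin> K \<longrightarrow> \<phi> x = 0)"
  using assms closure_subset[of "{x. \<phi> x \<noteq> 0}"] unfolding test_functions_def by blast

lemma test_functions_C_k: "\<phi> \<in> test_functions \<Omega> \<Longrightarrow> C_k k \<phi>"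
  by (simp add: test_functions_def)

lemma test_functions_lincomb:
  assumes "\<phi> \<in> test_functions \<Omega>" "\<psi> \<in> test_functions \<Omega>"
  shows "(\<lambda>x. c * \<phi> x + d * \<psi> x) \<in> test_functions \<Omega>"
proof -
  from test_functions_support[OF assms(1)] obtain K where K: "compact K" "K \<subseteq> \<Omega>" "\<And>x. x \<notin> K \<Longrightarrow> \<phi> x = 0" by blast
  from test_functions_support[OF assms(2)] obtain L where L: "compact L" "L \<subseteq> \<Omega>" "\<And>x. x \<notin> L \<Longrightarrow> \<psi> x = 0" by blast
  show ?thesis
    by (rule test_functionsI[of _ "K \<union> L"]) (use K L in \<open>auto intro!: C_k_add C_k_cmult test_functions_C_k[OF assms(1)] test_functions_C_k[OF assms(2)]\<close>)
qed

lemma test_functions_mult: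
  assumes "\<phi> \<in> test_functions \<Omega>" "\<psi> \<in> test_functions \<Omega>"
  shows "(\<lambda>x. \<phi> x * \<psi> x) \<in> test_functions \<Omega>"
proof -
  from test_functions_support[OF assms(1)] obtain K where K: "compact K" "K \<subseteq> \<Omega>" "\<And>x. x \<notin> K \<Longrightarrow> \<phi> x = 0" by blast
  show ?thesis
    by (rule test_functionsI[of _ K]) (use K in \<open>auto intro!: C_k_mult test_functions_C_k[OF assms(1)] test_functions_C_k[OF assms(2)]\<close>)
qed

lemma test_functions_differentiable: "\<phi> \<in> test_functions \<Omega> \<Longrightarrow> \<phi> differentiable (at x)"
  using test_functions_C_k[of \<phi> \<Omega> "Suc 0"] by auto

lemma test_functions_pd:
  assumes "\<phi> \<in> test_functions \<Omega>" "i \<in> Basis"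
  shows "pd i \<phi> \<in> test_functions \<Omega>"
proof -
  from test_functions_support[OF assms(1)] obtain K where K: "compact K" "K \<subseteq> \<Omega>" "\<And>x. x \<notin> K \<Longrightarrow> \<phi> x = 0" by blast
  show ?thesis
  proof (rule test_functionsI[of _ K])
    show "C_k k (pd i \<phi>)" for k using test_functions_C_k[OF assms(1), of "Suc k"] assms(2) by auto
    show "pd i \<phi> x = 0" if "x \<notin> K" for x
    proof -
      have "(\<phi> has_derivative (\<lambda>h. 0)) (at x)"
        by (rule has_derivative_transform_within_open[of "\<lambda>_. 0" _ x UNIV "-K"])
          (use K that in \<open>auto simp: compact_imp_closed open_Compl\<close>)
      then have "frechet_derivative \<phi> (at x) = (\<lambda>h. 0)" using frechet_derivative_at by metis
      then show ?thesis by simp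
    qed
  qed (use K in auto)
qed

text \<open>As \<open>n\<close> grows these functions stay between 0 and 1 and tend pointwise to the
  indicator of the open box: inside, \<open>1 - box_bump\<close> lies in [0, 1), outside it is 1.
  They carry the fundamental lemma from test functions to boxes.\<close>

lemma box_bump_test_functions:
  assumes "cbox a b \<subseteq> \<Omega>"
  shows "(\<lambda>x. 1 - (1 - box_bump a b x) ^ n) \<in> test_functions \<Omega>"
proof (rule test_functionsI[of _ "cbox a b"])
  show "1 - (1 - box_bump a b x) ^ n = 0" if "x \<notin> cbox a b" for x
  proof -
    have "\<not> box_bump a b x > 0" using that box_subset_cbox[of a b] by (auto simp: box_bump_pos_iff)
    then show ?thesis using box_bump_nonneg[of a b x] by simp
  qed
qed (use assms in \<open>auto intro!: C_k_diff C_k_power C_k_const C_k_box_bump\<close>)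

section \<open>Compactly supported continuous functions and integrals of derivatives\<close>

lemma continuous_compact_support_bounded:
  fixes f :: "'a::euclidean_space \<Rightarrow> 'b::euclidean_space"
  assumes "continuous_on UNIV f" "compact K" "\<And>x. x \<notin> K \<Longrightarrow> f x = 0"
  obtains B where "B \<ge> 0" "\<And>x. norm (f x) \<le> B"
proof -
  have "compact (f ` K)" using assms by (intro compact_continuous_image continuous_on_subset[OF assms(1)]) auto
  then obtain B where "\<And>y. y \<in> f ` K \<Longrightarrow> norm y \<le> B" using compact_imp_bounded bounded_iff by metis
  then have "norm (f x) \<le> max B 0" for x by (cases "x \<in> K") (auto simp: assms(3) intro: le_max_iff_disj[THEN iffD2])
  then show ?thesis using that[of "max B 0"] by auto
qed

lemma continuous_compact_support_integrable:
  fixes f :: "'a::euclidean_space \<Rightarrow> 'b::euclidean_space"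
  assumes "continuous_on UNIV f" "compact K" "\<And>x. x \<notin> K \<Longrightarrow> f x = 0"
  shows "integrable lborel f"
proof -
  from continuous_compact_support_bounded[OF assms] obtain B where B: "\<And>x. norm (f x) \<le> B" by metis
  have m: "f \<in> borel_measurable borel" using assms(1) by (rule borel_measurable_continuous_onI)
  have "emeasure lborel K < \<infinity>" using assms(2) compact_imp_bounded emeasure_bounded_finite by blast
  then have "integrable lborel (\<lambda>x. B * indicat_real K x)"
    using assms(2) by (intro integrable_mult_right integrable_real_indicator) (auto simp: borel_compact)
  then show ?thesis
    by (rule Bochner_Integration.integrable_bound) (use m B assms(3) in \<open>auto simp: indicator_def intro!: AE_I2 order.trans[OF _ abs_ge_self]\<close>)
qed

text \<open>The definitions integrate over the completed measure restricted to the domain, whereas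
  translation invariance and Fubini are used for \<open>lborel\<close>; for Borel functions that
  vanish outside the domain the two agree.\<close>

lemma lebesgue_on_lborel:
  fixes f :: "'a::euclidean_space \<Rightarrow> 'b::euclidean_space"
  assumes "\<Omega> \<in> sets lebesgue" "\<And>x. x \<notin> \<Omega> \<Longrightarrow> f x = 0" "f \<in> borel_measurable borel"
  shows "(LINT x|lebesgue_on \<Omega>. f x) = (LINT x|lborel. f x)"
    and "integrable (lebesgue_on \<Omega>) f \<longleftrightarrow> integrable lborel f"
proof -
  have e: "(\<lambda>x. indicator \<Omega> x *\<^sub>R f x) = f" using assms(2) by (auto simp: indicator_def)
  show "(LINT x|lebesgue_on \<Omega>. f x) = (LINT x|lborel. f x)"
    using assms by (subst integral_restrict_space) (auto simp: e integral_completion)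
  show "integrable (lebesgue_on \<Omega>) f \<longleftrightarrow> integrable lborel f"
    using assms by (subst integrable_restrict_space) (auto simp: e integrable_completion)
qed

text \<open>Translation invariance makes the integral of each difference quotient \<open>s n\<close>
  vanish, and dominated convergence passes to the derivative. This is the only integration by parts
  on which the weak gradients rest.\<close>

lemma integral_pd_eq_0:
  assumes f: "\<phi> \<in> test_functions \<Omega>" and i: "i \<in> Basis"
  shows "(LINT x|lborel. pd i \<phi> x) = 0"
proof -
  note t = test_functions_pd[OF f i]
  from test_functions_support[OF f] obtain K where K: "compact K" "\<And>x. x \<notin> K \<Longrightarrow> \<phi> x = 0" by blast
  from test_functions_support[OF t] obtain L where L: "compact L" "\<And>x. x \<notin> L \<Longrightarrow> pd i \<phi> x = 0" by blast
  have cp: "continuous_on UNIV \<phi>" using f C_k_continuous test_functions_C_k by blast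
  have cd: "continuous_on UNIV (pd i \<phi>)" using t C_k_continuous test_functions_C_k by blast
  from continuous_compact_support_bounded[OF cd L] obtain B where B: "B \<ge> 0" "\<And>x. \<bar>pd i \<phi> x\<bar> \<le> B" by (metis real_norm_def)
  from K(1) obtain R where R: "\<And>x. x \<in> K \<Longrightarrow> norm x \<le> R" using compact_imp_bounded bounded_iff by metis
  define s where "s n x = (\<phi> (x + (1 / real (Suc n)) *\<^sub>R i) - \<phi> x) * real (Suc n)" for n x
  have der: "((\<lambda>t. \<phi> (x + t *\<^sub>R i)) has_real_derivative pd i \<phi> (x + t *\<^sub>R i)) (at t)" for x t
  proof -
    have "((\<lambda>t. \<phi> (x + t *\<^sub>R i)) has_derivative (\<lambda>h. frechet_derivative \<phi> (at (x + t *\<^sub>R i)) (h *\<^sub>R i))) (at t)"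
      by (rule has_derivative_compose[OF _ test_functions_differentiable[OF f, unfolded frechet_derivative_works], of "\<lambda>t. x + t *\<^sub>R i" "\<lambda>h. h *\<^sub>R i"])
         (auto intro!: derivative_eq_intros)
    moreover have "frechet_derivative \<phi> (at y) (h *\<^sub>R i) = h * pd i \<phi> y" for y h
      using linear_scale[OF linear_frechet_derivative[OF test_functions_differentiable[OF f]]] by auto
    ultimately show ?thesis by (intro has_derivative_imp_has_field_derivative) auto
  qed
  have mvt: "\<bar>\<phi> (x + t *\<^sub>R i) - \<phi> x\<bar> \<le> B * t" if "t > 0" for x t
  proof -
    have "\<exists>z. z > 0 \<and> z < t \<and> \<phi> (x + t *\<^sub>R i) - \<phi> (x + 0 *\<^sub>R i) = (t - 0) * pd i \<phi> (x + z *\<^sub>R i)"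
      by (rule MVT2[OF that]) (use der in auto)
    then obtain z where "\<phi> (x + t *\<^sub>R i) - \<phi> x = t * pd i \<phi> (x + z *\<^sub>R i)" by auto
    then show ?thesis using B that by (simp add: abs_mult mult.commute)
  qed
  have lim: "(\<lambda>n. s n x) \<longlonglongrightarrow> pd i \<phi> x" for x
  proof -
    have "((\<lambda>h. (\<phi> (x + h *\<^sub>R i) - \<phi> x) / h) \<longlongrightarrow> pd i \<phi> x) (at 0)"
      using der[of x 0] by (simp add: DERIV_def)
    moreover have "filterlim (\<lambda>n. 1 / real (Suc n)) (at 0) sequentially"
      using LIMSEQ_inverse_real_of_nat by (auto simp: filterlim_at inverse_eq_divide)
    ultimately have "(\<lambda>n. (\<phi> (x + (1 / real (Suc n)) *\<^sub>R i) - \<phi> x) / (1 / real (Suc n))) \<longlonglongrightarrow> pd i \<phi> x"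
      by (rule filterlim_compose)
    then show ?thesis by (simp add: s_def)
  qed
  \<comment> \<open>The shift has length at most 1, so all quotients live in one ball of radius
    \<open>R + 1\<close>, where the mean value theorem bounds them by \<open>B\<close>.\<close>
  have bd: "norm (s n x) \<le> B * indicat_real (cball 0 (R+1)) x" for n x
  proof (cases "x \<in> cball 0 (R+1)")
    case True
    have "\<bar>s n x\<bar> \<le> B * (1 / real (Suc n)) * real (Suc n)"
      unfolding s_def abs_mult using mvt[of "1 / real (Suc n)" x] by (intro mult_mono) auto
    then show ?thesis using True by auto
  next
    case False
    then have n: "norm x > R + 1" by simp
    have "norm (x + (1 / real (Suc n)) *\<^sub>R i) \<ge> norm x - norm ((1 / real (Suc n)) *\<^sub>R i)" by (rule norm_diff_ineq)
    moreover have "norm ((1 / real (Suc n)) *\<^sub>R i) \<le> 1" using i by (simp add: divide_simps)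
    ultimately have "x + (1 / real (Suc n)) *\<^sub>R i \<notin> K" using R[of "x + (1 / real (Suc n)) *\<^sub>R i"] n by linarith
    moreover have "x \<notin> K" using R[of x] n by auto
    ultimately show ?thesis using False by (simp add: s_def K(2))
  qed
  have int\<phi>: "integrable lborel \<phi>" by (rule continuous_compact_support_integrable[OF cp K])
  have int0: "(LINT x|lborel. s n x) = 0" for n
  proof -
    have tr: "(LINT x|lborel. \<phi> (x + (1 / real (Suc n)) *\<^sub>R i)) = (LINT x|lborel. \<phi> x)"
      and ti: "integrable lborel (\<lambda>x. \<phi> (x + (1 / real (Suc n)) *\<^sub>R i))"
    proof -
      let ?c = "(1 / real (Suc n)) *\<^sub>R i"
      have d: "distr lborel borel ((+) ?c) = lborel" by (rule lborel_distr_plus)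
      have m: "\<phi> \<in> borel_measurable borel" using cp by (rule borel_measurable_continuous_onI)
      show "(LINT x|lborel. \<phi> (x + ?c)) = (LINT x|lborel. \<phi> x)"
        using integral_distr[of "(+) ?c" lborel borel \<phi>] m d by (simp add: add.commute)
      show "integrable lborel (\<lambda>x. \<phi> (x + ?c))"
        using integrable_distr_eq[of "(+) ?c" lborel borel \<phi>] m d int\<phi> by (simp add: add.commute)
    qed
    show ?thesis unfolding s_def using tr ti int\<phi> by simp
  qed
  have "(\<lambda>n. LINT x|lborel. s n x) \<longlonglongrightarrow> (LINT x|lborel. pd i \<phi> x)"
  proof (rule integral_dominated_convergence)
    show "pd i \<phi> \<in> borel_measurable lborel" using cd by (simp add: borel_measurable_continuous_onI)
    have "continuous_on UNIV (\<lambda>x. s n x)" for n unfolding s_def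
      by (intro continuous_intros continuous_on_compose2[OF cp]) auto
    then show "s n \<in> borel_measurable lborel" for n by (simp add: borel_measurable_continuous_onI)
    show "integrable lborel (\<lambda>x. B * indicat_real (cball 0 (R+1)) x)"
      by (intro integrable_mult_right integrable_real_indicator)
(simp_all add: emeasure_bounded_finite[unfolded infinity_ennreal_def])
  qed (use lim bd in auto)
  then show ?thesis by (simp add: int0 LIMSEQ_const_iff)
qed

subsection \<open>Square integrable functions\<close>

definition ip :: "'a::euclidean_space set \<Rightarrow> ('a \<Rightarrow> 'b::euclidean_space) \<Rightarrow> ('a \<Rightarrow> 'b) \<Rightarrow> real" where
  "ip \<Omega> f g = (LINT x|lebesgue_on \<Omega>. f x \<bullet> g x)"

definition l2 :: "'a::euclidean_space set \<Rightarrow> ('a \<Rightarrow> 'b::euclidean_space) \<Rightarrow> real" where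
  "l2 \<Omega> f = sqrt (ip \<Omega> f f)"

lemma L2_measurable: "f \<in> L2 \<Omega> \<Longrightarrow> f \<in> borel_measurable (lebesgue_on \<Omega>)"
  by (simp add: L2_def)

lemma L2_integrable: "f \<in> L2 \<Omega> \<Longrightarrow> integrable (lebesgue_on \<Omega>) (\<lambda>x. (norm (f x))\<^sup>2)"
  by (simp add: L2_def)

lemma inner_le_sum_squares: "\<bar>x \<bullet> y\<bar> \<le> (norm x)\<^sup>2 + (norm y)\<^sup>2" for x y :: "'a::real_inner"
  using Cauchy_Schwarz_ineq2[of x y] sum_squares_bound[of "norm x" "norm y"]
    mult_nonneg_nonneg[OF norm_ge_zero[of x] norm_ge_zero[of y]] by linarith

lemma L2_inner_integrable:
  assumes "f \<in> L2 \<Omega>" "g \<in> L2 \<Omega>"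
  shows "integrable (lebesgue_on \<Omega>) (\<lambda>x. f x \<bullet> g x)"
proof (rule Bochner_Integration.integrable_bound)
  show "integrable (lebesgue_on \<Omega>) (\<lambda>x. (norm (f x))\<^sup>2 + (norm (g x))\<^sup>2)"
    by (intro Bochner_Integration.integrable_add L2_integrable assms)
  show "(\<lambda>x. f x \<bullet> g x) \<in> borel_measurable (lebesgue_on \<Omega>)"
    using assms[THEN L2_measurable] by measurable
  show "AE x in lebesgue_on \<Omega>. norm (f x \<bullet> g x) \<le> norm ((norm (f x))\<^sup>2 + (norm (g x))\<^sup>2)"
    using inner_le_sum_squares by (auto intro!: AE_I2 simp: order.trans[OF _ abs_ge_self])
qed

lemma L2_lincomb:
  assumes "f \<in> L2 \<Omega>" "g \<in> L2 \<Omega>"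
  shows "(\<lambda>x. c *\<^sub>R f x + d *\<^sub>R g x) \<in> L2 \<Omega>"
proof -
  have [measurable]: "f \<in> borel_measurable (lebesgue_on \<Omega>)" "g \<in> borel_measurable (lebesgue_on \<Omega>)"
    using assms by (auto simp: L2_measurable)
  have e: "(norm (c *\<^sub>R f x + d *\<^sub>R g x))\<^sup>2 = c\<^sup>2 * (norm (f x))\<^sup>2 + d\<^sup>2 * (norm (g x))\<^sup>2 + 2 * c * d * (f x \<bullet> g x)" for x
    by (simp add: power2_norm_eq_inner inner_add inner_commute algebra_simps power2_eq_square[of c] power2_eq_square[of d])
  show ?thesis unfolding L2_def
    by (auto simp: e intro!: Bochner_Integration.integrable_add integrable_mult_right L2_integrable L2_inner_integrable assms)
qed

lemma L2_add: "f \<in> L2 \<Omega> \<Longrightarrow> g \<in> L2 \<Omega> \<Longrightarrow> (\<lambda>x. f x + g x) \<in> L2 \<Omega>"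
  and L2_diff: "f \<in> L2 \<Omega> \<Longrightarrow> g \<in> L2 \<Omega> \<Longrightarrow> (\<lambda>x. f x - g x) \<in> L2 \<Omega>"
  using L2_lincomb[of f \<Omega> g 1 1] L2_lincomb[of f \<Omega> g 1 "-1"] by simp_all

lemma ip_commute: "ip \<Omega> f g = ip \<Omega> g f"
  by (simp add: ip_def inner_commute)

lemma ip_lincomb_left:
  assumes "f \<in> L2 \<Omega>" "g \<in> L2 \<Omega>" "h \<in> L2 \<Omega>"
  shows "ip \<Omega> (\<lambda>x. c *\<^sub>R f x + d *\<^sub>R g x) h = c * ip \<Omega> f h + d * ip \<Omega> g h"
  using assms by (simp add: ip_def inner_add_left L2_inner_integrable)

lemma ip_lincomb_right:
  assumes "f \<in> L2 \<Omega>" "g \<in> L2 \<Omega>" "h \<in> L2 \<Omega>"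
  shows "ip \<Omega> h (\<lambda>x. c *\<^sub>R f x + d *\<^sub>R g x) = c * ip \<Omega> h f + d * ip \<Omega> h g"
  using assms by (simp add: ip_def inner_add_right L2_inner_integrable)

lemma ip_lincomb_self:
  assumes "f \<in> L2 \<Omega>" "g \<in> L2 \<Omega>"
  shows "ip \<Omega> (\<lambda>x. c *\<^sub>R f x + d *\<^sub>R g x) (\<lambda>x. c *\<^sub>R f x + d *\<^sub>R g x)
    = c\<^sup>2 * ip \<Omega> f f + 2 * c * d * ip \<Omega> f g + d\<^sup>2 * ip \<Omega> g g"
  using assms by (simp add: ip_lincomb_left ip_lincomb_right L2_lincomb ip_commute[of \<Omega> g f] algebra_simps power2_eq_square)

lemma ip_self_nonneg: "ip \<Omega> f f \<ge> 0"
  by (auto simp: ip_def intro!: integral_nonneg_AE)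

lemma ip_self: "ip \<Omega> f f = (LINT x|lebesgue_on \<Omega>. (norm (f x))\<^sup>2)"
  by (simp add: ip_def power2_norm_eq_inner)

lemma l2_nonneg: "l2 \<Omega> f \<ge> 0" and l2_square: "(l2 \<Omega> f)\<^sup>2 = ip \<Omega> f f"
  by (auto simp: l2_def ip_self_nonneg)

lemma ip_cong_AE:
  assumes "f \<in> borel_measurable (lebesgue_on \<Omega>)" "f' \<in> borel_measurable (lebesgue_on \<Omega>)"
    "g \<in> borel_measurable (lebesgue_on \<Omega>)" "g' \<in> borel_measurable (lebesgue_on \<Omega>)"
    "AE x in lebesgue_on \<Omega>. f x = f' x" "AE x in lebesgue_on \<Omega>. g x = g' x"
  shows "ip \<Omega> f g = ip \<Omega> f' g'"
  unfolding ip_def using assms by (intro integral_cong_AE) auto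

lemma l2_cong_AE:
  assumes "f \<in> borel_measurable (lebesgue_on \<Omega>)" "f' \<in> borel_measurable (lebesgue_on \<Omega>)"
    "AE x in lebesgue_on \<Omega>. f x = f' x"
  shows "l2 \<Omega> f = l2 \<Omega> f'"
  unfolding l2_def using ip_cong_AE assms by metis

lemma quadratic_nonneg_imp_discriminant:
  fixes A B C :: real
  assumes "\<And>t. A + 2 * t * B + t\<^sup>2 * C \<ge> 0" "C \<ge> 0"
  shows "B\<^sup>2 \<le> A * C"
proof (cases "C = 0")
  case True
  have "B = 0"
  proof (rule ccontr)
    assume "B \<noteq> 0"
    \<comment> \<open>This choice of \<open>t\<close> turns the left-hand side into -1.\<close>
    then show False using assms(1)[of "- (A + 1) / (2 * B)"] True by (simp add: field_simps)
  qed
  then show ?thesis using True by simp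
next
  case False
  then show ?thesis using assms(1)[of "- B / C"] assms(2) by (simp add: field_simps power2_eq_square)
qed

lemma ip_Cauchy_Schwarz:
  assumes "f \<in> L2 \<Omega>" "g \<in> L2 \<Omega>"
  shows "\<bar>ip \<Omega> f g\<bar> \<le> l2 \<Omega> f * l2 \<Omega> g"
proof -
  have "0 \<le> ip \<Omega> f f + 2 * t * ip \<Omega> f g + t\<^sup>2 * ip \<Omega> g g" for t
    using ip_lincomb_self[OF assms, of 1 t] ip_self_nonneg[of \<Omega> "\<lambda>x. 1 *\<^sub>R f x + t *\<^sub>R g x"] by simp
  then have "(ip \<Omega> f g)\<^sup>2 \<le> ip \<Omega> f f * ip \<Omega> g g"
    by (rule quadratic_nonneg_imp_discriminant) (rule ip_self_nonneg)
  then have "(ip \<Omega> f g)\<^sup>2 \<le> (l2 \<Omega> f * l2 \<Omega> g)\<^sup>2" by (simp add: power_mult_distrib l2_square)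
  then show ?thesis using l2_nonneg by (metis abs_le_square_iff abs_of_nonneg mult_nonneg_nonneg)
qed

lemma l2_lincomb_le:
  assumes "f \<in> L2 \<Omega>" "g \<in> L2 \<Omega>"
  shows "l2 \<Omega> (\<lambda>x. c *\<^sub>R f x + d *\<^sub>R g x) \<le> \<bar>c\<bar> * l2 \<Omega> f + \<bar>d\<bar> * l2 \<Omega> g"
proof (rule power2_le_imp_le)
  have "c * d * ip \<Omega> f g \<le> \<bar>c\<bar> * \<bar>d\<bar> * (l2 \<Omega> f * l2 \<Omega> g)"
    using abs_ge_self[of "c * d * ip \<Omega> f g"] mult_left_mono[OF ip_Cauchy_Schwarz[OF assms], of "\<bar>c\<bar> * \<bar>d\<bar>"]
    by (simp add: abs_mult)
  then show "(l2 \<Omega> (\<lambda>x. c *\<^sub>R f x + d *\<^sub>R g x))\<^sup>2 \<le> (\<bar>c\<bar> * l2 \<Omega> f + \<bar>d\<bar> * l2 \<Omega> g)\<^sup>2"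
    unfolding l2_square power2_sum power_mult_distrib ip_lincomb_self[OF assms] by (simp add: mult_ac)
qed (simp add: l2_nonneg)

lemma l2_scale: "l2 \<Omega> (\<lambda>x. c *\<^sub>R f x) = \<bar>c\<bar> * l2 \<Omega> f"
  by (simp add: l2_def ip_def real_sqrt_mult mult.assoc[symmetric] power2_eq_square[symmetric])

lemma l2_triangle: "f \<in> L2 \<Omega> \<Longrightarrow> g \<in> L2 \<Omega> \<Longrightarrow> l2 \<Omega> (\<lambda>x. f x + g x) \<le> l2 \<Omega> f + l2 \<Omega> g"
  using l2_lincomb_le[of f \<Omega> g 1 1] by simp

lemma l2_minus_commute: "l2 \<Omega> (\<lambda>x. f x - g x) = l2 \<Omega> (\<lambda>x. g x - f x)"
  using l2_scale[of \<Omega> "-1" "\<lambda>x. f x - g x"] by simp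

lemma l2_triangle_diff:
  "f \<in> L2 \<Omega> \<Longrightarrow> g \<in> L2 \<Omega> \<Longrightarrow> h \<in> L2 \<Omega> \<Longrightarrow> l2 \<Omega> (\<lambda>x. f x - h x) \<le> l2 \<Omega> (\<lambda>x. f x - g x) + l2 \<Omega> (\<lambda>x. g x - h x)"
  using l2_triangle[of "\<lambda>x. f x - g x" \<Omega> "\<lambda>x. g x - h x"] by (simp add: L2_diff)

section \<open>Square integrable functions on sets of finite measure; completeness\<close>

lemma borel_measurable_lebesgue_onI: "f \<in> borel_measurable borel \<Longrightarrow> f \<in> borel_measurable (lebesgue_on \<Omega>)"
  by (intro measurable_restrict_space1 measurable_completion) simp

lemma L2_bounded_measurable:
  assumes "\<Omega> \<in> lmeasurable" "f \<in> borel_measurable (lebesgue_on \<Omega>)" "\<And>x. norm (f x) \<le> B"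
  shows "f \<in> L2 \<Omega>"
proof -
  interpret finite_measure "lebesgue_on \<Omega>" by (rule finite_measure_lebesgue_on[OF assms(1)])
  have [measurable]: "f \<in> borel_measurable (lebesgue_on \<Omega>)" by fact
  have "integrable (lebesgue_on \<Omega>) (\<lambda>x. (norm (f x))\<^sup>2)"
    by (rule integrable_const_bound[of _ "B\<^sup>2"]) (use assms(3) in \<open>auto intro!: power_mono\<close>)
  then show ?thesis by (simp add: L2_def)
qed

lemma L2_integrable1:
  assumes "\<Omega> \<in> lmeasurable" "f \<in> L2 \<Omega>"
  shows "integrable (lebesgue_on \<Omega>) f"
    and "(LINT x|lebesgue_on \<Omega>. norm (f x)) \<le> sqrt (measure lebesgue \<Omega>) * l2 \<Omega> f"
proof -
  interpret finite_measure "lebesgue_on \<Omega>" by (rule finite_measure_lebesgue_on[OF assms(1)])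
  have [measurable]: "f \<in> borel_measurable (lebesgue_on \<Omega>)" using assms(2) by (rule L2_measurable)
  have n: "(\<lambda>x. norm (f x)) \<in> L2 \<Omega>" using assms(2) by (simp add: L2_def)
  have o: "(\<lambda>x. 1::real) \<in> L2 \<Omega>" by (rule L2_bounded_measurable[OF assms(1), of _ 1]) auto
  have "integrable (lebesgue_on \<Omega>) (\<lambda>x. norm (f x))" using L2_inner_integrable[OF n o] by simp
  then show "integrable (lebesgue_on \<Omega>) f" by (simp add: integrable_norm_iff)
  have m: "measure (lebesgue_on \<Omega>) \<Omega> = measure lebesgue \<Omega>"
    using assms(1) by (simp add: measure_restrict_space)
  have "l2 \<Omega> (\<lambda>x. 1::real) = sqrt (measure lebesgue \<Omega>)" by (simp add: l2_def ip_def m)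
  moreover have "l2 \<Omega> (\<lambda>x. norm (f x)) = l2 \<Omega> f" by (simp add: l2_def ip_self)
  ultimately show "(LINT x|lebesgue_on \<Omega>. norm (f x)) \<le> sqrt (measure lebesgue \<Omega>) * l2 \<Omega> f"
    using ip_Cauchy_Schwarz[OF n o] by (simp add: ip_def mult.commute)
qed

lemma L2_AE_subseq:
  assumes "\<And>n. f n \<in> L2 \<Omega>" "g \<in> L2 \<Omega>" "(\<lambda>n. l2 \<Omega> (\<lambda>x. f n x - g x)) \<longlonglongrightarrow> 0"
  shows "\<exists>r::nat\<Rightarrow>nat. strict_mono r \<and> (AE x in lebesgue_on \<Omega>. (\<lambda>n. f (r n) x) \<longlonglongrightarrow> g x)"
proof -
  have "(\<lambda>n. (l2 \<Omega> (\<lambda>x. f n x - g x))\<^sup>2) \<longlonglongrightarrow> 0" using tendsto_power[OF assms(3), of 2] by simp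
  then have "(\<lambda>n. LINT x|lebesgue_on \<Omega>. norm ((norm (f n x - g x))\<^sup>2)) \<longlonglongrightarrow> 0" by (simp add: l2_square ip_self)
  then obtain r :: "nat \<Rightarrow> nat" where r: "strict_mono r" "AE x in lebesgue_on \<Omega>. (\<lambda>n. (norm (f (r n) x - g x))\<^sup>2) \<longlonglongrightarrow> 0"
    using tendsto_L1_AE_subseq[of "lebesgue_on \<Omega>" "\<lambda>n x. (norm (f n x - g x))\<^sup>2"] L2_integrable[OF L2_diff[OF assms(1,2)]] by auto
  have "(\<lambda>n. f (r n) x) \<longlonglongrightarrow> g x" if "(\<lambda>n. (norm (f (r n) x - g x))\<^sup>2) \<longlonglongrightarrow> 0" for x
  proof -
    have "(\<lambda>n. sqrt ((norm (f (r n) x - g x))\<^sup>2)) \<longlonglongrightarrow> 0" using tendsto_real_sqrt[OF that] by simp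
    then show ?thesis by (simp add: LIM_zero_iff tendsto_norm_zero_iff)
  qed
  with r show ?thesis by (intro exI[of _ r]) (auto elim: AE_mp)
qed

text \<open>Riesz-Fischer. A subsequence with increments below \<open>(1/2)^k\<close> is chosen;
  finite measure turns the bounds into summable L1 bounds, so the telescoping series converges
  almost everywhere. Fatou's lemma then upgrades the pointwise limit to a limit in L2 of the whole
  sequence.\<close>

lemma L2_complete:
  fixes f :: "nat \<Rightarrow> 'a::euclidean_space \<Rightarrow> 'b::euclidean_space"
  assumes \<Omega>: "\<Omega> \<in> lmeasurable" and f: "\<And>n. f n \<in> L2 \<Omega>"
    and C: "\<And>e. e > 0 \<Longrightarrow> \<exists>N. \<forall>m\<ge>N. \<forall>n\<ge>N. l2 \<Omega> (\<lambda>x. f m x - f n x) < e"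
  shows "\<exists>g\<in>L2 \<Omega>. (\<lambda>n. l2 \<Omega> (\<lambda>x. f n x - g x)) \<longlonglongrightarrow> 0"
proof -
  let ?M = "lebesgue_on \<Omega>"
  have [measurable]: "f n \<in> borel_measurable ?M" for n using f by (rule L2_measurable)
  have "\<exists>N. \<forall>k. (\<forall>m\<ge>N k. \<forall>n\<ge>N k. l2 \<Omega> (\<lambda>x. f m x - f n x) < (1/2)^k) \<and> N k < N (Suc k)"
  proof (rule dependent_nat_choice)
    show "\<exists>N. \<forall>m\<ge>N. \<forall>n\<ge>N. l2 \<Omega> (\<lambda>x. f m x - f n x) < (1/2)^0" using C[of 1] by simp
    fix N k
    obtain N' where "\<forall>m\<ge>N'. \<forall>n\<ge>N'. l2 \<Omega> (\<lambda>x. f m x - f n x) < (1/2)^Suc k" using C[of "(1/2)^Suc k"] by auto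
    then show "\<exists>N'. (\<forall>m\<ge>N'. \<forall>n\<ge>N'. l2 \<Omega> (\<lambda>x. f m x - f n x) < (1/2)^Suc k) \<and> N < N'"
      by (intro exI[of _ "max N' (Suc N)"]) auto
  qed
  then obtain r where r: "\<And>k m n. m \<ge> r k \<Longrightarrow> n \<ge> r k \<Longrightarrow> l2 \<Omega> (\<lambda>x. f m x - f n x) < (1/2)^k" and rm: "\<And>k. r k < r (Suc k)"
    by blast
  have smr: "strict_mono r" using rm by (simp add: strict_mono_Suc_iff)
  define d where "d k x = f (r (Suc k)) x - f (r k) x" for k x
  have d[measurable]: "d k \<in> borel_measurable ?M" and dL: "d k \<in> L2 \<Omega>" for k
    unfolding d_def by (auto intro: L2_diff f)
  have dn: "(LINT x|?M. norm (d k x)) \<le> sqrt (measure lebesgue \<Omega>) * (1/2)^k" for k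
  proof -
    have "l2 \<Omega> (d k) \<le> (1/2)^k" using r[of k "r (Suc k)" "r k"] rm[of k] by (simp add: d_def[abs_def])
    then show ?thesis using L2_integrable1(2)[OF \<Omega> dL[of k]] by (meson mult_left_mono order_trans real_sqrt_ge_zero measure_nonneg)
  qed
  have "(\<integral>\<^sup>+x. (\<Sum>k. ennreal (norm (d k x))) \<partial>?M) = (\<Sum>k. \<integral>\<^sup>+x. ennreal (norm (d k x)) \<partial>?M)"
    by (rule nn_integral_suminf) simp
  also have "\<dots> \<le> (\<Sum>k. ennreal (sqrt (measure lebesgue \<Omega>) * (1/2)^k))"
  proof (rule suminf_le)
    show "(\<integral>\<^sup>+x. ennreal (norm (d k x)) \<partial>?M) \<le> ennreal (sqrt (measure lebesgue \<Omega>) * (1/2)^k)" for k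
      using dn[of k] L2_integrable1(1)[OF \<Omega> dL[of k]]
      by (subst nn_integral_eq_integral) (auto intro: ennreal_leI)
  qed auto
  also have "\<dots> < \<infinity>"
  proof -
    have "summable (\<lambda>k. sqrt (measure lebesgue \<Omega>) * (1/2::real)^k)" by (intro summable_mult summable_geometric) simp
    then show ?thesis by (simp add: suminf_ennreal2 less_top[symmetric])
  qed
  finally have "(\<integral>\<^sup>+x. (\<Sum>k. ennreal (norm (d k x))) \<partial>?M) \<noteq> \<infinity>" by simp
  then have "AE x in ?M. (\<Sum>k. ennreal (norm (d k x))) \<noteq> \<infinity>"
    by (intro nn_integral_noteq_infinite) measurable
  then have conv: "AE x in ?M. convergent (\<lambda>k. f (r k) x)"
  proof (rule AE_mp, intro AE_I2 impI)
    fix x assume "(\<Sum>k. ennreal (norm (d k x))) \<noteq> \<infinity>"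
    then have "summable (\<lambda>k. norm (d k x))" by (intro summable_suminf_not_top) auto
    then have "summable (\<lambda>k. d k x)" by (rule summable_norm_cancel)
    then have "convergent (\<lambda>n. \<Sum>k<n. d k x)" by (simp add: summable_iff_convergent)
    moreover have "(\<Sum>k<n. d k x) = f (r n) x - f (r 0) x" for n
      unfolding d_def using sum_lessThan_telescope[of "\<lambda>k. f (r k) x" n] by simp
    ultimately have "convergent (\<lambda>n. f (r n) x - f (r 0) x)" by simp
    then show "convergent (\<lambda>n. f (r n) x)" by (simp add: convergent_diff_const_right_iff)
  qed
  define g where "g x = lim (\<lambda>k. f (r k) x)" for x
  have g[measurable]: "g \<in> borel_measurable ?M" unfolding g_def[abs_def] by measurable
  have lim: "AE x in ?M. (\<lambda>k. f (r k) x) \<longlonglongrightarrow> g x"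
    using conv by (auto simp: g_def convergent_LIMSEQ_iff elim: AE_mp)
  \<comment> \<open>Fatou along the subsequence with \<open>n\<close> fixed: the Cauchy bound for
    \<open>f n - f (r j)\<close> survives as \<open>j\<close> tends to infinity, for every
    \<open>n\<close> beyond \<open>r k\<close> and not only along the subsequence.\<close>
  have fat: "(\<integral>\<^sup>+x. ennreal ((norm (f n x - g x))\<^sup>2) \<partial>?M) \<le> ennreal (((1/2)^k)\<^sup>2)" if n: "n \<ge> r k" for n k
  proof -
    have "(\<integral>\<^sup>+x. ennreal ((norm (f n x - g x))\<^sup>2) \<partial>?M) = (\<integral>\<^sup>+x. liminf (\<lambda>j. ennreal ((norm (f n x - f (r j) x))\<^sup>2)) \<partial>?M)"
    proof (rule nn_integral_cong_AE, rule AE_mp[OF lim], intro AE_I2 impI)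
      fix x assume "(\<lambda>k. f (r k) x) \<longlonglongrightarrow> g x"
      then have "(\<lambda>j. ennreal ((norm (f n x - f (r j) x))\<^sup>2)) \<longlonglongrightarrow> ennreal ((norm (f n x - g x))\<^sup>2)"
        by (intro tendsto_intros tendsto_ennrealI)
      then show "ennreal ((norm (f n x - g x))\<^sup>2) = liminf (\<lambda>j. ennreal ((norm (f n x - f (r j) x))\<^sup>2))"
        by (intro lim_imp_Liminf[symmetric]) simp_all
    qed
    also have "\<dots> \<le> liminf (\<lambda>j. \<integral>\<^sup>+x. ennreal ((norm (f n x - f (r j) x))\<^sup>2) \<partial>?M)"
      by (rule nn_integral_liminf) measurable
    also have "\<dots> \<le> ennreal (((1/2)^k)\<^sup>2)"
    proof (rule Liminf_le)
      show "\<forall>\<^sub>F j in sequentially. (\<integral>\<^sup>+x. ennreal ((norm (f n x - f (r j) x))\<^sup>2) \<partial>?M) \<le> ennreal (((1/2)^k)\<^sup>2)"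
      proof (rule eventually_sequentiallyI[of k])
        fix j assume "k \<le> j"
        then have "r k \<le> r j" using smr by (simp add: strict_mono_less_eq)
        then have "l2 \<Omega> (\<lambda>x. f n x - f (r j) x) < (1/2)^k" using r n by auto
        then have "(l2 \<Omega> (\<lambda>x. f n x - f (r j) x))\<^sup>2 \<le> ((1/2)^k)\<^sup>2"
          by (intro power_mono) (auto simp: l2_nonneg)
        then show "(\<integral>\<^sup>+x. ennreal ((norm (f n x - f (r j) x))\<^sup>2) \<partial>?M) \<le> ennreal (((1/2)^k)\<^sup>2)"
          using L2_integrable[OF L2_diff[OF f f]]
            by (subst nn_integral_eq_integral) (auto simp: l2_square ip_self intro!: ennreal_leI)
      qed
    qed simp
    finally show ?thesis .
  qed
  have dif: "(\<lambda>x. f n x - g x) \<in> L2 \<Omega>" if "n \<ge> r k" for n k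
    using fat[OF that] unfolding L2_def by (auto simp: integrable_iff_bounded intro: order.strict_trans1)
  have gL: "g \<in> L2 \<Omega>" using L2_diff[OF f dif[of 0 "r 0"], of "r 0"] by simp
  have le: "l2 \<Omega> (\<lambda>x. f n x - g x) \<le> (1/2)^k" if "n \<ge> r k" for n k
  proof -
    have "ennreal (ip \<Omega> (\<lambda>x. f n x - g x) (\<lambda>x. f n x - g x)) \<le> ennreal (((1/2)^k)\<^sup>2)"
      using fat[OF that] L2_integrable[OF dif[OF that]] unfolding ip_self by (subst (asm) nn_integral_eq_integral) auto
    then have "(l2 \<Omega> (\<lambda>x. f n x - g x))\<^sup>2 \<le> ((1/2)^k)\<^sup>2" unfolding l2_square by (simp add: ennreal_le_iff)
    then show ?thesis by (rule power2_le_imp_le) simp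
  qed
  have "(\<lambda>n. l2 \<Omega> (\<lambda>x. f n x - g x)) \<longlonglongrightarrow> 0"
  proof (rule LIMSEQ_I)
    fix e :: real assume "e > 0"
    then obtain k where "(1/2)^k < e" using real_arch_pow_inv[of e "1/2"] by auto
    then show "\<exists>no. \<forall>n\<ge>no. norm (l2 \<Omega> (\<lambda>x. f n x - g x) - 0) < e"
      using le[of k] by (intro exI[of _ "r k"]) (auto simp: l2_nonneg intro: order.strict_trans1)
  qed
  with gL show ?thesis by blast
qed

subsection \<open>The fundamental lemma of the calculus of variations\<close>

text \<open>The positive and negative parts of \<open>G\<close> are densities of finite-on-boxes
  measures that agree on the open boxes, an intersection-stable generator of the Borel sets; hence
  the measures coincide, and so do the densities almost everywhere.\<close>

lemma integral_boxes_0_imp_AE_0: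
  fixes G :: "'a::euclidean_space \<Rightarrow> real"
  assumes G: "integrable lborel G" and 0: "\<And>a b. (LINT x|lborel. indicator (box a b) x * G x) = 0"
  shows "AE x in lborel. G x = 0"
proof -
  have [measurable]: "G \<in> borel_measurable borel" using G by auto
  define p where "p x = max 0 (G x)" for x
  define m where "m x = max 0 (- G x)" for x
  have [measurable]: "p \<in> borel_measurable borel" "m \<in> borel_measurable borel" unfolding p_def m_def by auto
  have ip: "integrable lborel p" "integrable lborel m" unfolding p_def m_def using G by auto
  have pn: "p x \<ge> 0" "m x \<ge> 0" for x by (auto simp: p_def m_def)
  have e: "density lborel (\<lambda>x. ennreal (p x)) = density lborel (\<lambda>x. ennreal (m x))"
  proof (rule measure_eqI_generator_eq)
    let ?E = "range (\<lambda>(a, b). box a b::'a set)"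
    show "Int_stable ?E" by (auto simp: Int_stable_def box_Int_box)
    show "?E \<subseteq> Pow UNIV" "sets (density lborel (\<lambda>x. ennreal (p x))) = sigma_sets UNIV ?E"
      "sets (density lborel (\<lambda>x. ennreal (m x))) = sigma_sets UNIV ?E"
      by (simp_all add: borel_eq_box)
    let ?A = "\<lambda>n::nat. box (- (real n *\<^sub>R One)) (real n *\<^sub>R One) :: 'a set"
    show "range ?A \<subseteq> ?E" "(\<Union>i. ?A i) = UNIV" unfolding UN_box_eq_UNIV by auto
    have em: "emeasure (density lborel (\<lambda>x. ennreal (q x))) (box a b) = ennreal (LINT x|lborel. indicator (box a b) x * q x)"
      if "integrable lborel q" "\<And>x. q x \<ge> 0" for a b and q :: "'a \<Rightarrow> real"
    proof -
      have [measurable]: "q \<in> borel_measurable borel" using that by auto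
      have "emeasure (density lborel (\<lambda>x. ennreal (q x))) (box a b) = (\<integral>\<^sup>+x. ennreal (indicator (box a b) x * q x) \<partial>lborel)"
        by (subst emeasure_density) (auto intro!: nn_integral_cong simp: indicator_def)
      also have "\<dots> = ennreal (LINT x|lborel. indicator (box a b) x * q x)"
        using integrable_mult_indicator[OF _ that(1), of "box a b"] that(2) by (intro nn_integral_eq_integral) auto
      finally show ?thesis .
    qed
    show "emeasure (density lborel (\<lambda>x. ennreal (p x))) (?A i) \<noteq> \<infinity>" for i
      using em[OF ip(1) pn(1)] by simp
    have pm: "(LINT x|lborel. indicator (box a b) x * p x) = (LINT x|lborel. indicator (box a b) x * m x)" for a b :: 'a
    proof -
      have "(LINT x|lborel. indicator (box a b) x * p x) - (LINT x|lborel. indicator (box a b) x * m x)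
        = (LINT x|lborel. indicator (box a b) x * p x - indicator (box a b) x * m x)"
        using integrable_mult_indicator[OF _ ip(1), of "box a b"] integrable_mult_indicator[OF _ ip(2), of "box a b"]
        by (intro Bochner_Integration.integral_diff[symmetric]) auto
      also have "\<dots> = (LINT x|lborel. indicator (box a b) x * G x)"
        by (intro Bochner_Integration.integral_cong) (auto simp: p_def m_def max_def)
      finally show ?thesis using 0 by simp
    qed
    show "emeasure (density lborel (\<lambda>x. ennreal (p x))) X = emeasure (density lborel (\<lambda>x. ennreal (m x))) X" if "X \<in> ?E" for X
      using that by (auto simp: em[OF ip(1) pn(1)] em[OF ip(2) pn(2)] pm)
  qed
  have "AE x in lborel. ennreal (p x) = ennreal (m x)"
    by (rule sigma_finite_measure.density_unique[OF sigma_finite_lborel _ _ e]) auto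
  then show ?thesis by (rule AE_mp) (auto intro!: AE_I2 simp: p_def m_def max_def split: if_splits)
qed

text \<open>Testing against the functions that increase to the indicator of a box shows that
  \<open>w\<close> has zero integral over every box whose closure lies in the domain. The rest
  localizes to countably many closed boxes that exhaust the domain.\<close>

lemma fundamental_lemma:
  fixes w :: "'a::euclidean_space \<Rightarrow> real"
  assumes \<Omega>: "open \<Omega>" "\<Omega> \<in> lmeasurable" and w: "w \<in> L2 \<Omega>"
    and 0: "\<And>\<phi>. \<phi> \<in> test_functions \<Omega> \<Longrightarrow> (LINT x|lebesgue_on \<Omega>. w x * \<phi> x) = 0"
  shows "AE x in lebesgue_on \<Omega>. w x = 0"
proof -
  let ?M = "lebesgue_on \<Omega>"
  have \<Omega>s: "\<Omega> \<in> sets lebesgue" using \<Omega> by (simp add: fmeasurableD)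
  have wi: "integrable ?M w" by (rule L2_integrable1[OF \<Omega>(2) w])
  have wm[measurable]: "w \<in> borel_measurable ?M" using w by (rule L2_measurable)
  have box0: "(LINT x|?M. indicator (box a b) x * w x) = 0" if ab: "cbox a b \<subseteq> \<Omega>" for a b
  proof -
    have cb: "continuous_on UNIV (box_bump a b)" using C_k_continuous C_k_box_bump by blast
    have [measurable]: "box_bump a b \<in> borel_measurable ?M"
      using cb by (intro borel_measurable_lebesgue_onI borel_measurable_continuous_onI)
    have [measurable]: "(indicator (box a b) :: _ \<Rightarrow> real) \<in> borel_measurable ?M"
      by (intro borel_measurable_lebesgue_onI) simp
    have z: "(\<lambda>n. LINT x|?M. w x * (1 - (1 - box_bump a b x) ^ n)) \<longlonglongrightarrow> (LINT x|?M. indicator (box a b) x * w x)"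
    proof (rule integral_dominated_convergence)
      show "(\<lambda>x. indicator (box a b) x * w x) \<in> borel_measurable ?M" by measurable
      show "(\<lambda>x. w x * (1 - (1 - box_bump a b x) ^ n)) \<in> borel_measurable ?M" for n by measurable
      show "integrable ?M (\<lambda>x. norm (w x))" using wi by simp
      show "AE x in ?M. (\<lambda>n. w x * (1 - (1 - box_bump a b x) ^ n)) \<longlonglongrightarrow> indicator (box a b) x * w x"
      proof (rule AE_I2)
        fix x
        show "(\<lambda>n. w x * (1 - (1 - box_bump a b x) ^ n)) \<longlonglongrightarrow> indicator (box a b) x * w x"
        proof (cases "x \<in> box a b")
          case True
          then have "box_bump a b x > 0" by (simp add: box_bump_pos_iff)
          then have "(\<lambda>n. (1 - box_bump a b x) ^ n) \<longlonglongrightarrow> 0"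
            using box_bump_le_1[of a b x] by (intro LIMSEQ_power_zero) auto
          then have "(\<lambda>n. w x * (1 - (1 - box_bump a b x) ^ n)) \<longlonglongrightarrow> w x * (1 - 0)"
            by (rule tendsto_mult[OF tendsto_const tendsto_diff[OF tendsto_const]])
          then show ?thesis using True by simp
        next
          case False
          then have "box_bump a b x = 0" using box_bump_pos_iff[of a b x] box_bump_nonneg[of a b x] by auto
          then show ?thesis using False by simp
        qed
      qed
      have le1: "\<bar>1 - (1 - box_bump a b x) ^ n\<bar> \<le> 1" for x n
      proof -
        have "0 \<le> (1 - box_bump a b x) ^ n" "(1 - box_bump a b x) ^ n \<le> 1"
          using box_bump_nonneg[of a b x] box_bump_le_1[of a b x] by (auto intro!: zero_le_power power_le_one)
        then show ?thesis by linarith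
      qed
      show "AE x in ?M. norm (w x * (1 - (1 - box_bump a b x) ^ n)) \<le> norm (w x)" for n
        using le1 by (auto intro!: AE_I2 simp: abs_mult mult_left_le)
    qed
    have "(LINT x|?M. w x * (1 - (1 - box_bump a b x) ^ n)) = 0" for n
      by (rule 0) (rule box_bump_test_functions[OF ab])
    then show ?thesis using z by (simp add: LIMSEQ_const_iff)
  qed
  \<comment> \<open>Cutting off at \<open>box c d\<close> makes the arbitrary values of
    \<open>w\<close> outside the domain harmless: intersecting with any further box gives a box
    whose closure stays in \<open>cbox c d\<close>, so \<open>box0\<close> applies.\<close>
  have cbox0: "AE x in lborel. x \<in> cbox c d \<longrightarrow> w x = 0" if cd: "cbox c d \<subseteq> \<Omega>" for c d
  proof -
    define F where "F x = indicator (box c d) x * w x" for x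
    have bs: "box c d \<subseteq> \<Omega>" using cd box_subset_cbox by blast
    have Fe: "(\<lambda>x. indicator \<Omega> x *\<^sub>R F x) = F" using bs by (auto simp: F_def indicator_def fun_eq_iff)
    have "box c d \<in> sets ?M" using bs \<Omega>s by (simp add: sets_restrict_space_iff)
    from integrable_mult_indicator[OF this wi] have "integrable ?M F" by (simp add: F_def[abs_def])
    then have Fi: "integrable lebesgue F" using \<Omega>s by (subst (asm) integrable_restrict_space) (simp_all only: Fe space_completion space_lborel space_borel Int_UNIV_right)
    \<comment> \<open>\<open>F\<close> is only Lebesgue measurable, so the statement about boxes is
      applied to a Borel representative.\<close>
    then obtain G where G[measurable]: "G \<in> borel_measurable lborel" and FG: "AE x in lborel. F x = G x"
      using completion_ex_borel_measurable_real[of F lborel] by auto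
    have FGc: "AE x in lebesgue. F x = G x" using FG by (rule AE_completion)
    have Gi: "integrable lborel G"
    proof -
      have "integrable lebesgue G"
        using Fi FGc G by (subst integrable_cong_AE[of G lebesgue F]) (auto intro: measurable_completion elim: AE_mp)
      then show ?thesis by (simp add: integrable_completion G)
    qed
    have "AE x in lborel. G x = 0"
    proof (rule integral_boxes_0_imp_AE_0[OF Gi])
      fix a b :: 'a
      obtain a' b' where ab': "box a b \<inter> box c d = box a' b'" unfolding box_Int_box by blast
      have "(LINT x|lborel. indicator (box a b) x * G x) = (LINT x|lebesgue. indicator (box a b) x * G x)"
        by (rule integral_completion[symmetric]) measurable
      also have "\<dots> = (LINT x|lebesgue. indicator (box a b) x * F x)"
      proof (rule integral_cong_AE)
        have [measurable]: "F \<in> borel_measurable lebesgue" "G \<in> borel_measurable lebesgue"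
            "(indicator (box a b) :: _ \<Rightarrow> real) \<in> borel_measurable lebesgue"
          using Fi by (auto intro: measurable_completion)
        show "(\<lambda>x. indicator (box a b) x * G x) \<in> borel_measurable lebesgue"
          "(\<lambda>x. indicator (box a b) x * F x) \<in> borel_measurable lebesgue" by measurable
        show "AE x in lebesgue. indicator (box a b) x * G x = indicator (box a b) x * F x"
          using FGc by eventually_elim simp
      qed
      also have "\<dots> = (LINT x|lebesgue. indicator \<Omega> x *\<^sub>R (indicator (box a' b') x * w x))"
        using bs by (intro Bochner_Integration.integral_cong) (auto simp: F_def indicator_def ab'[symmetric])
      also have "\<dots> = (LINT x|?M. indicator (box a' b') x * w x)"
        using \<Omega>s by (subst integral_restrict_space) auto
      also have "\<dots> = 0"
      proof (cases "box a' b' = {}")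
        case False
        then have "cbox a' b' = closure (box a' b')" by (simp add: closure_box)
        also have "\<dots> \<subseteq> cbox c d" using ab' box_subset_cbox[of c d] by (intro closure_minimal) auto
        finally show ?thesis using cd by (intro box0) blast
      qed simp
      finally show "(LINT x|lborel. indicator (box a b) x * G x) = 0" .
    qed
    \<comment> \<open>The cut-off sees the open box only; its boundary is a null set.\<close>
    moreover have "AE x in lborel. x \<notin> cbox c d - box c d"
    proof -
      have "cbox c d - box c d \<in> null_sets lborel"
        using negligible_frontier_interval[of c d] negligible_iff_null_sets by (simp add: negligible_iff_null_sets null_sets_completion_iff)
      then show ?thesis by (rule AE_not_in)
    qed
    ultimately show ?thesis using FG by eventually_elim (auto simp: F_def)
  qed
  obtain \<D> where D: "countable \<D>" "\<D> \<subseteq> Pow \<Omega>" "\<And>X. X \<in> \<D> \<Longrightarrow> \<exists>a b. X = cbox a b" "\<Union>\<D> = \<Omega>"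
    using open_countable_Union_open_cbox[OF \<Omega>(1)] by metis
  have "AE x in lborel. \<forall>X\<in>\<D>. x \<in> X \<longrightarrow> w x = 0"
    using D(2,3) cbox0 by (subst AE_ball_countable[OF D(1)]) blast
  then have "AE x in lborel. x \<in> \<Omega> \<longrightarrow> w x = 0" by (rule AE_mp) (use D(4) in auto)
  then have "AE x in lebesgue. x \<in> \<Omega> \<longrightarrow> w x = 0" by (rule AE_completion)
  then show ?thesis using \<Omega>s by (simp add: AE_restrict_space_iff)
qed

subsection \<open>The Hilbert space structure\<close>

definition tgrad :: "('a::euclidean_space \<Rightarrow> real) \<Rightarrow> 'a \<Rightarrow> 'a" where
  "tgrad \<phi> x = (\<Sum>i\<in>Basis. pd i \<phi> x *\<^sub>R i)"

lemma tgrad_inner_Basis: "i \<in> Basis \<Longrightarrow> tgrad \<phi> x \<bullet> i = pd i \<phi> x"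
  by (simp add: tgrad_def)

lemma L2_inner_const: "f \<in> L2 \<Omega> \<Longrightarrow> (\<lambda>x. f x \<bullet> c) \<in> L2 \<Omega>" for c :: "'b::euclidean_space"
proof -
  assume f: "f \<in> L2 \<Omega>"
  have [measurable]: "f \<in> borel_measurable (lebesgue_on \<Omega>)" using f by (rule L2_measurable)
  have "integrable (lebesgue_on \<Omega>) (\<lambda>x. (norm (f x \<bullet> c))\<^sup>2)"
  proof (rule Bochner_Integration.integrable_bound)
    show "integrable (lebesgue_on \<Omega>) (\<lambda>x. (norm (f x))\<^sup>2 * (norm c)\<^sup>2)"
      using L2_integrable[OF f] by simp
    have "(norm (f x \<bullet> c))\<^sup>2 \<le> (norm (f x))\<^sup>2 * (norm c)\<^sup>2" for x
      using power_mono[OF Cauchy_Schwarz_ineq2[of "f x" c], of 2] by (simp add: power_mult_distrib)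
    then show "AE x in lebesgue_on \<Omega>. norm ((norm (f x \<bullet> c))\<^sup>2) \<le> norm ((norm (f x))\<^sup>2 * (norm c)\<^sup>2)"
      by (auto intro!: AE_I2)
  qed measurable
  then show ?thesis by (simp add: L2_def)
qed

definition gip :: "'a::euclidean_space set \<Rightarrow> ('a \<Rightarrow> real) \<Rightarrow> ('a \<Rightarrow> real) \<Rightarrow> real" where
  "gip \<Omega> u v = ip \<Omega> (weak_grad \<Omega> u) (weak_grad \<Omega> v)"

lemma H01_norm_eq: "H01_norm \<Omega> u = l2 \<Omega> (weak_grad \<Omega> u)"
  by (simp add: H01_norm_def l2_def ip_self)

lemma H1_norm_eq: "H1_norm \<Omega> u = sqrt ((l2 \<Omega> u)\<^sup>2 + (H01_norm \<Omega> u)\<^sup>2)"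
  by (simp add: H1_norm_def H01_norm_eq l2_square ip_self)

lemma H01_norm_nonneg: "H01_norm \<Omega> u \<ge> 0"
  by (simp add: H01_norm_eq l2_nonneg)

lemma H1_L2: "u \<in> H1 \<Omega> \<Longrightarrow> u \<in> L2 \<Omega>"
  by (simp add: H1_def)

lemma H1_weak_grad:
  assumes "u \<in> H1 \<Omega>"
  shows "weak_grad \<Omega> u \<in> L2 \<Omega>" "is_weak_gradient \<Omega> u (weak_grad \<Omega> u)"
proof -
  have "\<exists>g. g \<in> L2 \<Omega> \<and> is_weak_gradient \<Omega> u g" using assms by (auto simp: H1_def)
  from someI_ex[OF this] show "weak_grad \<Omega> u \<in> L2 \<Omega>" "is_weak_gradient \<Omega> u (weak_grad \<Omega> u)"
    by (auto simp: weak_grad_def)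
qed

lemma H01_H1: "u \<in> H01 \<Omega> \<Longrightarrow> u \<in> H1 \<Omega>"
  by (simp add: H01_def)

section \<open>Weak gradients and the gradient inner product on a bounded domain\<close>

locale bounded_dom =
  fixes \<Omega> :: "'a::euclidean_space set"
  assumes dom: "bounded_domain \<Omega>"
begin

lemma open_dom: "open \<Omega>" and bounded_dom: "bounded \<Omega>"
  using dom by (auto simp: bounded_domain_def)

lemma lmeasurable_dom: "\<Omega> \<in> lmeasurable"
  using open_dom bounded_dom by (simp add: lmeasurable_open)

lemma sets_dom: "\<Omega> \<in> sets lebesgue"
  using lmeasurable_dom by (rule fmeasurableD)

lemma continuous_L2:
  fixes f :: "'a \<Rightarrow> 'b::euclidean_space"
  assumes "continuous_on UNIV f" "compact K" "\<And>x. x \<notin> K \<Longrightarrow> f x = 0"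
  shows "f \<in> L2 \<Omega>"
proof -
  obtain B where "\<And>x. norm (f x) \<le> B" using continuous_compact_support_bounded[OF assms] by metis
  then show ?thesis using assms(1)
    by (intro L2_bounded_measurable[OF lmeasurable_dom] borel_measurable_lebesgue_onI borel_measurable_continuous_onI)
qed

lemma test_continuous: "\<phi> \<in> test_functions \<Omega> \<Longrightarrow> continuous_on UNIV \<phi>"
  using C_k_continuous test_functions_C_k by blast

lemma test_L2: "\<phi> \<in> test_functions \<Omega> \<Longrightarrow> \<phi> \<in> L2 \<Omega>"
  using test_functions_support[of \<phi> \<Omega>] continuous_L2[OF test_continuous] by blast

text \<open>The fundamental lemma applied to each component of the difference. It gives control over
  the arbitrary choice inside \<open>weak_grad\<close>: every norm can be computed from whichever
  weak gradient is at hand.\<close>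

lemma weak_gradient_unique:
  assumes "g \<in> L2 \<Omega>" "g' \<in> L2 \<Omega>" "is_weak_gradient \<Omega> u g" "is_weak_gradient \<Omega> u g'"
  shows "AE x in lebesgue_on \<Omega>. g x = g' x"
proof -
  have "AE x in lebesgue_on \<Omega>. (g x - g' x) \<bullet> i = 0" if i: "i \<in> Basis" for i
  proof (rule fundamental_lemma[OF open_dom lmeasurable_dom])
    show "(\<lambda>x. (g x - g' x) \<bullet> i) \<in> L2 \<Omega>" by (intro L2_inner_const L2_diff assms)
    fix \<phi> assume \<phi>: "\<phi> \<in> test_functions \<Omega>"
    have "(LINT x|lebesgue_on \<Omega>. (g x \<bullet> i) * \<phi> x) = (LINT x|lebesgue_on \<Omega>. (g' x \<bullet> i) * \<phi> x)"
      using assms(3)[unfolded is_weak_gradient_def, rule_format, OF \<phi> i]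
        assms(4)[unfolded is_weak_gradient_def, rule_format, OF \<phi> i] by simp
    moreover have "integrable (lebesgue_on \<Omega>) (\<lambda>x. (g x \<bullet> i) * \<phi> x)" "integrable (lebesgue_on \<Omega>) (\<lambda>x. (g' x \<bullet> i) * \<phi> x)"
      using L2_inner_integrable[OF L2_inner_const[OF assms(1)] test_L2[OF \<phi>]]
        L2_inner_integrable[OF L2_inner_const[OF assms(2)] test_L2[OF \<phi>]] by simp_all
    ultimately show "(LINT x|lebesgue_on \<Omega>. (g x - g' x) \<bullet> i * \<phi> x) = 0"
      by (simp add: inner_diff_left left_diff_distrib)
  qed
  then have "AE x in lebesgue_on \<Omega>. \<forall>i\<in>Basis. (g x - g' x) \<bullet> i = 0"
    by (subst AE_ball_countable) (auto simp: countable_finite)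
  then show ?thesis by eventually_elim (auto intro: euclidean_eqI simp: inner_diff_left)
qed

lemma weak_grad_AE:
  assumes "u \<in> L2 \<Omega>" "g \<in> L2 \<Omega>" "is_weak_gradient \<Omega> u g"
  shows "u \<in> H1 \<Omega>" "AE x in lebesgue_on \<Omega>. weak_grad \<Omega> u x = g x"
proof -
  show u: "u \<in> H1 \<Omega>" using assms by (auto simp: H1_def)
  show "AE x in lebesgue_on \<Omega>. weak_grad \<Omega> u x = g x"
    by (rule weak_gradient_unique[OF H1_weak_grad(1)[OF u] assms(2) H1_weak_grad(2)[OF u] assms(3)])
qed

lemma tgrad_L2: "\<phi> \<in> test_functions \<Omega> \<Longrightarrow> tgrad \<phi> \<in> L2 \<Omega>"
  and tgrad_continuous: "\<phi> \<in> test_functions \<Omega> \<Longrightarrow> continuous_on UNIV (tgrad \<phi>)"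
proof -
  assume \<phi>: "\<phi> \<in> test_functions \<Omega>"
  have "(\<lambda>x. \<Sum>i\<in>B. pd i \<phi> x *\<^sub>R i) \<in> L2 \<Omega>" if "finite B" "B \<subseteq> Basis" for B
    using that
  proof (induction B rule: finite_induct)
    case empty
    show ?case by (auto intro: L2_bounded_measurable[OF lmeasurable_dom, of _ 0])
  next
    case (insert i B)
    have "pd i \<phi> \<in> L2 \<Omega>" using insert test_L2 test_functions_pd \<phi> by blast
    then have "(\<lambda>x. pd i \<phi> x *\<^sub>R i) \<in> L2 \<Omega>"
      by (auto simp: L2_def power_mult_distrib)
    then show ?case using insert by (auto intro: L2_add)
  qed
  then show "tgrad \<phi> \<in> L2 \<Omega>" by (auto simp: tgrad_def[abs_def])
  show "continuous_on UNIV (tgrad \<phi>)" unfolding tgrad_def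
    using test_continuous[OF test_functions_pd[OF \<phi>]] by (intro continuous_intros) auto
qed

text \<open>The product of two test functions is a test function, so its partial derivatives
  integrate to zero; the product rule makes this integration by parts.\<close>

lemma is_weak_gradient_tgrad:
  assumes \<phi>: "\<phi> \<in> test_functions \<Omega>"
  shows "is_weak_gradient \<Omega> \<phi> (tgrad \<phi>)"
  unfolding is_weak_gradient_def
proof (intro ballI)
  fix \<psi> i assume \<psi>: "\<psi> \<in> test_functions \<Omega>" and i: "i \<in> (Basis :: 'a set)"
  note p = test_functions_mult[OF \<phi> \<psi>]
  have e: "pd i (\<lambda>x. \<phi> x * \<psi> x) x = \<phi> x * pd i \<psi> x + pd i \<phi> x * \<psi> x" for x
    using frechet_derivative_at[OF has_derivative_mult[OF test_functions_differentiable[OF \<phi>, of x, unfolded frechet_derivative_works]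
       test_functions_differentiable[OF \<psi>, of x, unfolded frechet_derivative_works]], THEN fun_cong, of i] by simp
  have i1: "integrable (lebesgue_on \<Omega>) (\<lambda>x. \<phi> x * pd i \<psi> x)" "integrable (lebesgue_on \<Omega>) (\<lambda>x. pd i \<phi> x * \<psi> x)"
    using L2_inner_integrable[OF test_L2[OF \<phi>] test_L2[OF test_functions_pd[OF \<psi> i]]]
      L2_inner_integrable[OF test_L2[OF test_functions_pd[OF \<phi> i]] test_L2[OF \<psi>]] by simp_all
  obtain K where K: "K \<subseteq> \<Omega>" "\<And>x. x \<notin> K \<Longrightarrow> pd i (\<lambda>x. \<phi> x * \<psi> x) x = 0"
    using test_functions_support[OF test_functions_pd[OF p i]] by blast
  have "(LINT x|lebesgue_on \<Omega>. pd i (\<lambda>x. \<phi> x * \<psi> x) x) = (LINT x|lborel. pd i (\<lambda>x. \<phi> x * \<psi> x) x)"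
    using K by (intro lebesgue_on_lborel sets_dom borel_measurable_continuous_onI test_continuous[OF test_functions_pd[OF p i]]) auto
  also have "\<dots> = 0" by (rule integral_pd_eq_0[OF p i])
  finally have "(LINT x|lebesgue_on \<Omega>. \<phi> x * pd i \<psi> x) + (LINT x|lebesgue_on \<Omega>. pd i \<phi> x * \<psi> x) = 0"
    using i1 by (simp add: e)
  then show "(LINT x|lebesgue_on \<Omega>. \<phi> x * pd i \<psi> x) = - (LINT x|lebesgue_on \<Omega>. tgrad \<phi> x \<bullet> i * \<psi> x)"
    by (simp add: tgrad_inner_Basis[OF i])
qed

lemma is_weak_gradient_lincomb:
  assumes "u \<in> L2 \<Omega>" "v \<in> L2 \<Omega>" "g \<in> L2 \<Omega>" "h \<in> L2 \<Omega>" "is_weak_gradient \<Omega> u g" "is_weak_gradient \<Omega> v h"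
  shows "is_weak_gradient \<Omega> (\<lambda>x. c * u x + d * v x) (\<lambda>x. c *\<^sub>R g x + d *\<^sub>R h x)"
  unfolding is_weak_gradient_def
proof (intro ballI)
  fix \<phi> i assume \<phi>: "\<phi> \<in> test_functions \<Omega>" and i: "i \<in> (Basis :: 'a set)"
  note t = test_L2[OF \<phi>] and tp = test_L2[OF test_functions_pd[OF \<phi> i]]
  have ints: "integrable (lebesgue_on \<Omega>) (\<lambda>x. u x * pd i \<phi> x)" "integrable (lebesgue_on \<Omega>) (\<lambda>x. v x * pd i \<phi> x)"
    "integrable (lebesgue_on \<Omega>) (\<lambda>x. (g x \<bullet> i) * \<phi> x)" "integrable (lebesgue_on \<Omega>) (\<lambda>x. (h x \<bullet> i) * \<phi> x)"
    using L2_inner_integrable[OF assms(1) tp] L2_inner_integrable[OF assms(2) tp]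
      L2_inner_integrable[OF L2_inner_const[OF assms(3)] t] L2_inner_integrable[OF L2_inner_const[OF assms(4)] t] by simp_all
  have "(LINT x|lebesgue_on \<Omega>. (c * u x + d * v x) * pd i \<phi> x)
     = c * (LINT x|lebesgue_on \<Omega>. u x * pd i \<phi> x) + d * (LINT x|lebesgue_on \<Omega>. v x * pd i \<phi> x)"
    using ints by (simp add: distrib_right mult.assoc)
  also have "\<dots> = c * - (LINT x|lebesgue_on \<Omega>. (g x \<bullet> i) * \<phi> x) + d * - (LINT x|lebesgue_on \<Omega>. (h x \<bullet> i) * \<phi> x)"
    using assms(5,6) \<phi> i by (simp add: is_weak_gradient_def)
  also have "\<dots> = - (LINT x|lebesgue_on \<Omega>. (c *\<^sub>R g x + d *\<^sub>R h x) \<bullet> i * \<phi> x)"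
    using ints by (simp add: inner_add_left distrib_right mult.assoc)
  finally show "(LINT x|lebesgue_on \<Omega>. (c * u x + d * v x) * pd i \<phi> x) = - (LINT x|lebesgue_on \<Omega>. (c *\<^sub>R g x + d *\<^sub>R h x) \<bullet> i * \<phi> x)" .
qed

lemma
  assumes "u \<in> H1 \<Omega>" "v \<in> H1 \<Omega>"
  shows H1_lincomb: "(\<lambda>x. c * u x + d * v x) \<in> H1 \<Omega>"
    and weak_grad_lincomb:
      "AE x in lebesgue_on \<Omega>. weak_grad \<Omega> (\<lambda>x. c * u x + d * v x) x = c *\<^sub>R weak_grad \<Omega> u x + d *\<^sub>R weak_grad \<Omega> v x"
proof -
  note g = H1_weak_grad[OF assms(1)] and h = H1_weak_grad[OF assms(2)]
  have "(\<lambda>x. c * u x + d * v x) \<in> L2 \<Omega>"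
    using L2_lincomb[OF H1_L2[OF assms(1)] H1_L2[OF assms(2)], of c d] by simp
  from weak_grad_AE[OF this L2_lincomb[OF g(1) h(1)] is_weak_gradient_lincomb[OF H1_L2[OF assms(1)] H1_L2[OF assms(2)] g(1) h(1) g(2) h(2)]]
  show "(\<lambda>x. c * u x + d * v x) \<in> H1 \<Omega>"
    "AE x in lebesgue_on \<Omega>. weak_grad \<Omega> (\<lambda>x. c * u x + d * v x) x = c *\<^sub>R weak_grad \<Omega> u x + d *\<^sub>R weak_grad \<Omega> v x" .
qed

lemma gip_commute: "gip \<Omega> u v = gip \<Omega> v u"
  by (simp add: gip_def ip_commute)

lemma gip_self: "gip \<Omega> u u = (H01_norm \<Omega> u)\<^sup>2"
  by (simp add: gip_def H01_norm_eq l2_square)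

lemma gip_lincomb_left:
  assumes "u \<in> H1 \<Omega>" "v \<in> H1 \<Omega>" "w \<in> H1 \<Omega>"
  shows "gip \<Omega> (\<lambda>x. c * u x + d * v x) w = c * gip \<Omega> u w + d * gip \<Omega> v w"
proof -
  note g = H1_weak_grad(1)
  have "gip \<Omega> (\<lambda>x. c * u x + d * v x) w
    = ip \<Omega> (\<lambda>x. c *\<^sub>R weak_grad \<Omega> u x + d *\<^sub>R weak_grad \<Omega> v x) (weak_grad \<Omega> w)"
    unfolding gip_def
    by (rule ip_cong_AE) (auto intro!: L2_measurable g L2_lincomb H1_lincomb assms weak_grad_lincomb)
  then show ?thesis using ip_lincomb_left[OF g g g] assms by (simp add: gip_def)
qed

lemma gip_lincomb_self:
  assumes "u \<in> H1 \<Omega>" "v \<in> H1 \<Omega>"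
  shows "(H01_norm \<Omega> (\<lambda>x. c * u x + d * v x))\<^sup>2 = c\<^sup>2 * (H01_norm \<Omega> u)\<^sup>2 + 2 * c * d * gip \<Omega> u v + d\<^sup>2 * (H01_norm \<Omega> v)\<^sup>2"
  unfolding gip_self[symmetric] gip_lincomb_left[OF assms H1_lincomb[OF assms]]
    gip_commute[of _ "\<lambda>x. c * u x + d * v x"] gip_lincomb_left[OF assms assms(1)] gip_lincomb_left[OF assms assms(2)]
    gip_commute[of v u]
  by (simp add: algebra_simps power2_eq_square)

lemma gip_Cauchy_Schwarz: "u \<in> H1 \<Omega> \<Longrightarrow> v \<in> H1 \<Omega> \<Longrightarrow> \<bar>gip \<Omega> u v\<bar> \<le> H01_norm \<Omega> u * H01_norm \<Omega> v"
  unfolding gip_def H01_norm_eq by (intro ip_Cauchy_Schwarz H1_weak_grad)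

lemma H01_norm_scale: "u \<in> H1 \<Omega> \<Longrightarrow> H01_norm \<Omega> (\<lambda>x. c * u x) = \<bar>c\<bar> * H01_norm \<Omega> u"
  by (rule power2_eq_imp_eq)
    (use gip_lincomb_self[of u u c 0] in \<open>simp_all add: power_mult_distrib H01_norm_nonneg\<close>)

lemma H01_norm_lincomb_le:
  assumes "u \<in> H1 \<Omega>" "v \<in> H1 \<Omega>"
  shows "H01_norm \<Omega> (\<lambda>x. c * u x + d * v x) \<le> \<bar>c\<bar> * H01_norm \<Omega> u + \<bar>d\<bar> * H01_norm \<Omega> v"
proof -
  note g = H1_weak_grad(1)
  have "H01_norm \<Omega> (\<lambda>x. c * u x + d * v x) = l2 \<Omega> (\<lambda>x. c *\<^sub>R weak_grad \<Omega> u x + d *\<^sub>R weak_grad \<Omega> v x)"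
    unfolding H01_norm_eq
    by (rule l2_cong_AE) (auto intro!: L2_measurable g L2_lincomb H1_lincomb assms weak_grad_lincomb)
  then show ?thesis using l2_lincomb_le[OF g g] assms by (simp add: H01_norm_eq)
qed

lemma test_H1:
  assumes "\<phi> \<in> test_functions \<Omega>"
  shows "\<phi> \<in> H1 \<Omega>" "AE x in lebesgue_on \<Omega>. weak_grad \<Omega> \<phi> x = tgrad \<phi> x"
  using weak_grad_AE[OF test_L2 tgrad_L2 is_weak_gradient_tgrad] assms by blast+

lemma H01_norm_test: "\<phi> \<in> test_functions \<Omega> \<Longrightarrow> H01_norm \<Omega> \<phi> = l2 \<Omega> (tgrad \<phi>)"
  unfolding H01_norm_eq using test_H1 by (intro l2_cong_AE L2_measurable H1_weak_grad tgrad_L2) auto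

lemma H1_diff: "u \<in> H1 \<Omega> \<Longrightarrow> v \<in> H1 \<Omega> \<Longrightarrow> (\<lambda>x. u x - v x) \<in> H1 \<Omega>"
  using H1_lincomb[of u v 1 "-1"] by simp

section \<open>The closure of the test functions\<close>

lemma H01_iff:
  "u \<in> H01 \<Omega> \<longleftrightarrow> u \<in> H1 \<Omega> \<and>
    (\<forall>e>0. \<exists>\<phi>\<in>test_functions \<Omega>. l2 \<Omega> (\<lambda>x. u x - \<phi> x) < e \<and> H01_norm \<Omega> (\<lambda>x. u x - \<phi> x) < e)"
  (is "_ \<longleftrightarrow> _ \<and> ?P")
proof -
  have a: "l2 \<Omega> w \<le> H1_norm \<Omega> w" "H01_norm \<Omega> w \<le> H1_norm \<Omega> w" "H1_norm \<Omega> w \<le> l2 \<Omega> w + H01_norm \<Omega> w" for w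
    unfolding H1_norm_eq using l2_nonneg[of \<Omega> w] H01_norm_nonneg[of \<Omega> w]
    by (auto intro!: real_le_rsqrt sqrt_sum_squares_le_sum)
  have "?P" if "\<forall>e>0. \<exists>\<phi>\<in>test_functions \<Omega>. H1_norm \<Omega> (\<lambda>x. u x - \<phi> x) < e"
  proof (intro allI impI)
    fix e :: real assume "e > 0"
    with that obtain \<phi> where "\<phi> \<in> test_functions \<Omega>" "H1_norm \<Omega> (\<lambda>x. u x - \<phi> x) < e" by blast
    then show "\<exists>\<phi>\<in>test_functions \<Omega>. l2 \<Omega> (\<lambda>x. u x - \<phi> x) < e \<and> H01_norm \<Omega> (\<lambda>x. u x - \<phi> x) < e"
      using a(1,2)[of "\<lambda>x. u x - \<phi> x"] by (intro bexI[of _ \<phi>]) auto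
  qed
  moreover have "\<exists>\<phi>\<in>test_functions \<Omega>. H1_norm \<Omega> (\<lambda>x. u x - \<phi> x) < e" if ?P "e > 0" for e
  proof -
    from that(2) have "e / 2 > 0" by simp
    with that(1) obtain \<phi> where "\<phi> \<in> test_functions \<Omega>" "l2 \<Omega> (\<lambda>x. u x - \<phi> x) < e/2" "H01_norm \<Omega> (\<lambda>x. u x - \<phi> x) < e/2" by blast
    then show ?thesis using a(3)[of "\<lambda>x. u x - \<phi> x"] by (intro bexI[of _ \<phi>]) auto
  qed
  ultimately show ?thesis by (auto simp: H01_def)
qed

lemma test_H01: "\<phi> \<in> test_functions \<Omega> \<Longrightarrow> \<phi> \<in> H01 \<Omega>"
proof -
  assume \<phi>: "\<phi> \<in> test_functions \<Omega>"
  have "H01_norm \<Omega> (\<lambda>x. \<phi> x - \<phi> x) = 0" "l2 \<Omega> (\<lambda>x. \<phi> x - \<phi> x) = 0"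
    using H01_norm_scale[OF test_H1(1)[OF \<phi>], of 0] l2_scale[of \<Omega> 0 \<phi>] by simp_all
  then show ?thesis using \<phi> test_H1(1)[OF \<phi>] unfolding H01_iff by (auto intro!: bexI[of _ \<phi>])
qed

lemma H01_lincomb:
  assumes u: "u \<in> H01 \<Omega>" and v: "v \<in> H01 \<Omega>"
  shows "(\<lambda>x. c * u x + d * v x) \<in> H01 \<Omega>"
  unfolding H01_iff
proof (intro conjI allI impI)
  have H1: "u \<in> H1 \<Omega>" "v \<in> H1 \<Omega>" using assms by (auto simp: H01_H1)
  then show "(\<lambda>x. c * u x + d * v x) \<in> H1 \<Omega>" by (rule H1_lincomb)
  fix e :: real assume e: "e > 0"
  define e' where "e' = e / (\<bar>c\<bar> + \<bar>d\<bar> + 1)"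
  have e': "e' > 0" "(\<bar>c\<bar> + \<bar>d\<bar>) * e' < e" using e by (auto simp: e'_def field_simps add_nonneg_pos)
  obtain \<phi> where p: "\<phi> \<in> test_functions \<Omega>" "l2 \<Omega> (\<lambda>x. u x - \<phi> x) < e'" "H01_norm \<Omega> (\<lambda>x. u x - \<phi> x) < e'"
    using u e'(1) unfolding H01_iff by blast
  obtain \<psi> where q: "\<psi> \<in> test_functions \<Omega>" "l2 \<Omega> (\<lambda>x. v x - \<psi> x) < e'" "H01_norm \<Omega> (\<lambda>x. v x - \<psi> x) < e'"
    using v e'(1) unfolding H01_iff by blast
  have eq: "(\<lambda>x. c * u x + d * v x - (c * \<phi> x + d * \<psi> x)) = (\<lambda>x. c * (u x - \<phi> x) + d * (v x - \<psi> x))"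
    by (auto simp: algebra_simps)
  have D: "(\<lambda>x. u x - \<phi> x) \<in> H1 \<Omega>" "(\<lambda>x. v x - \<psi> x) \<in> H1 \<Omega>"
    by (intro H1_diff H1 test_H1(1) p(1) q(1))+
  have le: "\<bar>c\<bar> * r + \<bar>d\<bar> * s < e" if "r < e'" "s < e'" for r s
  proof -
    have "\<bar>c\<bar> * r + \<bar>d\<bar> * s \<le> \<bar>c\<bar> * e' + \<bar>d\<bar> * e'" using that by (intro add_mono mult_left_mono) auto
    then show ?thesis using e'(2) by (simp add: distrib_right)
  qed
  have "l2 \<Omega> (\<lambda>x. c * (u x - \<phi> x) + d * (v x - \<psi> x)) < e"
    using l2_lincomb_le[OF D[THEN H1_L2], of c d] le[OF p(2) q(2)] by simp
  moreover have "H01_norm \<Omega> (\<lambda>x. c * (u x - \<phi> x) + d * (v x - \<psi> x)) < e"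
    using H01_norm_lincomb_le[OF D, of c d] le[OF p(3) q(3)] by simp
  ultimately show "\<exists>\<phi>\<in>test_functions \<Omega>. l2 \<Omega> (\<lambda>x. c * u x + d * v x - \<phi> x) < e \<and> H01_norm \<Omega> (\<lambda>x. c * u x + d * v x - \<phi> x) < e"
    using test_functions_lincomb[OF p(1) q(1), of c d] eq by (intro bexI[of _ "\<lambda>x. c * \<phi> x + d * \<psi> x"]) simp_all
qed

lemma H01_add: "u \<in> H01 \<Omega> \<Longrightarrow> v \<in> H01 \<Omega> \<Longrightarrow> (\<lambda>x. u x + v x) \<in> H01 \<Omega>"
  and H01_diff: "u \<in> H01 \<Omega> \<Longrightarrow> v \<in> H01 \<Omega> \<Longrightarrow> (\<lambda>x. u x - v x) \<in> H01 \<Omega>"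
  and H01_scale: "u \<in> H01 \<Omega> \<Longrightarrow> (\<lambda>x. c * u x) \<in> H01 \<Omega>"
  using H01_lincomb[of u v 1 1] H01_lincomb[of u v 1 "-1"] H01_lincomb[of u u c 0] by simp_all

lemma H01_norm_triangle: "u \<in> H01 \<Omega> \<Longrightarrow> v \<in> H01 \<Omega> \<Longrightarrow> H01_norm \<Omega> (\<lambda>x. u x + v x) \<le> H01_norm \<Omega> u + H01_norm \<Omega> v"
  and H01_norm_triangle_diff: "u \<in> H01 \<Omega> \<Longrightarrow> v \<in> H01 \<Omega> \<Longrightarrow> H01_norm \<Omega> (\<lambda>x. u x - v x) \<le> H01_norm \<Omega> u + H01_norm \<Omega> v"
  using H01_norm_lincomb_le[of u v 1 1] H01_norm_lincomb_le[of u v 1 "-1"] H01_H1 by force+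

text \<open>The weak gradients are Cauchy in L2 and converge to some \<open>G\<close>. The defining
  identity of a weak gradient is continuous in both \<open>u\<close> and the gradient for a fixed
  test function, so \<open>G\<close> is a weak gradient of the limit, and a diagonal choice of test
  functions puts the limit into \<open>H01\<close>.\<close>

lemma H01_closed:
  assumes u: "u \<in> L2 \<Omega>" and v: "\<And>k. v k \<in> H01 \<Omega>" and lim: "(\<lambda>k. l2 \<Omega> (\<lambda>x. v k x - u x)) \<longlonglongrightarrow> 0"
    and C: "\<And>e. e > 0 \<Longrightarrow> \<exists>N. \<forall>m\<ge>N. \<forall>n\<ge>N. H01_norm \<Omega> (\<lambda>x. v m x - v n x) < e"
  shows "u \<in> H01 \<Omega>" "(\<lambda>k. H01_norm \<Omega> (\<lambda>x. v k x - u x)) \<longlonglongrightarrow> 0"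
proof -
  have vH: "v k \<in> H1 \<Omega>" for k using v by (rule H01_H1)
  note g = H1_weak_grad[OF vH]
  have gd: "l2 \<Omega> (\<lambda>x. weak_grad \<Omega> (v m) x - weak_grad \<Omega> (v n) x) = H01_norm \<Omega> (\<lambda>x. v m x - v n x)" for m n
    unfolding H01_norm_eq using weak_grad_lincomb[OF vH[of m] vH[of n], of 1 "-1"]
    by (intro l2_cong_AE L2_measurable L2_diff g H1_weak_grad H1_diff vH) (auto elim: AE_mp)
  obtain G where G: "G \<in> L2 \<Omega>" "(\<lambda>k. l2 \<Omega> (\<lambda>x. weak_grad \<Omega> (v k) x - G x)) \<longlonglongrightarrow> 0"
    using L2_complete[OF lmeasurable_dom, of "\<lambda>k. weak_grad \<Omega> (v k)"] g(1) C unfolding gd by blast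
  have tend: "(\<lambda>k. ip \<Omega> (f k) h) \<longlonglongrightarrow> ip \<Omega> F h"
    if "\<And>k. f k \<in> L2 \<Omega>" "F \<in> L2 \<Omega>" "h \<in> L2 \<Omega>" "(\<lambda>k. l2 \<Omega> (\<lambda>x. f k x - F x)) \<longlonglongrightarrow> 0" for f F and h :: "'a \<Rightarrow> real"
  proof -
    have z: "(\<lambda>k. l2 \<Omega> (\<lambda>x. f k x - F x) * l2 \<Omega> h) \<longlonglongrightarrow> 0" using tendsto_mult_left_zero[OF that(4)] by simp
    have "norm (ip \<Omega> (f k) h - ip \<Omega> F h) \<le> l2 \<Omega> (\<lambda>x. f k x - F x) * l2 \<Omega> h" for k
      using ip_Cauchy_Schwarz[OF L2_diff[OF that(1)[of k] that(2)] that(3)] ip_lincomb_left[OF that(1)[of k] that(2,3), of 1 "-1"] by simp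
    then have "(\<lambda>k. ip \<Omega> (f k) h - ip \<Omega> F h) \<longlonglongrightarrow> 0"
      by (intro Lim_null_comparison[OF always_eventually z] allI)
    then show ?thesis by (simp add: LIM_zero_iff)
  qed
  have wg: "is_weak_gradient \<Omega> u G"
    unfolding is_weak_gradient_def
  proof (intro ballI)
    fix \<phi> i assume \<phi>: "\<phi> \<in> test_functions \<Omega>" and i: "i \<in> (Basis :: 'a set)"
    have l1: "(\<lambda>k. ip \<Omega> (v k) (pd i \<phi>)) \<longlonglongrightarrow> ip \<Omega> u (pd i \<phi>)"
      by (rule tend) (use vH H1_L2 u lim test_L2[OF test_functions_pd[OF \<phi> i]] in auto)
    have "(\<lambda>k. l2 \<Omega> (\<lambda>x. weak_grad \<Omega> (v k) x \<bullet> i - G x \<bullet> i)) \<longlonglongrightarrow> 0"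
    proof (rule Lim_null_comparison[OF _ G(2)], rule eventuallyI)
      fix k
      have d: "(\<lambda>x. weak_grad \<Omega> (v k) x - G x) \<in> L2 \<Omega>" by (intro L2_diff g G)
      have "ip \<Omega> (\<lambda>x. (weak_grad \<Omega> (v k) x - G x) \<bullet> i) (\<lambda>x. (weak_grad \<Omega> (v k) x - G x) \<bullet> i)
        \<le> ip \<Omega> (\<lambda>x. weak_grad \<Omega> (v k) x - G x) (\<lambda>x. weak_grad \<Omega> (v k) x - G x)"
        unfolding ip_self
      proof (rule integral_mono)
        show "(norm ((weak_grad \<Omega> (v k) x - G x) \<bullet> i))\<^sup>2 \<le> (norm (weak_grad \<Omega> (v k) x - G x))\<^sup>2" for x
          using Basis_le_norm[OF i] by (intro power_mono) auto
      qed (rule L2_integrable[OF L2_inner_const[OF d]], rule L2_integrable[OF d])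
      then show "norm (l2 \<Omega> (\<lambda>x. weak_grad \<Omega> (v k) x \<bullet> i - G x \<bullet> i)) \<le> l2 \<Omega> (\<lambda>x. weak_grad \<Omega> (v k) x - G x)"
        by (simp add: l2_def inner_diff_left ip_self_nonneg)
    qed
    then have l2: "(\<lambda>k. ip \<Omega> (\<lambda>x. weak_grad \<Omega> (v k) x \<bullet> i) \<phi>) \<longlonglongrightarrow> ip \<Omega> (\<lambda>x. G x \<bullet> i) \<phi>"
      by (intro tend L2_inner_const g G test_L2 \<phi>)
    have "ip \<Omega> (v k) (pd i \<phi>) = - ip \<Omega> (\<lambda>x. weak_grad \<Omega> (v k) x \<bullet> i) \<phi>" for k
      using g(2)[of k] \<phi> i by (simp add: is_weak_gradient_def ip_def)
    with l1 tendsto_minus[OF l2] have "ip \<Omega> u (pd i \<phi>) = - ip \<Omega> (\<lambda>x. G x \<bullet> i) \<phi>"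
      by (simp add: LIMSEQ_unique)
    then show "(LINT x|lebesgue_on \<Omega>. u x * pd i \<phi> x) = - (LINT x|lebesgue_on \<Omega>. G x \<bullet> i * \<phi> x)"
      by (simp add: ip_def)
  qed
  note uH = weak_grad_AE[OF u G(1) wg]
  have e: "H01_norm \<Omega> (\<lambda>x. v k x - u x) = l2 \<Omega> (\<lambda>x. weak_grad \<Omega> (v k) x - G x)" for k
  proof -
    have "AE x in lebesgue_on \<Omega>. weak_grad \<Omega> (\<lambda>x. v k x - u x) x = weak_grad \<Omega> (v k) x - weak_grad \<Omega> u x"
      using weak_grad_lincomb[OF vH[of k] uH(1), of 1 "-1"] by simp
    then have "AE x in lebesgue_on \<Omega>. weak_grad \<Omega> (\<lambda>x. v k x - u x) x = weak_grad \<Omega> (v k) x - G x"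
      using uH(2) by eventually_elim simp
    then show ?thesis unfolding H01_norm_eq
      by (intro l2_cong_AE L2_measurable L2_diff g H1_weak_grad H1_diff vH uH G) auto
  qed
  show c: "(\<lambda>k. H01_norm \<Omega> (\<lambda>x. v k x - u x)) \<longlonglongrightarrow> 0" unfolding e by (rule G(2))
  show "u \<in> H01 \<Omega>" unfolding H01_iff
  proof (intro conjI allI impI uH(1))
    fix e :: real assume "e > 0"
    then have "e / 2 > 0" by simp
    obtain k where k: "H01_norm \<Omega> (\<lambda>x. v k x - u x) < e/2" "l2 \<Omega> (\<lambda>x. v k x - u x) < e/2"
      using eventually_conj[OF order_tendstoD(2)[OF c \<open>e/2>0\<close>] order_tendstoD(2)[OF lim \<open>e/2>0\<close>]]
      by (auto simp: eventually_sequentially)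
    obtain \<phi> where p: "\<phi> \<in> test_functions \<Omega>" "l2 \<Omega> (\<lambda>x. v k x - \<phi> x) < e/2" "H01_norm \<Omega> (\<lambda>x. v k x - \<phi> x) < e/2"
      using v[of k] \<open>e/2>0\<close> unfolding H01_iff by blast
    have D: "(\<lambda>x. v k x - \<phi> x) \<in> H1 \<Omega>" "(\<lambda>x. v k x - u x) \<in> H1 \<Omega>"
      by (intro H1_diff vH uH test_H1 p)+
    have "l2 \<Omega> (\<lambda>x. u x - \<phi> x) < e" "H01_norm \<Omega> (\<lambda>x. u x - \<phi> x) < e"
      using l2_lincomb_le[OF D[THEN H1_L2], of 1 "-1"] H01_norm_lincomb_le[OF D, of 1 "-1"] k p by simp_all
    then show "\<exists>\<phi>\<in>test_functions \<Omega>. l2 \<Omega> (\<lambda>x. u x - \<phi> x) < e \<and> H01_norm \<Omega> (\<lambda>x. u x - \<phi> x) < e"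
      using p(1) by blast
  qed
qed

end

subsection \<open>Rellich compactness\<close>

lemma nn_integral_lborel_shift:
  fixes f :: "'a::euclidean_space \<Rightarrow> ennreal"
  assumes "f \<in> borel_measurable borel"
  shows "(\<integral>\<^sup>+x. f (x + c) \<partial>lborel) = (\<integral>\<^sup>+x. f x \<partial>lborel)"
  using nn_integral_distr[of "(+) c" lborel borel f] assms lborel_distr_plus[of c]
  by (simp add: add.commute)

lemma integral_lborel_shift:
  fixes f :: "'a::euclidean_space \<Rightarrow> real"
  assumes "f \<in> borel_measurable borel"
  shows "(LINT x|lborel. f (c + x)) = (LINT x|lborel. f x)"
  using integral_distr[of "(+) c" lborel borel f] assms lborel_distr_plus[of c] by simp

text \<open>Averaging against a Lipschitz kernel of radius \<open>d\<close> moves a test function by at most \<open>d\<close> times the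
  norm of its gradient in \<open>L\<^sup>2\<close>, and makes bounded families equicontinuous.\<close>

definition cone_kernel :: "real \<Rightarrow> 'a::euclidean_space \<Rightarrow> real" where
  "cone_kernel d z = max 0 (d - norm z)"

definition mollify :: "real \<Rightarrow> ('a::euclidean_space \<Rightarrow> real) \<Rightarrow> 'a \<Rightarrow> real" where
  "mollify d w x = (LINT z|lborel. cone_kernel d z * w (x + z)) / (LINT z|lborel. cone_kernel d (z::'a))"

lemma cone_kernel_nonneg: "cone_kernel d z \<ge> 0" and cone_kernel_0: "z \<notin> cball 0 d \<Longrightarrow> cone_kernel d z = 0"
  and cone_kernel_le: "d \<ge> 0 \<Longrightarrow> cone_kernel d z \<le> d"
  and cone_kernel_lipschitz: "\<bar>cone_kernel d z - cone_kernel d z'\<bar> \<le> norm (z - z')"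
  and cone_kernel_continuous: "continuous_on UNIV (cone_kernel d)"
proof -
  show "\<bar>cone_kernel d z - cone_kernel d z'\<bar> \<le> norm (z - z')"
    using norm_triangle_ineq3[of z z'] by (auto simp: cone_kernel_def)
  show "continuous_on UNIV (cone_kernel d)" unfolding cone_kernel_def[abs_def] by (intro continuous_intros)
qed (auto simp: cone_kernel_def)

lemma cone_kernel_borel[measurable]: "cone_kernel d \<in> borel_measurable borel"
  by (intro borel_measurable_continuous_onI cone_kernel_continuous)

lemma cone_kernel_integrable:
  fixes w :: "'a::euclidean_space \<Rightarrow> real"
  assumes "continuous_on UNIV w"
  shows "integrable lborel (\<lambda>z. cone_kernel d z * w z)"
  by (rule continuous_compact_support_integrable[of _ "cball 0 d"])
    (auto intro!: continuous_intros cone_kernel_continuous assms simp: cone_kernel_0)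

lemma cone_kernel_integral_pos:
  assumes "d > 0"
  shows "(LINT z|lborel. cone_kernel d (z::'a::euclidean_space)) > 0"
proof -
  have i: "integrable lborel (cone_kernel d :: 'a \<Rightarrow> real)" using cone_kernel_integrable[of "\<lambda>_. 1" d] by simp
  have fin: "emeasure lborel (ball (0::'a) (d/2)) < \<infinity>" by (rule emeasure_bounded_finite) simp
  have "0 < d / 2 * measure lborel (ball (0::'a) (d/2))" using assms by (simp add: content_ball_pos)
  also have "\<dots> = (LINT z|lborel. d / 2 * indicator (ball (0::'a) (d/2)) z)" by simp
  also have "\<dots> \<le> (LINT z|lborel. cone_kernel d (z::'a))"
  proof (rule integral_mono[OF _ i])
    show "integrable lborel (\<lambda>z. d / 2 * indicat_real (ball (0::'a) (d/2)) z)"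
      using fin by (intro integrable_mult_right integrable_real_indicator) auto
    show "d / 2 * indicator (ball 0 (d/2)) z \<le> cone_kernel d z" for z :: 'a
      by (auto simp: indicator_def cone_kernel_def max_def)
  qed
  finally show ?thesis .
qed

text \<open>After a shift of variables, \<open>x\<close> occurs in the kernel only, which is
  1-Lipschitz and at most \<open>d\<close>. Both bounds therefore involve \<open>w\<close> through
  its L1 norm alone, which is what makes them uniform on bounded families.\<close>

lemma mollify_lipschitz:
  fixes w :: "'a::euclidean_space \<Rightarrow> real"
  assumes d: "d > 0" and w: "continuous_on UNIV w" "compact K" "\<And>x. x \<notin> K \<Longrightarrow> w x = 0"
  shows "\<bar>mollify d w x - mollify d w y\<bar> \<le> norm (x - y) * ((LINT z|lborel. \<bar>w z\<bar>) / (LINT z|lborel. cone_kernel d (z::'a)))"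
    and "\<bar>mollify d w x\<bar> \<le> d * ((LINT z|lborel. \<bar>w z\<bar>) / (LINT z|lborel. cone_kernel d (z::'a)))"
proof -
  let ?c = "LINT z|lborel. cone_kernel d (z::'a)"
  have c: "?c > 0" by (rule cone_kernel_integral_pos[OF d])
  have [measurable]: "w \<in> borel_measurable borel" using w(1) by (rule borel_measurable_continuous_onI)
  have eq: "(LINT z|lborel. cone_kernel d z * w (x + z)) = (LINT z|lborel. cone_kernel d (z - x) * w z)" for x
    using integral_lborel_shift[of "\<lambda>z. cone_kernel d (z - x) * w z" x] by simp
  have int: "integrable lborel (\<lambda>z. cone_kernel d (z - x) * w z)" for x
    by (rule continuous_compact_support_integrable[OF _ w(2)])
       (auto intro!: continuous_intros w(1) continuous_on_compose2[OF cone_kernel_continuous] simp: w(3))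
  have iw: "integrable lborel (\<lambda>z. \<bar>w z\<bar>)"
    using continuous_compact_support_integrable[OF w] by simp
  have "\<bar>(LINT z|lborel. cone_kernel d (z - x) * w z) - (LINT z|lborel. cone_kernel d (z - y) * w z)\<bar>
     = \<bar>LINT z|lborel. (cone_kernel d (z - x) - cone_kernel d (z - y)) * w z\<bar>"
    using int by (simp add: left_diff_distrib)
  also have "\<dots> \<le> (LINT z|lborel. norm (x - y) * \<bar>w z\<bar>)"
  proof (rule integral_abs_bound[THEN order_trans], rule integral_mono)
    show "integrable lborel (\<lambda>z. \<bar>(cone_kernel d (z - x) - cone_kernel d (z - y)) * w z\<bar>)"
      using Bochner_Integration.integrable_diff[OF int[of x] int[of y]] by (simp add: left_diff_distrib)
    show "\<bar>(cone_kernel d (z - x) - cone_kernel d (z - y)) * w z\<bar> \<le> norm (x - y) * \<bar>w z\<bar>" for z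
      using cone_kernel_lipschitz[of d "z - x" "z - y"] by (simp add: abs_mult mult_right_mono norm_minus_commute)
  qed (use iw in simp)
  finally have "\<bar>(LINT z|lborel. cone_kernel d (z - x) * w z) - (LINT z|lborel. cone_kernel d (z - y) * w z)\<bar> \<le> norm (x - y) * (LINT z|lborel. \<bar>w z\<bar>)"
    using iw by simp
  then show "\<bar>mollify d w x - mollify d w y\<bar> \<le> norm (x - y) * ((LINT z|lborel. \<bar>w z\<bar>) / ?c)"
    unfolding mollify_def eq diff_divide_distrib[symmetric] abs_divide using c by (simp add: divide_right_mono)
  have "\<bar>LINT z|lborel. cone_kernel d (z - x) * w z\<bar> \<le> (LINT z|lborel. d * \<bar>w z\<bar>)"
  proof (rule integral_abs_bound[THEN order_trans], rule integral_mono)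
    show "\<bar>cone_kernel d (z - x) * w z\<bar> \<le> d * \<bar>w z\<bar>" for z
      using cone_kernel_le[of d "z - x"] cone_kernel_nonneg[of d "z - x"] d by (simp add: abs_mult mult_right_mono)
  qed (use iw int in auto)
  then show "\<bar>mollify d w x\<bar> \<le> d * ((LINT z|lborel. \<bar>w z\<bar>) / ?c)"
    unfolding mollify_def eq abs_divide using c iw by (simp add: divide_right_mono)
qed

lemma mollify_diff:
  fixes v w :: "'a::euclidean_space \<Rightarrow> real"
  assumes "continuous_on UNIV v" "continuous_on UNIV w"
  shows "mollify d (\<lambda>x. v x - w x) x = mollify d v x - mollify d w x"
proof -
  have "integrable lborel (\<lambda>z. cone_kernel d z * u (x + z))" if "continuous_on UNIV u" for u :: "'a \<Rightarrow> real"
    by (rule cone_kernel_integrable, rule continuous_on_compose2[OF that]) (auto intro: continuous_intros)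
  then show ?thesis using assms by (simp add: mollify_def right_diff_distrib diff_divide_distrib)
qed

text \<open>Jensen's inequality for the probability density proportional to
  \<open>cone_kernel d\<close>, obtained from the discriminant of the nonnegative quadratic
  \<open>t\<close> maps to the weighted integral of \<open>(v z + t)^2\<close>.\<close>

lemma mollify_diff_square_le:
  fixes w :: "'a::euclidean_space \<Rightarrow> real"
  assumes d: "d > 0" and w: "continuous_on UNIV w"
  shows "ennreal ((mollify d w x - w x)\<^sup>2) \<le> ennreal (1 / (LINT z|lborel. cone_kernel d (z::'a))) * (\<integral>\<^sup>+z. ennreal (cone_kernel d z * (w (x + z) - w x)\<^sup>2) \<partial>lborel)"
proof -
  let ?c = "LINT z|lborel. cone_kernel d (z::'a)"
  have c: "?c > 0" by (rule cone_kernel_integral_pos[OF d])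
  define v where "v z = w (x + z) - w x" for z
  have cv: "continuous_on UNIV v" unfolding v_def
    by (intro continuous_intros continuous_on_compose2[OF w]) auto
  have ik: "integrable lborel (cone_kernel d :: 'a \<Rightarrow> real)" using cone_kernel_integrable[of "\<lambda>_. 1" d] by simp
  have iv: "integrable lborel (\<lambda>z. cone_kernel d z * v z)" by (rule cone_kernel_integrable[OF cv])
  have iv2: "integrable lborel (\<lambda>z. cone_kernel d z * (v z)\<^sup>2)" by (rule cone_kernel_integrable) (intro continuous_intros cv)
  have "(LINT z|lborel. cone_kernel d z * v z)\<^sup>2 \<le> (LINT z|lborel. cone_kernel d z * (v z)\<^sup>2) * ?c"
  proof (rule quadratic_nonneg_imp_discriminant)
    fix t
    have "0 \<le> (LINT z|lborel. cone_kernel d z * (v z + t)\<^sup>2)" by (intro integral_nonneg_AE AE_I2) (simp add: cone_kernel_nonneg)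
    also have "\<dots> = (LINT z|lborel. cone_kernel d z * (v z)\<^sup>2 + 2 * t * (cone_kernel d z * v z) + t\<^sup>2 * cone_kernel d z)"
      by (intro Bochner_Integration.integral_cong) (auto simp: power2_eq_square algebra_simps)
    also have "\<dots> = (LINT z|lborel. cone_kernel d z * (v z)\<^sup>2) + 2 * t * (LINT z|lborel. cone_kernel d z * v z) + t\<^sup>2 * ?c"
      using ik iv iv2 by simp
    finally show "0 \<le> (LINT z|lborel. cone_kernel d z * (v z)\<^sup>2) + 2 * t * (LINT z|lborel. cone_kernel d z * v z) + t\<^sup>2 * ?c" .
  qed (use c in simp)
  moreover have "(LINT z|lborel. cone_kernel d z * v z) = ?c * (mollify d w x - w x)"
  proof -
    have "integrable lborel (\<lambda>z. cone_kernel d z * w (x + z))"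
      by (rule cone_kernel_integrable, rule continuous_on_compose2[OF w]) (auto intro: continuous_intros)
    then have "(LINT z|lborel. cone_kernel d z * v z) = (LINT z|lborel. cone_kernel d z * w (x + z)) - ?c * w x"
      unfolding v_def right_diff_distrib using ik by simp
    then show ?thesis using c by (simp add: mollify_def right_diff_distrib)
  qed
  ultimately have "?c\<^sup>2 * (mollify d w x - w x)\<^sup>2 \<le> ?c * (LINT z|lborel. cone_kernel d z * (v z)\<^sup>2)"
    by (simp add: power_mult_distrib mult.commute)
  moreover have "X \<le> 1 / C * Y" if "C\<^sup>2 * X \<le> C * Y" "C > 0" for X Y C :: real
    using that by (simp add: power2_eq_square field_simps)
  ultimately have "(mollify d w x - w x)\<^sup>2 \<le> (1 / ?c) * (LINT z|lborel. cone_kernel d z * (v z)\<^sup>2)"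
    using c by blast
  then have "ennreal ((mollify d w x - w x)\<^sup>2) \<le> ennreal (1 / ?c) * ennreal (LINT z|lborel. cone_kernel d z * (v z)\<^sup>2)"
    using c by (subst ennreal_mult''[symmetric]) (auto intro!: ennreal_leI integral_nonneg_AE simp: cone_kernel_nonneg)
  also have "ennreal (LINT z|lborel. cone_kernel d z * (v z)\<^sup>2) = (\<integral>\<^sup>+z. ennreal (cone_kernel d z * (v z)\<^sup>2) \<partial>lborel)"
    by (rule nn_integral_eq_integral[symmetric, OF iv2]) (simp add: cone_kernel_nonneg)
  finally show ?thesis by (simp add: v_def)
qed

section \<open>Translation estimate, mollification error and extraction of subsequences\<close>

context bounded_dom
begin

text \<open>The fundamental theorem of calculus along the segment from \<open>x\<close> to
  \<open>x + h\<close> and Cauchy-Schwarz on [0, 1] bound the increment pointwise; integrating over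
  \<open>x\<close>, each slice in \<open>t\<close> is a translate of the same gradient integral.
  Nonnegative integrals make the exchange of order a matter of measurability.\<close>

lemma test_translation_estimate:
  assumes \<phi>: "\<phi> \<in> test_functions \<Omega>"
  shows "(\<integral>\<^sup>+x. ennreal ((\<phi> (x + h) - \<phi> x)\<^sup>2) \<partial>lborel) \<le> ennreal ((norm h)\<^sup>2) * (\<integral>\<^sup>+x. ennreal ((norm (tgrad \<phi> x))\<^sup>2) \<partial>lborel)"
proof -
  have [measurable]: "\<phi> \<in> borel_measurable borel" "tgrad \<phi> \<in> borel_measurable borel"
    using test_continuous[OF \<phi>] tgrad_continuous[OF \<phi>] by (auto intro: borel_measurable_continuous_onI)
  have fd: "frechet_derivative \<phi> (at y) k = tgrad \<phi> y \<bullet> k" for y k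
  proof -
    interpret linear "frechet_derivative \<phi> (at y)"
      by (rule linear_frechet_derivative[OF test_functions_differentiable[OF \<phi>]])
    have "frechet_derivative \<phi> (at y) k = frechet_derivative \<phi> (at y) (\<Sum>i\<in>Basis. (k \<bullet> i) *\<^sub>R i)"
      by (simp add: euclidean_representation)
    also have "\<dots> = (\<Sum>i\<in>Basis. (k \<bullet> i) * pd i \<phi> y)" by (simp add: sum scale)
    also have "\<dots> = tgrad \<phi> y \<bullet> k"
      by (simp add: tgrad_def inner_sum_left inner_commute[of k] mult.commute)
    finally show ?thesis .
  qed
  have pt: "ennreal ((\<phi> (x + h) - \<phi> x)\<^sup>2) \<le> ennreal ((norm h)\<^sup>2) * (\<integral>\<^sup>+t. indicator {0..1} t * ennreal ((norm (tgrad \<phi> (x + t *\<^sub>R h)))\<^sup>2) \<partial>lborel)" for x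
  proof -
    let ?f = "\<lambda>t. tgrad \<phi> (x + t *\<^sub>R h) \<bullet> h"
    have der: "((\<lambda>t. \<phi> (x + t *\<^sub>R h)) has_vector_derivative ?f t) (at t within {0..1})" for t
    proof -
      have "((\<lambda>t. \<phi> (x + t *\<^sub>R h)) has_derivative (\<lambda>s. frechet_derivative \<phi> (at (x + t *\<^sub>R h)) (s *\<^sub>R h))) (at t within {0..1})"
        by (rule has_derivative_compose[OF _ test_functions_differentiable[OF \<phi>, unfolded frechet_derivative_works], of "\<lambda>t. x + t *\<^sub>R h" "\<lambda>s. s *\<^sub>R h"])
           (auto intro!: derivative_eq_intros)
      then show ?thesis by (simp add: has_vector_derivative_def fd)
    qed
    have cf: "continuous_on {0..1} ?f"
      by (intro continuous_intros continuous_on_compose2[OF tgrad_continuous[OF \<phi>]]) auto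
    have hb: "has_bochner_integral lborel (\<lambda>t. indicator {0..1} t *\<^sub>R ?f t) (\<phi> (x + 1 *\<^sub>R h) - \<phi> (x + 0 *\<^sub>R h))"
      by (rule has_bochner_integral_FTC_Icc[OF _ der cf]) simp
    have fm: "?f \<in> borel_measurable borel" by measurable
    have "ennreal \<bar>\<phi> (x + h) - \<phi> x\<bar> \<le> (\<integral>\<^sup>+t. ennreal (norm (indicator {0..1} t *\<^sub>R ?f t)) \<partial>lborel)"
      using integral_norm_bound_ennreal[OF integrable.intros[OF hb]] has_bochner_integral_integral_eq[OF hb] by simp
    also have "\<dots> = (\<integral>\<^sup>+t. (indicator {0..1} t * ennreal \<bar>?f t\<bar>) * indicator {0..1} t \<partial>lborel)"
      by (intro nn_integral_cong) (auto simp: indicator_def)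
    finally have "(ennreal \<bar>\<phi> (x + h) - \<phi> x\<bar>)\<^sup>2 \<le> (\<integral>\<^sup>+t. (indicator {0..1} t * ennreal \<bar>?f t\<bar>) * indicator {0..1} t \<partial>lborel)\<^sup>2"
      by (rule power_mono) simp
    also have "\<dots> \<le> (\<integral>\<^sup>+t. (indicator {0..1} t * ennreal \<bar>?f t\<bar>)\<^sup>2 \<partial>lborel) * (\<integral>\<^sup>+t. (indicator {0..1::real} t)\<^sup>2 \<partial>lborel)"
      using fm by (intro Cauchy_Schwarz_nn_integral) measurable
    also have "(\<integral>\<^sup>+t. (indicator {0..1::real} t)\<^sup>2 \<partial>lborel) = (\<integral>\<^sup>+t. indicator {0..1::real} t \<partial>lborel)"
      by (intro nn_integral_cong) (auto simp: indicator_def)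
    also have "\<dots> = 1" by simp
    also have "(\<integral>\<^sup>+t. (indicator {0..1} t * ennreal \<bar>?f t\<bar>)\<^sup>2 \<partial>lborel)
       \<le> (\<integral>\<^sup>+t. ennreal ((norm h)\<^sup>2) * (indicator {0..1} t * ennreal ((norm (tgrad \<phi> (x + t *\<^sub>R h)))\<^sup>2)) \<partial>lborel)"
    proof (rule nn_integral_mono)
      fix t :: real
      have "(ennreal \<bar>?f t\<bar>)\<^sup>2 \<le> ennreal ((norm h)\<^sup>2) * ennreal ((norm (tgrad \<phi> (x + t *\<^sub>R h)))\<^sup>2)"
        using power_mono[OF Cauchy_Schwarz_ineq2[of "tgrad \<phi> (x + t *\<^sub>R h)" h], of 2]
        by (auto simp: ennreal_power ennreal_mult'[symmetric] power_mult_distrib mult.commute intro!: ennreal_leI)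
      then show "(indicator {0..1} t * ennreal \<bar>?f t\<bar>)\<^sup>2 \<le> ennreal ((norm h)\<^sup>2) * (indicator {0..1} t * ennreal ((norm (tgrad \<phi> (x + t *\<^sub>R h)))\<^sup>2))"
        by (auto simp: indicator_def)
    qed
    also have "\<dots> = ennreal ((norm h)\<^sup>2) * (\<integral>\<^sup>+t. indicator {0..1} t * ennreal ((norm (tgrad \<phi> (x + t *\<^sub>R h)))\<^sup>2) \<partial>lborel)"
      by (rule nn_integral_cmult) measurable
    finally show ?thesis by (simp add: ennreal_power)
  qed
  have "(\<integral>\<^sup>+x. ennreal ((\<phi> (x + h) - \<phi> x)\<^sup>2) \<partial>lborel)
     \<le> (\<integral>\<^sup>+x. ennreal ((norm h)\<^sup>2) * (\<integral>\<^sup>+t. indicator {0..1} t * ennreal ((norm (tgrad \<phi> (x + t *\<^sub>R h)))\<^sup>2) \<partial>lborel) \<partial>lborel)"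
    by (rule nn_integral_mono) (rule pt)
  also have "\<dots> = ennreal ((norm h)\<^sup>2) * (\<integral>\<^sup>+x. \<integral>\<^sup>+t. indicator {0..1} t * ennreal ((norm (tgrad \<phi> (x + t *\<^sub>R h)))\<^sup>2) \<partial>lborel \<partial>lborel)"
    by (rule nn_integral_cmult) measurable
  also have "(\<integral>\<^sup>+x. \<integral>\<^sup>+t. indicator {0..1} t * ennreal ((norm (tgrad \<phi> (x + t *\<^sub>R h)))\<^sup>2) \<partial>lborel \<partial>lborel)
     = (\<integral>\<^sup>+t. \<integral>\<^sup>+x. indicator {0..1} t * ennreal ((norm (tgrad \<phi> (x + t *\<^sub>R h)))\<^sup>2) \<partial>lborel \<partial>lborel)"
    by (rule lborel_pair.Fubini') measurable
  also have "\<dots> = (\<integral>\<^sup>+t. indicator {0..1::real} t * (\<integral>\<^sup>+x. ennreal ((norm (tgrad \<phi> x))\<^sup>2) \<partial>lborel) \<partial>lborel)"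
  proof (rule nn_integral_cong)
    fix t :: real
    have "(\<integral>\<^sup>+x. indicator {0..1} t * ennreal ((norm (tgrad \<phi> (x + t *\<^sub>R h)))\<^sup>2) \<partial>lborel)
      = indicator {0..1} t * (\<integral>\<^sup>+x. ennreal ((norm (tgrad \<phi> (x + t *\<^sub>R h)))\<^sup>2) \<partial>lborel)"
      by (rule nn_integral_cmult) measurable
    also have "(\<integral>\<^sup>+x. ennreal ((norm (tgrad \<phi> (x + t *\<^sub>R h)))\<^sup>2) \<partial>lborel) = (\<integral>\<^sup>+x. ennreal ((norm (tgrad \<phi> x))\<^sup>2) \<partial>lborel)"
      by (rule nn_integral_lborel_shift[of "\<lambda>x. ennreal ((norm (tgrad \<phi> x))\<^sup>2)"]) measurable
    finally show "(\<integral>\<^sup>+x. indicator {0..1} t * ennreal ((norm (tgrad \<phi> (x + t *\<^sub>R h)))\<^sup>2) \<partial>lborel)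
      = indicator {0..1} t * (\<integral>\<^sup>+x. ennreal ((norm (tgrad \<phi> x))\<^sup>2) \<partial>lborel)" .
  qed
  also have "\<dots> = (\<integral>\<^sup>+x. ennreal ((norm (tgrad \<phi> x))\<^sup>2) \<partial>lborel)"
    by (subst nn_integral_multc) auto
  finally show ?thesis .
qed

lemma nn_integral_tgrad:
  assumes \<phi>: "\<phi> \<in> test_functions \<Omega>"
  shows "(\<integral>\<^sup>+x. ennreal ((norm (tgrad \<phi> x))\<^sup>2) \<partial>lborel) = ennreal ((H01_norm \<Omega> \<phi>)\<^sup>2)"
proof -
  have "\<exists>L. compact L \<and> L \<subseteq> \<Omega> \<and> (\<forall>x. x \<notin> L \<longrightarrow> tgrad \<phi> x = 0)"
  proof -
    have "\<forall>i\<in>Basis. \<exists>L. compact L \<and> L \<subseteq> \<Omega> \<and> (\<forall>x. x \<notin> L \<longrightarrow> pd i \<phi> x = 0)"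
      using test_functions_support test_functions_pd[OF \<phi>] by blast
    then obtain L where "\<And>i. i \<in> Basis \<Longrightarrow> compact (L i) \<and> L i \<subseteq> \<Omega> \<and> (\<forall>x. x \<notin> L i \<longrightarrow> pd i \<phi> x = 0)"
      by metis
    then show ?thesis by (intro exI[of _ "\<Union>i\<in>Basis. L i"]) (auto simp: tgrad_def intro!: compact_UN sum.neutral)
  qed
  then obtain L where L: "compact L" "L \<subseteq> \<Omega>" "\<And>x. x \<notin> L \<Longrightarrow> tgrad \<phi> x = 0" by blast
  have cg: "continuous_on UNIV (\<lambda>x. (norm (tgrad \<phi> x))\<^sup>2)" by (intro continuous_intros tgrad_continuous[OF \<phi>])
  have i: "integrable lborel (\<lambda>x. (norm (tgrad \<phi> x))\<^sup>2)"
    by (rule continuous_compact_support_integrable[OF cg L(1)]) (simp add: L(3))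
  have "(\<integral>\<^sup>+x. ennreal ((norm (tgrad \<phi> x))\<^sup>2) \<partial>lborel) = ennreal (LINT x|lborel. (norm (tgrad \<phi> x))\<^sup>2)"
    by (rule nn_integral_eq_integral[OF i]) simp
  also have "(LINT x|lborel. (norm (tgrad \<phi> x))\<^sup>2) = (LINT x|lebesgue_on \<Omega>. (norm (tgrad \<phi> x))\<^sup>2)"
    using L by (intro lebesgue_on_lborel(1)[symmetric] sets_dom borel_measurable_continuous_onI cg) auto
  finally show ?thesis by (simp add: H01_norm_test[OF \<phi>] l2_square ip_self)
qed

text \<open>Jensen's bound is integrated in \<open>x\<close> and the order exchanged; the kernel is
  supported where \<open>norm z\<close> is at most \<open>d\<close>, so each translate contributes
  at most \<open>d^2\<close> times the squared gradient norm, and the kernel's mass cancels the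
  normalization.\<close>

lemma nn_integral_mollify_diff_le:
  assumes d: "d > 0" and \<phi>: "\<phi> \<in> test_functions \<Omega>"
  shows "(\<integral>\<^sup>+x. ennreal ((mollify d \<phi> x - \<phi> x)\<^sup>2) \<partial>lborel) \<le> ennreal ((d * H01_norm \<Omega> \<phi>)\<^sup>2)"
proof -
  let ?c = "LINT z|lborel. cone_kernel d (z::'a)" and ?G = "ennreal ((H01_norm \<Omega> \<phi>)\<^sup>2)"
  have c: "?c > 0" by (rule cone_kernel_integral_pos[OF d])
  have ik: "integrable lborel (cone_kernel d :: 'a \<Rightarrow> real)" using cone_kernel_integrable[of "\<lambda>_. 1" d] by simp
  have [measurable]: "\<phi> \<in> borel_measurable borel" using test_continuous[OF \<phi>] by (rule borel_measurable_continuous_onI)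
  have "(\<integral>\<^sup>+x. ennreal ((mollify d \<phi> x - \<phi> x)\<^sup>2) \<partial>lborel)
     \<le> (\<integral>\<^sup>+x. ennreal (1 / ?c) * (\<integral>\<^sup>+z. ennreal (cone_kernel d z * (\<phi> (x + z) - \<phi> x)\<^sup>2) \<partial>lborel) \<partial>lborel)"
    by (rule nn_integral_mono) (rule mollify_diff_square_le[OF d test_continuous[OF \<phi>]])
  also have "\<dots> = ennreal (1 / ?c) * (\<integral>\<^sup>+x. \<integral>\<^sup>+z. ennreal (cone_kernel d z * (\<phi> (x + z) - \<phi> x)\<^sup>2) \<partial>lborel \<partial>lborel)"
    by (rule nn_integral_cmult) measurable
  also have "(\<integral>\<^sup>+x. \<integral>\<^sup>+z. ennreal (cone_kernel d z * (\<phi> (x + z) - \<phi> x)\<^sup>2) \<partial>lborel \<partial>lborel)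
    = (\<integral>\<^sup>+z. \<integral>\<^sup>+x. ennreal (cone_kernel d z * (\<phi> (x + z) - \<phi> x)\<^sup>2) \<partial>lborel \<partial>lborel)"
    by (rule lborel_pair.Fubini') measurable
  also have "\<dots> \<le> (\<integral>\<^sup>+z. ennreal (cone_kernel d (z::'a)) * (ennreal (d\<^sup>2) * ?G) \<partial>lborel)"
  proof (rule nn_integral_mono)
    fix z :: 'a
    have "(\<integral>\<^sup>+x. ennreal (cone_kernel d z * (\<phi> (x + z) - \<phi> x)\<^sup>2) \<partial>lborel) = (\<integral>\<^sup>+x. ennreal (cone_kernel d z) * ennreal ((\<phi> (x + z) - \<phi> x)\<^sup>2) \<partial>lborel)"
      by (intro nn_integral_cong) (simp add: ennreal_mult' cone_kernel_nonneg)
    also have "\<dots> = ennreal (cone_kernel d z) * (\<integral>\<^sup>+x. ennreal ((\<phi> (x + z) - \<phi> x)\<^sup>2) \<partial>lborel)"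
      by (rule nn_integral_cmult) measurable
    also have "\<dots> \<le> ennreal (cone_kernel d z) * (ennreal (d\<^sup>2) * ?G)"
    proof (cases "norm z \<le> d")
      case True
      have "(\<integral>\<^sup>+x. ennreal ((\<phi> (x + z) - \<phi> x)\<^sup>2) \<partial>lborel) \<le> ennreal ((norm z)\<^sup>2) * ?G"
        using test_translation_estimate[OF \<phi>, of z] by (simp add: nn_integral_tgrad[OF \<phi>])
      also have "\<dots> \<le> ennreal (d\<^sup>2) * ?G" using True by (intro mult_right_mono ennreal_leI power_mono) auto
      finally show ?thesis by (rule mult_left_mono) simp
    next
      case False
      then have "cone_kernel d z = 0" by (simp add: cone_kernel_def)
      then show ?thesis by simp
    qed
    finally show "(\<integral>\<^sup>+x. ennreal (cone_kernel d z * (\<phi> (x + z) - \<phi> x)\<^sup>2) \<partial>lborel) \<le> ennreal (cone_kernel d z) * (ennreal (d\<^sup>2) * ?G)" .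
  qed
  also have "\<dots> = (\<integral>\<^sup>+z. ennreal (cone_kernel d (z::'a)) \<partial>lborel) * (ennreal (d\<^sup>2) * ?G)"
    by (rule nn_integral_multc) measurable
  also have "(\<integral>\<^sup>+z. ennreal (cone_kernel d (z::'a)) \<partial>lborel) = ennreal ?c"
    by (rule nn_integral_eq_integral[OF ik]) (simp add: cone_kernel_nonneg)
  also have "ennreal (1 / ?c) * (ennreal ?c * (ennreal (d\<^sup>2) * ?G)) = ennreal ((d * H01_norm \<Omega> \<phi>)\<^sup>2)"
    using c by (simp add: ennreal_mult'[symmetric] power_mult_distrib)
  finally show ?thesis by (simp add: mult_left_mono)
qed

lemma l2_mollify_diff_le:
  assumes d: "d > 0" and \<phi>: "\<phi> \<in> test_functions \<Omega>"
  shows "mollify d \<phi> \<in> L2 \<Omega>" "l2 \<Omega> (\<lambda>x. mollify d \<phi> x - \<phi> x) \<le> d * H01_norm \<Omega> \<phi>"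
proof -
  from test_functions_support[OF \<phi>] obtain K where K: "compact K" "\<And>x. x \<notin> K \<Longrightarrow> \<phi> x = 0" by blast
  note lip = mollify_lipschitz[OF d test_continuous[OF \<phi>] K]
  let ?L = "(LINT z|lborel. \<bar>\<phi> z\<bar>) / (LINT z|lborel. cone_kernel d (z::'a))"
  have L0: "?L \<ge> 0" using cone_kernel_integral_pos[OF d, where 'a='a] by (auto intro!: divide_nonneg_pos integral_nonneg_AE)
  have "?L-lipschitz_on UNIV (mollify d \<phi>)"
    using lip(1) L0 by (intro lipschitz_onI) (auto simp: dist_norm mult.commute)
  then have cm: "continuous_on UNIV (mollify d \<phi>)" by (rule lipschitz_on_continuous_on)
  show mL: "mollify d \<phi> \<in> L2 \<Omega>"
    by (rule L2_bounded_measurable[OF lmeasurable_dom borel_measurable_lebesgue_onI[OF borel_measurable_continuous_onI[OF cm]]])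
       (use lip(2) in simp)
  have mb: "mollify d \<phi> \<in> borel_measurable borel" "\<phi> \<in> borel_measurable borel"
    using cm test_continuous[OF \<phi>] by (auto intro: borel_measurable_continuous_onI)
  have D: "(\<lambda>x. mollify d \<phi> x - \<phi> x) \<in> L2 \<Omega>" by (intro L2_diff mL test_L2 \<phi>)
  have "ennreal ((l2 \<Omega> (\<lambda>x. mollify d \<phi> x - \<phi> x))\<^sup>2) = (\<integral>\<^sup>+x. ennreal ((mollify d \<phi> x - \<phi> x)\<^sup>2) \<partial>lebesgue_on \<Omega>)"
    unfolding l2_square ip_self using L2_integrable[OF D] by (subst nn_integral_eq_integral) auto
  also have "\<dots> \<le> (\<integral>\<^sup>+x. ennreal ((mollify d \<phi> x - \<phi> x)\<^sup>2) \<partial>lebesgue)"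
    using sets_dom by (subst nn_integral_restrict_space) (auto intro!: nn_integral_mono simp: indicator_def)
  also have "\<dots> = (\<integral>\<^sup>+x. ennreal ((mollify d \<phi> x - \<phi> x)\<^sup>2) \<partial>lborel)"
    by (rule nn_integral_completion)
  also have "\<dots> \<le> ennreal ((d * H01_norm \<Omega> \<phi>)\<^sup>2)" by (rule nn_integral_mollify_diff_le[OF d \<phi>])
  finally have "(l2 \<Omega> (\<lambda>x. mollify d \<phi> x - \<phi> x))\<^sup>2 \<le> (d * H01_norm \<Omega> \<phi>)\<^sup>2" by (simp add: ennreal_le_iff)
  then show "l2 \<Omega> (\<lambda>x. mollify d \<phi> x - \<phi> x) \<le> d * H01_norm \<Omega> \<phi>"
    by (rule power2_le_imp_le) (use d H01_norm_nonneg[of \<Omega> \<phi>] in simp)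
qed

text \<open>For one fixed tolerance, mollification at one fixed radius is enough: the mollified
  functions are uniformly bounded and equi-Lipschitz, so Arzela-Ascoli makes them uniformly Cauchy
  along a subsequence, and the mollification error is small uniformly in \<open>n\<close>.\<close>

lemma rellich_step:
  assumes \<phi>: "\<And>n. \<phi> n \<in> test_functions \<Omega>" and M: "\<And>n. H01_norm \<Omega> (\<phi> n) \<le> M" "\<And>n. l2 \<Omega> (\<phi> n) \<le> M" and e: "e > 0"
  shows "\<exists>r::nat\<Rightarrow>nat. strict_mono r \<and> (\<exists>N. \<forall>i\<ge>N. \<forall>j\<ge>N. l2 \<Omega> (\<lambda>x. \<phi> (r i) x - \<phi> (r j) x) < e)"
proof -
  have M0: "M \<ge> 0" using M(1)[of 0] H01_norm_nonneg[of \<Omega> "\<phi> 0"] by linarith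
  \<comment> \<open>A difference of two members has gradient norm at most \<open>2 * M\<close>, so
    mollifying it costs less than three quarters of \<open>e\<close>. The uniform closeness
    \<open>s\<close> below is chosen so that the mollified difference, of size at most
    \<open>2 * s\<close> on a set of measure \<open>V^2\<close>, takes less than the last
    quarter.\<close>
  define d where "d = e / (4 * (M + 1))"
  have d: "d > 0" "d * (2 * M) < e / 2 + e / 4" using e M0 by (auto simp: d_def field_simps intro!: add_pos_nonneg mult_nonneg_nonneg)
  let ?c = "LINT z|lborel. cone_kernel d (z::'a)"
  have c: "?c > 0" by (rule cone_kernel_integral_pos[OF d(1)])
  define L where "L = sqrt (measure lebesgue \<Omega>) * M / ?c"
  have L0: "L \<ge> 0" using M0 c by (auto simp: L_def)
  have int: "(LINT z|lborel. \<bar>\<phi> n z\<bar>) / ?c \<le> L" for n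
  proof -
    from test_functions_support[OF \<phi>[of n]] obtain K where K: "K \<subseteq> \<Omega>" "\<And>x. x \<notin> K \<Longrightarrow> \<phi> n x = 0" by blast
    have "(LINT z|lborel. \<bar>\<phi> n z\<bar>) = (LINT z|lebesgue_on \<Omega>. norm (\<phi> n z))"
      using K test_continuous[OF \<phi>[of n]]
      by (subst lebesgue_on_lborel(1)[OF sets_dom]) (auto intro!: borel_measurable_continuous_onI continuous_intros)
    also have "\<dots> \<le> sqrt (measure lebesgue \<Omega>) * l2 \<Omega> (\<phi> n)" by (rule L2_integrable1(2)[OF lmeasurable_dom test_L2[OF \<phi>]])
    also have "\<dots> \<le> sqrt (measure lebesgue \<Omega>) * M" using M(2) by (intro mult_left_mono) auto
    finally show ?thesis using c by (simp add: L_def divide_right_mono)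
  qed
  have lip: "\<bar>mollify d (\<phi> n) x - mollify d (\<phi> n) y\<bar> \<le> norm (x - y) * L" "\<bar>mollify d (\<phi> n) x\<bar> \<le> d * L" for n x y
  proof -
    from test_functions_support[OF \<phi>[of n]] obtain K where K: "compact K" "\<And>x. x \<notin> K \<Longrightarrow> \<phi> n x = 0" by blast
    note l = mollify_lipschitz[OF d(1) test_continuous[OF \<phi>[of n]] K]
    show "\<bar>mollify d (\<phi> n) x - mollify d (\<phi> n) y\<bar> \<le> norm (x - y) * L"
      using l(1)[of x y] mult_left_mono[OF int[of n], of "norm (x - y)"] by simp
    show "\<bar>mollify d (\<phi> n) x\<bar> \<le> d * L"
      using l(2)[of x] mult_left_mono[OF int[of n], of d] d(1) by simp
  qed
  have cO: "compact (closure \<Omega>)" using bounded_dom by (simp add: compact_closure)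
  obtain g k where k: "strict_mono (k :: nat \<Rightarrow> nat)"
    and u: "\<And>e. 0 < e \<Longrightarrow> \<exists>N. \<forall>n x. n \<ge> N \<and> x \<in> closure \<Omega> \<longrightarrow> norm (mollify d (\<phi> (k n)) x - g x) < e"
  proof (rule Arzela_Ascoli[OF cO, of "\<lambda>n. mollify d (\<phi> n)" "d * L"])
    show "norm (mollify d (\<phi> n) x) \<le> d * L" for n x using lip(2) by simp
    show "\<exists>d'>0. \<forall>n y. y \<in> closure \<Omega> \<and> norm (x - y) < d' \<longrightarrow> norm (mollify d (\<phi> n) x - mollify d (\<phi> n) y) < e'" if "e' > 0" for x e'
    proof (intro exI[of _ "e' / (L + 1)"] conjI allI impI)
      show "e' / (L + 1) > 0" using that L0 by simp
      fix n y assume "y \<in> closure \<Omega> \<and> norm (x - y) < e' / (L + 1)"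
      then have "norm (x - y) * (L + 1) < e'" using L0 by (simp add: field_simps)
      moreover have "norm (x - y) * L \<le> norm (x - y) * (L + 1)" by (intro mult_left_mono) auto
      ultimately show "norm (mollify d (\<phi> n) x - mollify d (\<phi> n) y) < e'" using lip(1)[of n x y] by simp
    qed
  qed blast
  define V where "V = sqrt (measure lebesgue \<Omega>)"
  define s where "s = e / (16 * (V + 1))"
  have V0: "V \<ge> 0" by (simp add: V_def)
  have s: "s > 0" "(2 * s) * V < e / 4" using e V0 by (auto simp: s_def field_simps intro!: add_pos_nonneg mult_nonneg_nonneg)
  obtain N where N: "\<And>n x. n \<ge> N \<Longrightarrow> x \<in> \<Omega> \<Longrightarrow> \<bar>mollify d (\<phi> (k n)) x - g x\<bar> < s"
    using u[OF s(1)] closure_subset[of \<Omega>] by (auto simp: subset_iff)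
  have "l2 \<Omega> (\<lambda>x. \<phi> (k i) x - \<phi> (k j) x) < e" if "i \<ge> N" "j \<ge> N" for i j
  proof -
    let ?w = "\<lambda>x. \<phi> (k i) x - \<phi> (k j) x"
    have w: "?w \<in> test_functions \<Omega>" using test_functions_lincomb[OF \<phi>[of "k i"] \<phi>[of "k j"], of 1 "-1"] by simp
    note m = l2_mollify_diff_le[OF d(1) w]
    have "H01_norm \<Omega> ?w \<le> 2 * M"
      using H01_norm_triangle_diff[OF test_H01[OF \<phi>[of "k i"]] test_H01[OF \<phi>[of "k j"]]] M(1)[of "k i"] M(1)[of "k j"] by linarith
    then have 1: "l2 \<Omega> (\<lambda>x. ?w x - mollify d ?w x) \<le> d * (2 * M)"
      using m(2) d(1) l2_minus_commute[of \<Omega> ?w "mollify d ?w"] by (smt (verit) mult_left_mono)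
    have 2: "l2 \<Omega> (mollify d ?w) \<le> (2 * s) * V"
    proof -
      have b: "\<bar>mollify d ?w x\<bar> \<le> 2 * s" if "x \<in> \<Omega>" for x
        using N[OF \<open>i \<ge> N\<close> that] N[OF \<open>j \<ge> N\<close> that]
        by (simp add: mollify_diff[OF test_continuous[OF \<phi>] test_continuous[OF \<phi>]])
      interpret finite_measure "lebesgue_on \<Omega>" by (rule finite_measure_lebesgue_on[OF lmeasurable_dom])
      have "ip \<Omega> (mollify d ?w) (mollify d ?w) \<le> (LINT x|lebesgue_on \<Omega>. (2 * s)\<^sup>2)"
        unfolding ip_self
      proof (rule integral_mono)
        show "(norm (mollify d ?w x))\<^sup>2 \<le> (2 * s)\<^sup>2" if "x \<in> space (lebesgue_on \<Omega>)" for x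
          using b[of x] that by (intro power_mono) auto
      qed (use L2_integrable[OF m(1)] in auto)
      also have "\<dots> = ((2 * s) * V)\<^sup>2"
        using lmeasurable_dom by (simp add: V_def power_mult_distrib measure_restrict_space)
      finally have "(l2 \<Omega> (mollify d ?w))\<^sup>2 \<le> ((2 * s) * V)\<^sup>2" by (simp add: l2_square)
      then show ?thesis by (rule power2_le_imp_le) (use s V0 in auto)
    qed
    have "l2 \<Omega> ?w \<le> l2 \<Omega> (\<lambda>x. ?w x - mollify d ?w x) + l2 \<Omega> (mollify d ?w)"
      using l2_triangle[OF L2_diff[OF test_L2[OF w] m(1)] m(1)] by simp
    then show ?thesis using 1 2 d(2) s(2) by linarith
  qed
  then show ?thesis using k by blast
qed

text \<open>The radius in \<open>rellich_step\<close> depends on the tolerance, so one application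
  does not yield a Cauchy sequence. The tolerances \<open>1 / Suc n\<close> are treated in turn and
  a diagonal subsequence serves all of them.\<close>

lemma rellich_test:
  assumes \<phi>: "\<And>n. \<phi> n \<in> test_functions \<Omega>" and M: "\<And>n. H01_norm \<Omega> (\<phi> n) \<le> M" "\<And>n. l2 \<Omega> (\<phi> n) \<le> M"
  shows "\<exists>r::nat\<Rightarrow>nat. strict_mono r \<and> (\<forall>e>0. \<exists>N. \<forall>i\<ge>N. \<forall>j\<ge>N. l2 \<Omega> (\<lambda>x. \<phi> (r i) x - \<phi> (r j) x) < e)"
proof -
  define P where "P n s \<longleftrightarrow> (\<exists>N. \<forall>i\<ge>N. \<forall>j\<ge>N. l2 \<Omega> (\<lambda>x. \<phi> (s i) x - \<phi> (s j) x) < 1 / real (Suc n))"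
    for n and s :: "nat \<Rightarrow> nat"
  interpret subseqs P
  proof
    fix n and s :: "nat \<Rightarrow> nat" assume "strict_mono s"
    show "\<exists>r'. strict_mono r' \<and> P n (s \<circ> r')"
      using rellich_step[of "\<lambda>n. \<phi> (s n)" M "1 / real (Suc n)"] \<phi> M by (auto simp: P_def)
  qed
  have stable: "P n (s \<circ> r)" if "strict_mono r" "P n s" for n s and r :: "nat \<Rightarrow> nat"
  proof -
    from that(2) obtain N where "\<forall>i\<ge>N. \<forall>j\<ge>N. l2 \<Omega> (\<lambda>x. \<phi> (s i) x - \<phi> (s j) x) < 1 / real (Suc n)" by (auto simp: P_def)
    then show ?thesis unfolding P_def
      using seq_suble[OF that(1)] by (intro exI[of _ N]) (auto intro: order_trans)
  qed
  have "\<exists>N. \<forall>i\<ge>N. \<forall>j\<ge>N. l2 \<Omega> (\<lambda>x. \<phi> (diagseq i) x - \<phi> (diagseq j) x) < e" if e: "e > 0" for e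
  proof -
    obtain n where n: "1 / real (Suc n) < e" using nat_approx_posE[OF e] by blast
    \<comment> \<open>Only the tail of the diagonal sequence refines the \<open>n\<close>-th choice;
      hence the shift by \<open>Suc n\<close>.\<close>
    have "P n (diagseq \<circ> ((+) (Suc n)))" by (rule diagseq_holds) (rule stable)
    then obtain N where N: "\<And>i j. i \<ge> N \<Longrightarrow> j \<ge> N \<Longrightarrow> l2 \<Omega> (\<lambda>x. \<phi> (diagseq (Suc n + i)) x - \<phi> (diagseq (Suc n + j)) x) < 1 / real (Suc n)"
      by (auto simp: P_def)
    have "l2 \<Omega> (\<lambda>x. \<phi> (diagseq i) x - \<phi> (diagseq j) x) < e" if "i \<ge> Suc n + N" "j \<ge> Suc n + N" for i j
    proof -
      have "i - Suc n \<ge> N" "j - Suc n \<ge> N" "Suc n + (i - Suc n) = i" "Suc n + (j - Suc n) = j" using that by linarith+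
      with N[of "i - Suc n" "j - Suc n"] have "l2 \<Omega> (\<lambda>x. \<phi> (diagseq i) x - \<phi> (diagseq j) x) < 1 / real (Suc n)" by metis
      then show ?thesis using n by (rule less_trans)
    qed
    then show ?thesis by blast
  qed
  then show ?thesis using subseq_diagseq by blast
qed

text \<open>Members of \<open>H01\<close> are replaced by test functions at distance below
  \<open>1 / Suc n\<close>, for which the mollification estimates hold; the replacement does not
  change the limit.\<close>

lemma rellich:
  assumes u: "\<And>n. u n \<in> H01 \<Omega>" and M: "\<And>n. H01_norm \<Omega> (u n) \<le> M" "\<And>n. l2 \<Omega> (u n) \<le> M"
  shows "\<exists>(r::nat\<Rightarrow>nat) v. strict_mono r \<and> v \<in> L2 \<Omega> \<and> (\<lambda>n. l2 \<Omega> (\<lambda>x. u (r n) x - v x)) \<longlonglongrightarrow> 0"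
proof -
  have "\<exists>\<phi>\<in>test_functions \<Omega>. l2 \<Omega> (\<lambda>x. u n x - \<phi> x) < 1 / real (Suc n) \<and> H01_norm \<Omega> (\<lambda>x. u n x - \<phi> x) < 1 / real (Suc n)" for n
    using u[of n] unfolding H01_iff by simp
  then obtain \<phi> where \<phi>: "\<And>n. \<phi> n \<in> test_functions \<Omega>"
    and l: "\<And>n. l2 \<Omega> (\<lambda>x. u n x - \<phi> n x) < 1 / real (Suc n)" and h: "\<And>n. H01_norm \<Omega> (\<lambda>x. u n x - \<phi> n x) < 1 / real (Suc n)"
    by metis
  have uL: "u n \<in> L2 \<Omega>" and pL: "\<phi> n \<in> L2 \<Omega>" for n using u H01_H1 H1_L2 test_L2 \<phi> by blast+
  have one: "1 / real (Suc n) \<le> 1" for n by simp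
  have "H01_norm \<Omega> (\<phi> n) \<le> M + 1" for n
  proof -
    have "H01_norm \<Omega> (\<phi> n) \<le> H01_norm \<Omega> (u n) + H01_norm \<Omega> (\<lambda>x. u n x - \<phi> n x)"
      using H01_norm_triangle_diff[OF u[of n] H01_diff[OF u[of n] test_H01[OF \<phi>[of n]]]] by simp
    then show ?thesis using h[of n] M(1)[of n] one[of n] by linarith
  qed
  moreover have "l2 \<Omega> (\<phi> n) \<le> M + 1" for n
  proof -
    have "l2 \<Omega> (\<phi> n) \<le> l2 \<Omega> (u n) + l2 \<Omega> (\<lambda>x. u n x - \<phi> n x)"
      using l2_lincomb_le[OF uL[of n] L2_diff[OF uL[of n] pL[of n]], of 1 "-1"] by simp
    then show ?thesis using l[of n] M(2)[of n] one[of n] by linarith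
  qed
  ultimately obtain r :: "nat \<Rightarrow> nat" where r: "strict_mono r"
    and C: "\<And>e. e > 0 \<Longrightarrow> \<exists>N. \<forall>i\<ge>N. \<forall>j\<ge>N. l2 \<Omega> (\<lambda>x. \<phi> (r i) x - \<phi> (r j) x) < e"
    using rellich_test[of \<phi> "M + 1"] \<phi> by blast
  have "\<exists>v\<in>L2 \<Omega>. (\<lambda>n. l2 \<Omega> (\<lambda>x. \<phi> (r n) x - v x)) \<longlonglongrightarrow> 0"
    by (rule L2_complete[OF lmeasurable_dom]) (use pL C in auto)
  then obtain v where v: "v \<in> L2 \<Omega>" "(\<lambda>n. l2 \<Omega> (\<lambda>x. \<phi> (r n) x - v x)) \<longlonglongrightarrow> 0" by blast
  have "(\<lambda>n. 1 / real (Suc (r n)) + l2 \<Omega> (\<lambda>x. \<phi> (r n) x - v x)) \<longlonglongrightarrow> 0 + 0"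
    using LIMSEQ_subseq_LIMSEQ[OF LIMSEQ_inverse_real_of_nat r]
    by (intro tendsto_add v(2)) (simp add: o_def inverse_eq_divide)
  then have z: "(\<lambda>n. 1 / real (Suc (r n)) + l2 \<Omega> (\<lambda>x. \<phi> (r n) x - v x)) \<longlonglongrightarrow> 0" by simp
  have "norm (l2 \<Omega> (\<lambda>x. u (r n) x - v x)) \<le> 1 / real (Suc (r n)) + l2 \<Omega> (\<lambda>x. \<phi> (r n) x - v x)" for n
    using l2_triangle_diff[OF uL[of "r n"] pL[of "r n"] v(1)] l[of "r n"] l2_nonneg[of \<Omega> "\<lambda>x. u (r n) x - v x"]
    unfolding real_norm_def by linarith
  then have "(\<lambda>n. l2 \<Omega> (\<lambda>x. u (r n) x - v x)) \<longlonglongrightarrow> 0"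
    by (intro Lim_null_comparison[OF always_eventually z] allI)
  then show ?thesis using r v(1) by blast
qed

end

subsection \<open>Weak limits\<close>

context bounded_dom
begin

lemma parallelogram_half:
  assumes "u \<in> H1 \<Omega>" "v \<in> H1 \<Omega>"
  shows "(H01_norm \<Omega> (\<lambda>x. u x - v x))\<^sup>2
    = 2 * (H01_norm \<Omega> u)\<^sup>2 + 2 * (H01_norm \<Omega> v)\<^sup>2 - 4 * (H01_norm \<Omega> (\<lambda>x. (1/2) * u x + (1/2) * v x))\<^sup>2"
  using gip_lincomb_self[OF assms, of 1 "-1"] gip_lincomb_self[OF assms, of "1/2" "1/2"]
  by (simp add: power2_eq_square)

text \<open>Weak compactness is avoided: elements of almost minimal norm in the shrinking convex sets
  \<open>K k = {w. l2 \<Omega> (w - v) \<le> 1 / (k + 1)}\<close> form a Cauchy sequence by the parallelogram identity, so they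
  converge to \<open>v\<close>; minimality along the segments from \<open>v\<close> to \<open>u n\<close> gives the inequality.\<close>

lemma weak_limit:
  assumes u: "\<And>n. u n \<in> H01 \<Omega>" and M: "\<And>n. H01_norm \<Omega> (u n) \<le> M"
    and v: "v \<in> L2 \<Omega>" and lim: "(\<lambda>n. l2 \<Omega> (\<lambda>x. u n x - v x)) \<longlonglongrightarrow> 0"
  shows "v \<in> H01 \<Omega>"
    and "\<And>e. e > 0 \<Longrightarrow> \<forall>\<^sub>F n in sequentially. (H01_norm \<Omega> v)\<^sup>2 + (H01_norm \<Omega> (\<lambda>x. u n x - v x))\<^sup>2 \<le> (H01_norm \<Omega> (u n))\<^sup>2 + e"
proof -
  let ?n = "H01_norm \<Omega>"
  define K where "K k = {w \<in> H01 \<Omega>. l2 \<Omega> (\<lambda>x. w x - v x) \<le> 1 / real (Suc k)}" for k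
  define D where "D k = (INF w\<in>K k. ?n w)" for k
  have KH: "w \<in> H01 \<Omega>" "w \<in> H1 \<Omega>" "w \<in> L2 \<Omega>" if "w \<in> K k" for w k
    using that by (auto simp: K_def dest: H01_H1 intro: H1_L2[OF H01_H1])
  have evK: "\<forall>\<^sub>F n in sequentially. u n \<in> K k" for k
    using order_tendstoD(2)[OF lim, of "1 / real (Suc k)"] by (auto simp: K_def u elim: eventually_mono)
  have Kne: "\<exists>n. u n \<in> K k" for k using eventually_happens'[OF _ evK[of k]] by auto
  have bdd: "bdd_below (?n ` A)" for A by (rule bdd_belowI2[of _ 0]) (rule H01_norm_nonneg)
  have Dle: "D k \<le> ?n w" if "w \<in> K k" for w k unfolding D_def by (rule cINF_lower[OF bdd that])
  have D0: "D k \<ge> 0" for k unfolding D_def using Kne by (intro cINF_greatest) (auto simp: H01_norm_nonneg)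
  have DM: "D k \<le> M" for k using Kne[of k] Dle M by (meson order_trans)
  have Kmono: "K j \<subseteq> K k" if "k \<le> j" for j k
  proof -
    have "1 / real (Suc j) \<le> 1 / real (Suc k)" using that by (simp add: frac_le)
    then show ?thesis unfolding K_def by auto
  qed
  have Dinc: "incseq D"
    unfolding incseq_def D_def using Kne by (intro allI impI cINF_superset_mono bdd Kmono) auto
  obtain d where d: "D \<longlonglongrightarrow> d" "\<And>k. D k \<le> d"
    using incseq_convergent[OF Dinc, of M] DM by blast
  have "\<exists>w\<in>K k. ?n w < D k + 1 / real (Suc k)" for k
    using cINF_less_iff[of "K k" ?n "D k + 1 / real (Suc k)"] Kne[of k] bdd by (auto simp: D_def[symmetric])
  then obtain w where wK: "\<And>k. w k \<in> K k" and wD: "\<And>k. ?n (w k) < D k + 1 / real (Suc k)" by metis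
  have conv: "(\<lambda>x. (1 - s) * f x + s * g x) \<in> K k" if "f \<in> K k" "g \<in> K k" "0 \<le> s" "s \<le> 1" for f g s k
  proof -
    have "l2 \<Omega> (\<lambda>x. (1 - s) * (f x - v x) + s * (g x - v x)) \<le> (1 - s) * (1 / real (Suc k)) + s * (1 / real (Suc k))"
    proof -
      have "l2 \<Omega> (\<lambda>x. (1 - s) * (f x - v x) + s * (g x - v x)) \<le> (1 - s) * l2 \<Omega> (\<lambda>x. f x - v x) + s * l2 \<Omega> (\<lambda>x. g x - v x)"
        using l2_lincomb_le[OF L2_diff[OF KH(3)[OF that(1)] v] L2_diff[OF KH(3)[OF that(2)] v], of "1 - s" s] that(3,4) by simp
      also have "\<dots> \<le> (1 - s) * (1 / real (Suc k)) + s * (1 / real (Suc k))"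
        using that unfolding K_def by (intro add_mono mult_left_mono) simp_all
      finally show ?thesis .
    qed
    moreover have "(\<lambda>x. (1 - s) * (f x - v x) + s * (g x - v x)) = (\<lambda>x. (1 - s) * f x + s * g x - v x)"
      by (auto simp: algebra_simps)
    moreover have "(1 - s) * (1 / real (Suc k)) + s * (1 / real (Suc k)) = 1 / real (Suc k)"
      unfolding distrib_right[symmetric] by simp
    ultimately show ?thesis
      using H01_lincomb[OF KH(1)[OF that(1)] KH(1)[OF that(2)], of "1 - s" s] unfolding K_def mem_Collect_eq by metis
  qed
  have gap: "(\<lambda>k. 4 * ((d + 1 / real (Suc k))\<^sup>2 - (D k)\<^sup>2)) \<longlonglongrightarrow> 4 * ((d + 0)\<^sup>2 - d\<^sup>2)"
    using LIMSEQ_inverse_real_of_nat by (intro tendsto_intros d) (simp add: inverse_eq_divide)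
  have est: "(?n (\<lambda>x. w i x - w j x))\<^sup>2 \<le> 4 * ((d + 1 / real (Suc k))\<^sup>2 - (D k)\<^sup>2)" if "i \<ge> k" "j \<ge> k" for i j k
  proof -
    have wk: "w i \<in> K k" "w j \<in> K k" using wK Kmono that by blast+
    have le: "(?n (w m))\<^sup>2 \<le> (d + 1 / real (Suc k))\<^sup>2" if "m \<ge> k" for m
    proof -
      have "1 / real (Suc m) \<le> 1 / real (Suc k)" using that by (simp add: frac_le)
      then show ?thesis using wD[of m] d(2)[of m] by (intro power_mono) (auto simp: H01_norm_nonneg)
    qed
    have "(D k)\<^sup>2 \<le> (?n (\<lambda>x. (1/2) * w i x + (1/2) * w j x))\<^sup>2"
      using Dle[OF conv[OF wk, of "1/2"]] D0 by (intro power_mono) simp_all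
    moreover have "X \<le> 4 * (A - B)" if "B \<le> C" "X = 2 * P + 2 * R - 4 * C" "P \<le> A" "R \<le> A" for X A B C P R :: real
      using that unfolding right_diff_distrib by linarith
    ultimately show ?thesis
      using parallelogram_half[OF KH(2)[OF wk(1)] KH(2)[OF wk(2)]] le[OF that(1)] le[OF that(2)] by blast
  qed
  have C: "\<exists>N. \<forall>m\<ge>N. \<forall>n\<ge>N. ?n (\<lambda>x. w m x - w n x) < e" if e: "e > 0" for e
  proof -
    have "\<forall>\<^sub>F k in sequentially. 4 * ((d + 1 / real (Suc k))\<^sup>2 - (D k)\<^sup>2) < e\<^sup>2"
      using order_tendstoD(2)[OF gap, of "e\<^sup>2"] e by simp
    then obtain k where "4 * ((d + 1 / real (Suc k))\<^sup>2 - (D k)\<^sup>2) < e\<^sup>2" by (auto simp: eventually_sequentially)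
    then have "?n (\<lambda>x. w m x - w n x) < e" if "m \<ge> k" "n \<ge> k" for m n
      using power2_less_imp_less[OF le_less_trans[OF est[OF that]]] e by simp
    then show ?thesis by blast
  qed
  have "(\<lambda>k. l2 \<Omega> (\<lambda>x. w k x - v x)) \<longlonglongrightarrow> 0"
  proof (rule Lim_null_comparison[OF always_eventually])
    show "(\<lambda>k. 1 / real (Suc k)) \<longlonglongrightarrow> 0" using LIMSEQ_inverse_real_of_nat by (simp add: inverse_eq_divide)
    show "\<forall>k. norm (l2 \<Omega> (\<lambda>x. w k x - v x)) \<le> 1 / real (Suc k)" using wK by (auto simp: K_def l2_nonneg)
  qed
  note cl = H01_closed[OF v KH(1)[OF wK] this C]
  show vH: "v \<in> H01 \<Omega>" by (rule cl(1))
  have vK: "v \<in> K k" for k using vH l2_scale[of \<Omega> 0 v] by (simp add: K_def)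
  have "?n v \<le> d"
  proof (rule LIMSEQ_le_const)
    have "(\<lambda>k. ?n (w k) - ?n (\<lambda>x. w k x - v x)) \<longlonglongrightarrow> d - 0"
    proof (intro tendsto_diff cl(2))
      have "(\<lambda>k. D k + 1 / real (Suc k)) \<longlonglongrightarrow> d + 0"
        using LIMSEQ_inverse_real_of_nat by (intro tendsto_intros d) (simp add: inverse_eq_divide)
      then have "(\<lambda>k. D k + 1 / real (Suc k)) \<longlonglongrightarrow> d" by simp
      then show "(\<lambda>k. ?n (w k)) \<longlonglongrightarrow> d"
        by (rule real_tendsto_sandwich[OF always_eventually[OF allI[OF Dle[OF wK]]] always_eventually[OF allI[OF less_imp_le[OF wD]]] d(1)])
    qed
    then show "(\<lambda>k. ?n (w k) + ?n (\<lambda>x. w k x - v x)) \<longlonglongrightarrow> d"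
      using tendsto_add[OF tendsto_add[OF \<open>(\<lambda>k. ?n (w k) - ?n (\<lambda>x. w k x - v x)) \<longlonglongrightarrow> d - 0\<close> cl(2)] cl(2)] by simp
    have "?n v \<le> ?n (w k) + ?n (\<lambda>x. w k x - v x)" for k
      using H01_norm_triangle_diff[OF KH(1)[OF wK[of k]] H01_diff[OF KH(1)[OF wK[of k]] vH]] by simp
    then show "\<exists>N. \<forall>n\<ge>N. ?n v \<le> ?n (w n) + ?n (\<lambda>x. w n x - v x)" by blast
  qed
  moreover have "d \<le> ?n v" using Dle[OF vK] by (intro LIMSEQ_le_const2[OF d(1)]) auto
  ultimately have dv: "d = ?n v" by simp
  \<comment> \<open>Now the segment from \<open>v\<close> to \<open>u n\<close> with step
    \<open>s\<close>. The quadratic remainder is at most \<open>s^2 * T\<close>, and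
    \<open>s\<close> makes it at most \<open>s * (e / 2)\<close>; the gap between \<open>D k\<close>
    and the norm of \<open>v\<close> costs another \<open>s * (e / 2)\<close>. Dividing by
    \<open>s\<close> bounds \<open>2 * ((norm v)^2 - g)\<close> by \<open>e\<close>, which is the
    claim after expanding the square of the difference.\<close>
  define T where "T = (M + ?n v)\<^sup>2 + 1"
  have T: "T > 0" "(?n (\<lambda>x. u n x - v x))\<^sup>2 \<le> T" for n
  proof -
    show "T > 0" by (simp add: T_def add_nonneg_pos)
    have "(?n (\<lambda>x. u n x - v x))\<^sup>2 \<le> (M + ?n v)\<^sup>2"
      using H01_norm_triangle_diff[OF u[of n] vH] M[of n] by (intro power_mono) (auto simp: H01_norm_nonneg)
    then show "(?n (\<lambda>x. u n x - v x))\<^sup>2 \<le> T" by (simp add: T_def)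
  qed
  fix e :: real assume e: "e > 0"
  define s where "s = min 1 (e / (2 * T))"
  have s: "0 < s" "s \<le> 1" "s * T \<le> e / 2" using e T(1) by (auto simp: s_def min_def field_simps)
  have "(\<lambda>k. (?n v)\<^sup>2 - (D k)\<^sup>2) \<longlonglongrightarrow> (?n v)\<^sup>2 - d\<^sup>2" by (intro tendsto_intros d)
  then have "\<forall>\<^sub>F k in sequentially. (?n v)\<^sup>2 - (D k)\<^sup>2 < s * (e / 2)"
    by (rule order_tendstoD(2)) (use s e dv in simp)
  then obtain k where k: "(?n v)\<^sup>2 - (D k)\<^sup>2 < s * (e / 2)" by (auto simp: eventually_sequentially)
  show "\<forall>\<^sub>F n in sequentially. (?n v)\<^sup>2 + (?n (\<lambda>x. u n x - v x))\<^sup>2 \<le> (?n (u n))\<^sup>2 + e"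
    using evK[of k]
  proof eventually_elim
    fix n assume uK: "u n \<in> K k"
    let ?t = "(?n (\<lambda>x. u n x - v x))\<^sup>2"
    have H: "v \<in> H1 \<Omega>" "u n \<in> H1 \<Omega>" using vH u H01_H1 by auto
    define g where "g = gip \<Omega> v (u n)"
    have t: "?t = (?n (u n))\<^sup>2 - 2 * g + (?n v)\<^sup>2"
      using gip_lincomb_self[OF H(2,1), of 1 "-1"] by (simp add: g_def gip_commute)
    have "(D k)\<^sup>2 \<le> (?n (\<lambda>x. (1 - s) * v x + s * u n x))\<^sup>2"
      using Dle[OF conv[OF vK uK, of s]] s D0 by (intro power_mono) auto
    also have "\<dots> = (?n v)\<^sup>2 + 2 * s * (g - (?n v)\<^sup>2) + s\<^sup>2 * ?t"
      unfolding gip_lincomb_self[OF H] t g_def[symmetric] by (simp add: power2_eq_square algebra_simps)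
    finally have "- (2 * s * (g - (?n v)\<^sup>2)) \<le> s * (e / 2) + s\<^sup>2 * ?t" using k by linarith
    also have "s\<^sup>2 * ?t \<le> s * (e / 2)"
    proof -
      have "s * ?t \<le> e / 2" using mult_left_mono[OF T(2)[of n], of s] s by linarith
      then show ?thesis using mult_left_mono[of "s * ?t" "e/2" s] s by (simp add: power2_eq_square mult.assoc)
    qed
    finally have "s * (- 2 * (g - (?n v)\<^sup>2)) \<le> s * e" by (simp add: algebra_simps)
    then have "- 2 * (g - (?n v)\<^sup>2) \<le> e" using s(1) by (simp only: mult_le_cancel_left_pos)
    then show "(?n v)\<^sup>2 + ?t \<le> (?n (u n))\<^sup>2 + e" unfolding t by (simp add: algebra_simps)
  qed
qed

end

subsection \<open>Lebesgue norms on the Sobolev space\<close>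

definition pint :: "'a::euclidean_space set \<Rightarrow> real \<Rightarrow> ('a \<Rightarrow> real) \<Rightarrow> real" where
  "pint \<Omega> r u = (LINT x|lebesgue_on \<Omega>. \<bar>u x\<bar> powr r)"

lemma pint_nonneg: "pint \<Omega> r u \<ge> 0"
  by (simp add: pint_def)

lemma Lq_norm_powr: "r > 0 \<Longrightarrow> Lq_norm \<Omega> r u powr r = pint \<Omega> r u"
  using pint_nonneg[of \<Omega> r u] by (simp add: Lq_norm_def powr_powr flip: pint_def)

section \<open>Elementary inequalities for real powers\<close>

lemma square_powr_half: "x > 0 \<Longrightarrow> (x\<^sup>2) powr (r / 2) = x powr r" for x r :: real
proof -
  assume x: "x > 0"
  have "(x\<^sup>2) powr (r / 2) = (x powr 2) powr (r / 2)" using x by simp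
  also have "\<dots> = x powr r" by (subst powr_powr) simp
  finally show ?thesis .
qed

text \<open>Convexity of the power applied to \<open>x + y\<close> as the combination of
  \<open>x / (1 - s)\<close> and \<open>y / s\<close> with weights \<open>1 - s\<close> and
  \<open>s\<close>. The point of the free \<open>s\<close>: the coefficient of the first term can be
  brought as close to 1 as desired, at the price of a large second one.\<close>

lemma powr_convex_bound:
  fixes x y :: real
  assumes r: "r > 1" and s: "0 < s" "s < 1"
  shows "\<bar>x + y\<bar> powr r \<le> (1 - s) powr (1 - r) * \<bar>x\<bar> powr r + s powr (1 - r) * \<bar>y\<bar> powr r"
proof (cases "x = 0 \<or> y = 0")
  case True
  have "s powr 0 \<le> s powr (1 - r)" "(1 - s) powr 0 \<le> (1 - s) powr (1 - r)"
    by (rule powr_mono'; use s r in simp)+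
  then show ?thesis using True s r by (auto simp: mult_le_cancel_right1)
next
  case False
  have c: "convex_on {0<..} (\<lambda>t::real. t powr r)"
    using r by (intro powr_convex) simp
  have "\<bar>x + y\<bar> powr r \<le> ((1 - s) * (\<bar>x\<bar> / (1 - s)) + s * (\<bar>y\<bar> / s)) powr r"
    using s r by (intro powr_mono2) auto
  also have "\<dots> \<le> (1 - s) * (\<bar>x\<bar> / (1 - s)) powr r + s * (\<bar>y\<bar> / s) powr r"
    using convex_onD[OF c, of s "\<bar>x\<bar> / (1 - s)" "\<bar>y\<bar> / s"] s False by simp
  also have "\<dots> = (1 - s) powr (1 - r) * \<bar>x\<bar> powr r + s powr (1 - r) * \<bar>y\<bar> powr r"
    using s by (simp add: powr_divide powr_diff)
  finally show ?thesis .
qed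

lemma powr_le_1_plus:
  fixes x :: real
  assumes "0 \<le> x" "0 < r" "r \<le> q"
  shows "x powr r \<le> 1 + x powr q"
proof (cases "x \<le> 1")
  case True
  then have "x powr r \<le> 1" using assms by (simp add: powr_le1)
  then show ?thesis by (simp add: add_increasing2)
next
  case False
  then have "x powr r \<le> x powr q" using assms by (intro powr_mono) auto
  then show ?thesis by simp
qed

text \<open>Split at the height \<open>K\<close>: below it the square dominates, above it the
  critical power. Since \<open>p - q\<close> is negative, a large \<open>K\<close> makes the
  critical coefficient small.\<close>

lemma powr_interpolation:
  fixes x :: real
  assumes "0 \<le> x" "2 < p" "p < q" "K > 0"
  shows "x powr p \<le> K powr (p - 2) * x\<^sup>2 + K powr (p - q) * x powr q"
proof (cases "x = 0")
  case False
  then have x: "x > 0" using assms by simp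
  have x2: "x\<^sup>2 = x powr 2" using x by (simp add: powr_numeral)
  show ?thesis
  proof (cases "x \<le> K")
    case True
    have "x powr p = x powr (p - 2) * x\<^sup>2" unfolding x2 by (simp flip: powr_add)
    also have "\<dots> \<le> K powr (p - 2) * x\<^sup>2" using True x assms by (intro mult_right_mono powr_mono2) auto
    finally show ?thesis by (simp add: add_increasing2)
  next
    case False
    have "x powr p = x powr (p - q) * x powr q" by (simp flip: powr_add)
    also have "\<dots> \<le> K powr (p - q) * x powr q" using False x assms by (intro mult_right_mono powr_mono2') auto
    finally show ?thesis by (simp add: add_increasing)
  qed
qed simp

section \<open>The Sobolev inequality and the embeddings it gives\<close>

locale sobolev_dom = bounded_dom \<Omega> for \<Omega> :: "'a::euclidean_space set" +
  fixes q S :: real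
  assumes N4: "DIM('a) > 4" and q_eq: "q = crit_exp DIM('a)"
    and S_eq: "S = sobolev_const \<Omega>" and S_pos: "S > 0"
begin

abbreviation "nrm \<equiv> H01_norm \<Omega>"

lemma q_bounds: "2 < q" "q < 4"
  using N4 by (auto simp: q_eq crit_exp_def field_simps)

lemma H01_measurable: "u \<in> H01 \<Omega> \<Longrightarrow> u \<in> borel_measurable (lebesgue_on \<Omega>)"
  by (intro L2_measurable H1_L2 H01_H1)

lemma sobolev_inequality:
  assumes u: "u \<in> H01 \<Omega>"
  shows "integrable (lebesgue_on \<Omega>) (\<lambda>x. \<bar>u x\<bar> powr q)"
    and "pint \<Omega> q u \<le> S powr (- q / 2) * nrm u powr q"
proof -
  have [measurable]: "u \<in> borel_measurable (lebesgue_on \<Omega>)" by (rule H01_measurable[OF u])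
  have "integrable (lebesgue_on \<Omega>) (\<lambda>x. \<bar>u x\<bar> powr q) \<and> pint \<Omega> q u \<le> S powr (- q / 2) * nrm u powr q"
  proof (cases "AE x in lebesgue_on \<Omega>. u x = 0")
    case True
    have z: "AE x in lebesgue_on \<Omega>. \<bar>u x\<bar> powr q = 0" using True by eventually_elim simp
    have "integrable (lebesgue_on \<Omega>) (\<lambda>x. \<bar>u x\<bar> powr q) \<longleftrightarrow> integrable (lebesgue_on \<Omega>) (\<lambda>x. 0::real)"
      by (rule integrable_cong_AE) (use z in auto)
    moreover have "pint \<Omega> q u = 0" unfolding pint_def
      using z by (subst integral_cong_AE[of _ _ "\<lambda>_. 0"]) auto
    ultimately show ?thesis by simp
  next
    case False
    then have uN: "u \<in> H01_nonzero \<Omega>" using u by (simp add: H01_nonzero_def)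
    let ?L = "Lq_norm \<Omega> q u"
    have SL: "S \<le> (nrm u)\<^sup>2 / ?L\<^sup>2"
      unfolding S_eq sobolev_const_def q_eq by (rule cINF_lower[OF _ uN]) (auto intro!: bdd_belowI2[of _ 0])
    \<comment> \<open>Integrability comes out of the positivity of \<open>S\<close>: a
      non-integrable power has Bochner integral 0, so the Lebesgue norm would be 0 and the quotient,
      a division by 0, would be 0 as well, below \<open>S\<close>.\<close>
    then have L: "?L \<noteq> 0" using S_pos by auto
    then have i0: "pint \<Omega> q u \<noteq> 0" by (auto simp: Lq_norm_def pint_def)
    then have int: "integrable (lebesgue_on \<Omega>) (\<lambda>x. \<bar>u x\<bar> powr q)"
      using not_integrable_integral_eq[of "lebesgue_on \<Omega>" "\<lambda>x. \<bar>u x\<bar> powr q"] by (auto simp: pint_def)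
    have L2: "?L\<^sup>2 \<le> (nrm u)\<^sup>2 / S" using SL L S_pos by (simp add: field_simps)
    have Lpos: "?L > 0" using L by (simp add: Lq_norm_def)
    have "pint \<Omega> q u = (?L\<^sup>2) powr (q / 2)"
      using Lq_norm_powr[of q \<Omega> u] q_bounds by (simp add: square_powr_half[OF Lpos])
    also have "\<dots> \<le> ((nrm u)\<^sup>2 / S) powr (q / 2)" using L2 q_bounds by (intro powr_mono2) auto
    also have "\<dots> = S powr (- q / 2) * nrm u powr q"
    proof -
      have n: "nrm u > 0"
      proof (rule ccontr)
        assume "\<not> nrm u > 0"
        then have "nrm u = 0" using H01_norm_nonneg[of \<Omega> u] by linarith
        then show False using L2 Lpos by simp
      qed
      have "((nrm u)\<^sup>2 / S) powr (q / 2) = ((nrm u)\<^sup>2) powr (q / 2) / S powr (q / 2)"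
        by (rule powr_divide)
      also have "\<dots> = S powr (- (q / 2)) * nrm u powr q"
        unfolding square_powr_half[OF n] powr_minus[of S "q / 2"] by (simp only: divide_inverse mult.commute)
      finally show ?thesis by simp
    qed
    finally show ?thesis using int by simp
  qed
  then show "integrable (lebesgue_on \<Omega>) (\<lambda>x. \<bar>u x\<bar> powr q)" "pint \<Omega> q u \<le> S powr (- q / 2) * nrm u powr q" by auto
qed

lemma powr_integrable:
  assumes u: "u \<in> H01 \<Omega>" and r: "0 < r" "r \<le> q"
  shows "integrable (lebesgue_on \<Omega>) (\<lambda>x. \<bar>u x\<bar> powr r)"
proof -
  interpret finite_measure "lebesgue_on \<Omega>" by (rule finite_measure_lebesgue_on[OF lmeasurable_dom])
  have [measurable]: "u \<in> borel_measurable (lebesgue_on \<Omega>)" by (rule H01_measurable[OF u])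
  show ?thesis
  proof (rule Bochner_Integration.integrable_bound)
    show "integrable (lebesgue_on \<Omega>) (\<lambda>x. 1 + \<bar>u x\<bar> powr q)"
      using sobolev_inequality(1)[OF u] by simp
    show "AE x in lebesgue_on \<Omega>. norm (\<bar>u x\<bar> powr r) \<le> norm (1 + \<bar>u x\<bar> powr q)"
      using powr_le_1_plus[OF _ r] by (auto intro!: AE_I2 simp: add_nonneg_nonneg)
  qed measurable
qed

lemma pint_scale: "pint \<Omega> r (\<lambda>x. c * u x) = \<bar>c\<bar> powr r * pint \<Omega> r u"
  by (simp add: pint_def abs_mult powr_mult)

lemma pint_eq_0_iff:
  assumes u: "u \<in> H01 \<Omega>" and r: "0 < r" "r \<le> q"
  shows "pint \<Omega> r u = 0 \<longleftrightarrow> (AE x in lebesgue_on \<Omega>. u x = 0)"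
  unfolding pint_def by (subst integral_nonneg_eq_0_iff_AE[OF powr_integrable[OF u r]]) auto

lemma nrm_eq_0:
  assumes u: "u \<in> H01 \<Omega>" and 0: "nrm u = 0"
  shows "AE x in lebesgue_on \<Omega>. u x = 0"
proof -
  have "pint \<Omega> q u = 0" using sobolev_inequality(2)[OF u] 0 pint_nonneg[of \<Omega> q u] by simp
  then show ?thesis using pint_eq_0_iff[OF u, of q] q_bounds by simp
qed

lemma nrm_pos: "u \<in> H01_nonzero \<Omega> \<Longrightarrow> nrm u > 0"
  using nrm_eq_0 H01_norm_nonneg[of \<Omega> u] by (force simp: H01_nonzero_def less_le)

text \<open>By homogeneity it suffices to treat gradient norm 1, where \<open>t powr r\<close> is at
  most \<open>1 + t powr q\<close>; integrating gives the measure of the domain plus the Sobolev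
  constant, which is the witness.\<close>

lemma embedding:
  assumes r: "0 < r" "r \<le> q"
  obtains K where "K > 0" "\<And>u. u \<in> H01 \<Omega> \<Longrightarrow> pint \<Omega> r u \<le> K * nrm u powr r"
proof
  interpret finite_measure "lebesgue_on \<Omega>" by (rule finite_measure_lebesgue_on[OF lmeasurable_dom])
  let ?K = "measure lebesgue \<Omega> + S powr (- q / 2)"
  show "?K > 0" using S_pos by (simp add: add_nonneg_pos)
  fix u assume u: "u \<in> H01 \<Omega>"
  show "pint \<Omega> r u \<le> ?K * nrm u powr r"
  proof (cases "nrm u = 0")
    case True
    then show ?thesis using pint_eq_0_iff[OF u r] nrm_eq_0[OF u] by simp
  next
    case False
    then have n: "nrm u > 0" using H01_norm_nonneg[of \<Omega> u] by simp
    define w where "w x = (1 / nrm u) * u x" for x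
    have w: "w \<in> H01 \<Omega>" unfolding w_def by (rule H01_scale[OF u])
    have nw: "nrm w = 1" unfolding w_def using H01_norm_scale[OF H01_H1[OF u], of "1 / nrm u"] n by simp
    have uw: "u = (\<lambda>x. nrm u * w x)" using n by (auto simp: w_def)
    have "pint \<Omega> r w \<le> (LINT x|lebesgue_on \<Omega>. 1 + \<bar>w x\<bar> powr q)"
      unfolding pint_def using sobolev_inequality(1)[OF w] powr_le_1_plus[OF _ r]
      by (intro integral_mono powr_integrable[OF w r]) auto
    also have "\<dots> = measure lebesgue \<Omega> + pint \<Omega> q w"
      using sobolev_inequality(1)[OF w] lmeasurable_dom by (simp add: pint_def measure_restrict_space)
    also have "\<dots> \<le> ?K" using sobolev_inequality(2)[OF w] nw by simp
    finally have "nrm u powr r * pint \<Omega> r w \<le> nrm u powr r * ?K" by (intro mult_left_mono) auto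
    moreover have "pint \<Omega> r u = nrm u powr r * pint \<Omega> r w"
      using pint_scale[of r "nrm u" w] n by (subst uw) simp
    ultimately show ?thesis by (simp add: mult.commute)
  qed
qed

lemma l2_eq_pint: "(l2 \<Omega> u)\<^sup>2 = pint \<Omega> 2 u" for u :: "'a \<Rightarrow> real"
  unfolding l2_square ip_self pint_def by (intro Bochner_Integration.integral_cong) (auto simp: powr_numeral)

text \<open>Here a consequence of the Sobolev inequality, as the case \<open>r = 2\<close> of the
  embedding; it supplies the L2 bound that Rellich compactness asks for.\<close>

lemma poincare: obtains K where "K > 0" "\<And>u. u \<in> H01 \<Omega> \<Longrightarrow> l2 \<Omega> u \<le> K * nrm u"
proof -
  obtain K where K: "K > 0" "\<And>u. u \<in> H01 \<Omega> \<Longrightarrow> pint \<Omega> 2 u \<le> K * nrm u powr 2"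
    using embedding[of 2] q_bounds by auto
  have "l2 \<Omega> u \<le> sqrt K * nrm u" if "u \<in> H01 \<Omega>" for u
  proof (rule power2_le_imp_le)
    show "(l2 \<Omega> u)\<^sup>2 \<le> (sqrt K * nrm u)\<^sup>2"
      using K(2)[OF that] K(1) H01_norm_nonneg[of \<Omega> u] by (simp add: l2_eq_pint power_mult_distrib powr_numeral)
  qed (use K H01_norm_nonneg[of \<Omega> u] in simp)
  then show ?thesis using K(1) by (intro that[of "sqrt K"]) auto
qed

section \<open>Lebesgue norms along sequences\<close>

lemma pint_add_le:
  assumes u: "u \<in> H01 \<Omega>" and v: "v \<in> H01 \<Omega>" and r: "1 < r" "r \<le> q" and s: "0 < s" "s < 1"
  shows "pint \<Omega> r (\<lambda>x. u x + v x) \<le> (1 - s) powr (1 - r) * pint \<Omega> r u + s powr (1 - r) * pint \<Omega> r v"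
proof -
  have "pint \<Omega> r (\<lambda>x. u x + v x) \<le> (LINT x|lebesgue_on \<Omega>. (1 - s) powr (1 - r) * \<bar>u x\<bar> powr r + s powr (1 - r) * \<bar>v x\<bar> powr r)"
    unfolding pint_def using powr_convex_bound[OF r(1) s] r
    by (intro integral_mono powr_integrable H01_add u v Bochner_Integration.integrable_add integrable_mult_right) auto
  also have "\<dots> = (1 - s) powr (1 - r) * pint \<Omega> r u + s powr (1 - r) * pint \<Omega> r v"
    using powr_integrable[OF u, of r] powr_integrable[OF v, of r] r by (simp add: pint_def)
  finally show ?thesis .
qed

text \<open>Interpolation between L2, where the sequence tends to 0, and the critical exponent,
  where it is only bounded.\<close>

lemma subcritical_convergence:
  assumes w: "\<And>n. w n \<in> H01 \<Omega>" and B: "\<And>n. pint \<Omega> q (w n) \<le> B"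
    and l: "(\<lambda>n. l2 \<Omega> (w n)) \<longlonglongrightarrow> 0" and p: "2 < p" "p < q" and e: "e > 0"
  shows "\<forall>\<^sub>F n in sequentially. pint \<Omega> p (w n) \<le> e"
proof -
  have B0: "B \<ge> 0" using B[of 0] pint_nonneg[of \<Omega> q "w 0"] by linarith
  \<comment> \<open>\<open>K\<close> solves \<open>K powr (p - q) = c\<close>, so that the critical
    part, bounded by \<open>B\<close>, takes at most half of \<open>e\<close>.\<close>
  define c where "c = e / (2 * (B + 1))"
  define K where "K = c powr (1 / (p - q))"
  have b: "c > 0" using e B0 by (simp add: c_def)
  have K: "K > 0" "K powr (p - q) = c" using b p by (auto simp: K_def powr_powr)
  have KB: "K powr (p - q) * B \<le> e / 2" unfolding K(2) c_def using e B0 by (simp add: field_simps)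
  have "(\<lambda>n. K powr (p - 2) * (l2 \<Omega> (w n))\<^sup>2) \<longlonglongrightarrow> K powr (p - 2) * 0\<^sup>2" by (intro tendsto_intros l)
  then have "\<forall>\<^sub>F n in sequentially. K powr (p - 2) * (l2 \<Omega> (w n))\<^sup>2 < e / 2"
    by (rule order_tendstoD(2)) (use e in simp)
  then show ?thesis
  proof eventually_elim
    fix n assume n: "K powr (p - 2) * (l2 \<Omega> (w n))\<^sup>2 < e / 2"
    have i2: "integrable (lebesgue_on \<Omega>) (\<lambda>x. (w n x)\<^sup>2)" using L2_integrable[OF H1_L2[OF H01_H1[OF w[of n]]]] by simp
    have "pint \<Omega> p (w n) \<le> (LINT x|lebesgue_on \<Omega>. K powr (p - 2) * (w n x)\<^sup>2 + K powr (p - q) * \<bar>w n x\<bar> powr q)"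
      unfolding pint_def using powr_interpolation[OF abs_ge_zero p K(1)] p
      by (intro integral_mono powr_integrable w Bochner_Integration.integrable_add integrable_mult_right i2) auto
    also have "\<dots> = K powr (p - 2) * (l2 \<Omega> (w n))\<^sup>2 + K powr (p - q) * pint \<Omega> q (w n)"
      using i2 powr_integrable[OF w[of n], of q] q_bounds by (simp add: pint_def l2_square ip_self)
    also have "\<dots> \<le> e / 2 + K powr (p - q) * B" using n B[of n] by (intro add_mono mult_left_mono) auto
    finally show "pint \<Omega> p (w n) \<le> e" using KB by linarith
  qed
qed

text \<open>By convexity \<open>\<bar>u\<^sub>n\<bar>\<^sup>q - (1 + \<eta>) \<bar>u\<^sub>n - v\<bar>\<^sup>q\<close> is dominated by a multiple of \<open>\<bar>v\<bar>\<^sup>q\<close>, so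
  its positive part converges in mean.\<close>

lemma brezis_lieb_upper:
  assumes u: "\<And>n. u n \<in> H01 \<Omega>" and v: "v \<in> H01 \<Omega>" and B: "\<And>n. pint \<Omega> q (\<lambda>x. u n x - v x) \<le> B"
    and ae: "AE x in lebesgue_on \<Omega>. (\<lambda>n. u n x) \<longlonglongrightarrow> v x" and e: "e > 0"
  shows "\<forall>\<^sub>F n in sequentially. pint \<Omega> q (u n) \<le> pint \<Omega> q v + pint \<Omega> q (\<lambda>x. u n x - v x) + e"
proof -
  let ?M = "lebesgue_on \<Omega>"
  have B0: "B \<ge> 0" using B[of 0] pint_nonneg[of \<Omega> q "\<lambda>x. u 0 x - v x"] by linarith
  define \<eta> where "\<eta> = e / (2 * (B + 1))"
  have \<eta>: "\<eta> > 0" "\<eta> * B \<le> e / 2" using e B0 by (auto simp: \<eta>_def field_simps)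
  \<comment> \<open>Solves \<open>(1 - s) powr (1 - q) = 1 + \<eta>\<close>; the surplus
    \<open>\<eta>\<close> on the defect costs at most \<open>\<eta> * B\<close>, half of
    \<open>e\<close>.\<close>
  define s where "s = 1 - (1 + \<eta>) powr (1 / (1 - q))"
  have s: "0 < s" "s < 1" "(1 - s) powr (1 - q) = 1 + \<eta>"
  proof -
    have "(1 + \<eta>) powr (1 / (1 - q)) < (1 + \<eta>) powr 0" using \<eta> q_bounds by (intro powr_less_mono) (auto simp: divide_simps)
    then show "0 < s" using \<eta> by (simp add: s_def)
    show "s < 1" "(1 - s) powr (1 - q) = 1 + \<eta>" using \<eta> q_bounds by (auto simp: s_def powr_powr)
  qed
  define w where "w n x = u n x - v x" for n x
  have w: "w n \<in> H01 \<Omega>" for n unfolding w_def using H01_diff[OF u v] .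
  have [measurable]: "u n \<in> borel_measurable ?M" "v \<in> borel_measurable ?M" "w n \<in> borel_measurable ?M" for n
    using u v w by (auto intro: H01_measurable)
  define f where "f n x = max 0 (\<bar>u n x\<bar> powr q - (1 + \<eta>) * \<bar>w n x\<bar> powr q)" for n x
  have iv: "integrable ?M (\<lambda>x. \<bar>v x\<bar> powr q)" and iu: "integrable ?M (\<lambda>x. \<bar>u n x\<bar> powr q)" and iw: "integrable ?M (\<lambda>x. \<bar>w n x\<bar> powr q)" for n
    using powr_integrable q_bounds u v w by auto
  have fb: "f n x \<le> s powr (1 - q) * \<bar>v x\<bar> powr q" for n x
    using powr_convex_bound[of q s "w n x" "v x"] s q_bounds by (simp add: f_def w_def)
  have "(\<lambda>n. LINT x|?M. f n x) \<longlonglongrightarrow> (LINT x|?M. \<bar>v x\<bar> powr q)"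
  proof (rule integral_dominated_convergence)
    show "integrable ?M (\<lambda>x. s powr (1 - q) * \<bar>v x\<bar> powr q)" using iv by simp
    show "AE x in ?M. norm (f n x) \<le> s powr (1 - q) * \<bar>v x\<bar> powr q" for n
      using fb by (auto intro!: AE_I2 simp: f_def)
    show "AE x in ?M. (\<lambda>n. f n x) \<longlonglongrightarrow> \<bar>v x\<bar> powr q"
      using ae
    proof eventually_elim
      fix x assume l: "(\<lambda>n. u n x) \<longlonglongrightarrow> v x"
      have l0: "(\<lambda>n. \<bar>w n x\<bar>) \<longlonglongrightarrow> 0" using tendsto_diff[OF l tendsto_const[of "v x"]] unfolding w_def by (simp add: tendsto_rabs_zero)
      have "(\<lambda>n. f n x) \<longlonglongrightarrow> max 0 (\<bar>v x\<bar> powr q - (1 + \<eta>) * 0 powr q)"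
        unfolding f_def using q_bounds l l0 by (intro tendsto_intros) auto
      then show "(\<lambda>n. f n x) \<longlonglongrightarrow> \<bar>v x\<bar> powr q" using q_bounds by simp
    qed
  qed (auto simp: f_def[abs_def])
  then have "\<forall>\<^sub>F n in sequentially. (LINT x|?M. f n x) < pint \<Omega> q v + e / 2"
    by (rule order_tendstoD(2)) (use e in \<open>simp add: pint_def\<close>)
  then show ?thesis
  proof eventually_elim
    fix n assume n: "(LINT x|?M. f n x) < pint \<Omega> q v + e / 2"
    have "pint \<Omega> q (u n) - (1 + \<eta>) * pint \<Omega> q (w n) = (LINT x|?M. \<bar>u n x\<bar> powr q - (1 + \<eta>) * \<bar>w n x\<bar> powr q)"
      using iu iw by (simp add: pint_def)
    also have "\<dots> \<le> (LINT x|?M. f n x)"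
    proof (rule integral_mono)
      show "integrable ?M (f n)" unfolding f_def[abs_def] using iu iw by (intro integrable_max) auto
    qed (use iu iw in \<open>auto simp: f_def\<close>)
    finally have "pint \<Omega> q (u n) \<le> pint \<Omega> q (w n) + \<eta> * pint \<Omega> q (w n) + pint \<Omega> q v + e / 2"
      using n by (simp add: algebra_simps)
    also have "\<eta> * pint \<Omega> q (w n) \<le> \<eta> * B" using B \<eta> by (intro mult_left_mono) (auto simp: w_def[abs_def])
    finally show "pint \<Omega> q (u n) \<le> pint \<Omega> q v + pint \<Omega> q (\<lambda>x. u n x - v x) + e"
      using \<eta>(2) by (simp add: w_def[abs_def])
  qed
qed

text \<open>Collects what a bounded sequence offers: the first two inequalities still contain the
  defect, because nothing prevents critical mass from escaping, whereas the subcritical term passes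
  to the limit without one.\<close>

lemma compactness:
  assumes u: "\<And>n. u n \<in> H01 \<Omega>" and M: "\<And>n. nrm (u n) \<le> M" and p: "2 < p" "p < q"
  obtains r :: "nat \<Rightarrow> nat" and v where "strict_mono r" "v \<in> H01 \<Omega>"
    "\<And>e. e > 0 \<Longrightarrow> \<forall>\<^sub>F n in sequentially.
        (nrm v)\<^sup>2 + (nrm (\<lambda>x. u (r n) x - v x))\<^sup>2 \<le> (nrm (u (r n)))\<^sup>2 + e \<and>
        pint \<Omega> q (u (r n)) \<le> pint \<Omega> q v + pint \<Omega> q (\<lambda>x. u (r n) x - v x) + e \<and>
        pint \<Omega> p (u (r n)) \<le> pint \<Omega> p v + e"
proof -
  obtain K where K: "K > 0" "\<And>u. u \<in> H01 \<Omega> \<Longrightarrow> l2 \<Omega> u \<le> K * nrm u" using poincare by blast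
  have M0: "M \<ge> 0" using M[of 0] H01_norm_nonneg[of \<Omega> "u 0"] by linarith
  have "K * nrm (u n) \<le> K * M" for n using M K(1) by (intro mult_left_mono) auto
  then have "l2 \<Omega> (u n) \<le> max M (K * M)" for n using K(2)[OF u[of n]] by (meson max.cobounded2 order_trans)
  moreover have "nrm (u n) \<le> max M (K * M)" for n using M[of n] by simp
  ultimately obtain r1 v where r1: "strict_mono (r1::nat\<Rightarrow>nat)" and vL: "v \<in> L2 \<Omega>" and l1: "(\<lambda>n. l2 \<Omega> (\<lambda>x. u (r1 n) x - v x)) \<longlonglongrightarrow> 0"
    using rellich[of u "max M (K * M)"] u by blast
  obtain r2 where r2: "strict_mono (r2::nat\<Rightarrow>nat)" and ae: "AE x in lebesgue_on \<Omega>. (\<lambda>n. u (r1 (r2 n)) x) \<longlonglongrightarrow> v x"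
    using L2_AE_subseq[of "\<lambda>n. u (r1 n)" \<Omega> v] vL l1 u H01_H1 H1_L2 by blast
  define r where "r = r1 \<circ> r2"
  have r: "strict_mono r" unfolding r_def using r1 r2 by (rule strict_mono_o)
  have l: "(\<lambda>n. l2 \<Omega> (\<lambda>x. u (r n) x - v x)) \<longlonglongrightarrow> 0"
    using LIMSEQ_subseq_LIMSEQ[OF l1 r2] by (simp add: r_def o_def)
  note wl = weak_limit[of "\<lambda>n. u (r n)", OF u M vL l]
  have v: "v \<in> H01 \<Omega>" by (rule wl(1))
  have wH: "(\<lambda>x. u n x - v x) \<in> H01 \<Omega>" for n by (rule H01_diff[OF u v])
  have wM: "nrm (\<lambda>x. u n x - v x) \<le> M + nrm v" for n
    using H01_norm_triangle_diff[OF u[of n] v] M[of n] by linarith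
  define B where "B = S powr (- q / 2) * (M + nrm v) powr q"
  have B: "pint \<Omega> q (\<lambda>x. u n x - v x) \<le> B" for n
    unfolding B_def using wM[of n] q_bounds H01_norm_nonneg
    by (intro order_trans[OF sobolev_inequality(2)[OF wH]] mult_left_mono powr_mono2) auto
  have ae': "AE x in lebesgue_on \<Omega>. (\<lambda>n. u (r n) x) \<longlonglongrightarrow> v x" using ae by (simp add: r_def)
  show ?thesis
  proof (rule that[OF r v])
    fix e :: real assume e: "e > 0"
    define P where "P = pint \<Omega> p v"
    have P0: "P \<ge> 0" by (simp add: P_def pint_nonneg)
    \<comment> \<open>The same device as for the critical term:
      \<open>(1 - s) powr (1 - p) = 1 + c\<close> with \<open>c * P\<close> at most half of
      \<open>e\<close>. The large coefficient \<open>s powr (1 - p)\<close> meets a defect that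
      tends to 0.\<close>
    define c where "c = e / (2 * (P + 1))"
    define s where "s = 1 - (1 + c) powr (1 / (1 - p))"
    have b: "c > 0" using e P0 by (simp add: c_def)
    have s: "0 < s" "s < 1" "(1 - s) powr (1 - p) = 1 + c"
    proof -
      have "(1 + c) powr (1 / (1 - p)) < (1 + c) powr 0"
        using b p by (intro powr_less_mono) (auto simp: divide_simps)
      then show "0 < s" using b by (simp add: s_def)
      show "s < 1" "(1 - s) powr (1 - p) = 1 + c" using b p by (auto simp: s_def powr_powr)
    qed
    have sp: "s powr (1 - p) > 0" using s by simp
    have "e / (2 * s powr (1 - p)) > 0" using e sp by simp
    note sc = subcritical_convergence[of "\<lambda>n x. u (r n) x - v x", OF wH B l p this]
    from wl(2)[OF e] brezis_lieb_upper[of "\<lambda>n. u (r n)", OF u v B ae' e] sc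
    show "\<forall>\<^sub>F n in sequentially.
        (nrm v)\<^sup>2 + (nrm (\<lambda>x. u (r n) x - v x))\<^sup>2 \<le> (nrm (u (r n)))\<^sup>2 + e \<and>
        pint \<Omega> q (u (r n)) \<le> pint \<Omega> q v + pint \<Omega> q (\<lambda>x. u (r n) x - v x) + e \<and>
        pint \<Omega> p (u (r n)) \<le> pint \<Omega> p v + e"
    proof eventually_elim
      fix n
      assume 1: "(nrm v)\<^sup>2 + (nrm (\<lambda>x. u (r n) x - v x))\<^sup>2 \<le> (nrm (u (r n)))\<^sup>2 + e"
        and 2: "pint \<Omega> q (u (r n)) \<le> pint \<Omega> q v + pint \<Omega> q (\<lambda>x. u (r n) x - v x) + e"
        and 3: "pint \<Omega> p (\<lambda>x. u (r n) x - v x) \<le> e / (2 * s powr (1 - p))"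
      have "pint \<Omega> p (u (r n)) \<le> (1 - s) powr (1 - p) * P + s powr (1 - p) * pint \<Omega> p (\<lambda>x. u (r n) x - v x)"
        using pint_add_le[OF v wH[of "r n"], of p s] p s by (simp add: P_def)
      also have "\<dots> \<le> (1 + c) * P + s powr (1 - p) * (e / (2 * s powr (1 - p)))"
        using 3 sp s(3) by (intro add_mono mult_left_mono) auto
      also have "\<dots> = P + c * P + e / 2" using sp by (simp add: distrib_right)
      also have "c * P \<le> e / 2" using e P0 by (simp add: c_def field_simps)
      finally show "(nrm v)\<^sup>2 + (nrm (\<lambda>x. u (r n) x - v x))\<^sup>2 \<le> (nrm (u (r n)))\<^sup>2 + e \<and>
        pint \<Omega> q (u (r n)) \<le> pint \<Omega> q v + pint \<Omega> q (\<lambda>x. u (r n) x - v x) + e \<and>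
        pint \<Omega> p (u (r n)) \<le> pint \<Omega> p v + e" using 1 2 by (simp add: P_def)
    qed
  qed
qed

end

subsection \<open>Fibres of the energy\<close>

lemma powr_Young:
  fixes x z :: real
  assumes "r > 1" "x \<ge> 0" "z \<ge> 0"
  shows "r * (x powr (r - 1) * z) \<le> (r - 1) * x powr r + z powr r"
proof -
  have "x powr (r - 1) * z \<le> (x powr (r - 1)) powr (r / (r - 1)) / (r / (r - 1)) + z powr r / r"
    by (rule Youngs_inequality) (use assms in \<open>auto simp: field_simps\<close>)
  also have "(x powr (r - 1)) powr (r / (r - 1)) = x powr r" using assms by (simp add: powr_powr)
  finally have "r * (x powr (r - 1) * z) \<le> r * (x powr r / (r / (r - 1)) + z powr r / r)"
    using assms by (intro mult_left_mono) auto
  also have "\<dots> = (r - 1) * x powr r + z powr r" using assms by (simp add: field_simps)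
  finally show ?thesis .
qed

text \<open>The convex function \<open>|.| powr r\<close> lies above its tangent. Young's inequality
  for \<open>|x| powr (r - 1)\<close> and \<open>|x + y|\<close> gives this with all sign cases, and
  the point 0, handled together.\<close>

lemma powr_tangent:
  fixes x y :: real
  assumes r: "r > 1"
  shows "\<bar>x\<bar> powr r + r * (\<bar>x\<bar> powr (r - 1) * sgn x * y) \<le> \<bar>x + y\<bar> powr r"
proof -
  have "sgn x * (x + y) \<le> \<bar>x + y\<bar>" by (auto simp: sgn_real_def)
  then have "r * (\<bar>x\<bar> powr (r - 1) * (sgn x * (x + y))) \<le> r * (\<bar>x\<bar> powr (r - 1) * \<bar>x + y\<bar>)"
    using r by (intro mult_left_mono) auto
  also have "\<dots> \<le> (r - 1) * \<bar>x\<bar> powr r + \<bar>x + y\<bar> powr r" using r by (intro powr_Young) auto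
  finally have 1: "r * (\<bar>x\<bar> powr (r - 1) * (sgn x * (x + y))) \<le> (r - 1) * \<bar>x\<bar> powr r + \<bar>x + y\<bar> powr r" .
  have "\<bar>x\<bar> powr (r - 1) * \<bar>x\<bar> = \<bar>x\<bar> powr r"
    using powr_mult_base[of "\<bar>x\<bar>" "r - 1"] by (simp add: mult.commute)
  moreover have "sgn x * x = \<bar>x\<bar>" by (auto simp: sgn_real_def)
  ultimately have "\<bar>x\<bar> powr (r - 1) * (sgn x * (x + y)) = \<bar>x\<bar> powr r + \<bar>x\<bar> powr (r - 1) * sgn x * y"
    by (simp add: distrib_left mult.assoc)
  with 1 show ?thesis by (simp add: algebra_simps)
qed

text \<open>By the weighted AM-GM inequality, the largest \<open>P\<close> with \<open>P * t powr q \<le> a/2 * t\<^sup>2 + b/4 * t ^ 4\<close>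
  is \<open>(a / (2 * (1 - \<theta>))) powr (1 - \<theta>) * (b / (4 * \<theta>)) powr \<theta>\<close> with \<open>\<theta> = 2 / (N - 2)\<close>;
  the threshold \<open>C1\<close> is the condition that \<open>P\<close> exceed the Sobolev coefficient.\<close>

lemma kirchhoff_coercive:
  fixes a b S :: real
  assumes n: "n > 4" and S: "S > 0" and ab: "a > 0" "b > 0"
    and C1: "C1 n S < a powr ((real n - 4) / 2) * b"
  obtains \<kappa> where "\<kappa> > 0"
    "\<And>t. t \<ge> 0 \<Longrightarrow> \<kappa> * (a / 2 * t\<^sup>2 + b / 4 * t ^ 4) \<le> a / 2 * t\<^sup>2 + b / 4 * t ^ 4 - S powr (- crit_exp n / 2) * t powr crit_exp n / crit_exp n"
proof -
  define N where "N = real n"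
  have N: "N > 4" using n by (simp add: N_def)
  define q where "q = crit_exp n"
  have q: "q = 2 * N / (N - 2)" by (simp add: q_def crit_exp_def N_def)
  have q0: "q > 0" using N by (simp add: q)
  define \<theta> where "\<theta> = 2 / (N - 2)"
  have \<theta>: "0 < \<theta>" "\<theta> < 1" "q = 2 + 2 * \<theta>" using N by (auto simp: \<theta>_def q field_simps)
  define P where "P = (a / (2 * (1 - \<theta>))) powr (1 - \<theta>) * (b / (4 * \<theta>)) powr \<theta>"
  define Q where "Q = S powr (- q / 2) / q"
  have P0: "P > 0" using ab \<theta> by (simp add: P_def)
  have Q0: "Q > 0" using S q0 by (simp add: Q_def)
  have "ln Q < ln P"
  proof -
    have lnP: "ln P = (1 - \<theta>) * ln (a / (2 * (1 - \<theta>))) + \<theta> * ln (b / (4 * \<theta>))"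
      using ab \<theta> by (simp add: P_def ln_mult ln_powr)
    have e1: "a / (2 * (1 - \<theta>)) = a * (N - 2) / (2 * (N - 4))" and e2: "b / (4 * \<theta>) = b * (N - 2) / 8"
      using N by (auto simp: \<theta>_def field_simps)
    have l1: "ln (a / (2 * (1 - \<theta>))) = ln a + ln (N - 2) - ln 2 - ln (N - 4)"
    proof -
      have "ln (a * (N - 2) / (2 * (N - 4))) = ln (a * (N - 2)) - ln (2 * (N - 4))"
        using ab N by (subst ln_div) simp_all
      moreover have "ln (a * (N - 2)) = ln a + ln (N - 2)" using ab N by (subst ln_mult) simp_all
      moreover have "ln (2 * (N - 4)) = ln 2 + ln (N - 4)" using ab N by (subst ln_mult) simp_all
      ultimately show ?thesis unfolding e1 by linarith
    qed
    have ln8: "ln (8::real) = 3 * ln 2" using ln_realpow[of 2 3] by simp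
    have l2: "ln (b / (4 * \<theta>)) = ln b + ln (N - 2) - 3 * ln 2"
      unfolding e2 using ab N by (simp add: ln_mult ln_div ln8)
    have lq: "ln q = ln 2 + ln N - ln (N - 2)" unfolding q using N by (simp add: ln_mult ln_div)
    have lnQ: "ln Q = - (q / 2) * ln S - (ln 2 + ln N - ln (N - 2))"
      unfolding Q_def using S q0 by (simp add: ln_div ln_powr lq)
    have ln4: "ln (4::real) = 2 * ln 2" using ln_realpow[of 2 2] by simp
    have C1pos: "C1 n S > 0" using N S by (simp add: C1_def flip: N_def)
    have "ln (C1 n S) < ln (a powr ((N - 4) / 2) * b)"
      using C1 C1pos ab by (subst ln_less_cancel_iff) (auto simp: N_def)
    moreover have "ln (a powr ((N - 4) / 2) * b) = (N - 4) / 2 * ln a + ln b"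
      using ab by (simp add: ln_mult ln_powr)
    moreover have "ln (C1 n S) = 2 * ln 2 + (N - 4) / 2 * ln (N - 4) - ((N - 2) / 2 * ln N + N / 2 * ln S)"
      using N S by (simp add: C1_def ln_mult ln_div ln_powr ln4 flip: N_def)
    ultimately have d: "0 < (N - 4) / 2 * ln a + ln b - (2 * ln 2 + (N - 4) / 2 * ln (N - 4) - ((N - 2) / 2 * ln N + N / 2 * ln S))"
      by simp
    \<comment> \<open>The factor \<open>(N - 2) / 2\<close> turns the weights
      \<open>1 - \<theta>\<close> and \<open>\<theta>\<close> into \<open>(N - 4) / 2\<close> and 1.
      The difference of logarithms becomes exactly that of \<open>a powr ((N - 4) / 2) * b\<close>
      and \<open>C1\<close>, so the threshold is sharp for \<open>Q < P\<close>.\<close>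
    have key: "(N - 2) / 2 * (ln P - ln Q)
       = (N - 4) / 2 * ln a + ln b - (2 * ln 2 + (N - 4) / 2 * ln (N - 4) - ((N - 2) / 2 * ln N + N / 2 * ln S))"
    proof -
      have m: "(N - 2) / 2 * (1 - \<theta>) = (N - 4) / 2" "(N - 2) / 2 * \<theta> = 1" "(N - 2) / 2 * (q / 2) = N / 2"
        using N by (auto simp: \<theta>_def q field_simps)
      have "(N - 2) / 2 * (ln P - ln Q) = ((N - 2) / 2 * (1 - \<theta>)) * ln (a / (2 * (1 - \<theta>)))
          + ((N - 2) / 2 * \<theta>) * ln (b / (4 * \<theta>)) + ((N - 2) / 2 * (q / 2)) * ln S + (N - 2) / 2 * (ln 2 + ln N - ln (N - 2))"
      proof -
        have "M * (((1 - \<theta>) * X + \<theta> * Y) - (- h * Z - K)) = (M * (1 - \<theta>)) * X + (M * \<theta>) * Y + (M * h) * Z + M * K" for M X Y Z h K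
          by (simp add: algebra_simps)
        then show ?thesis unfolding lnP lnQ .
      qed
      also have "\<dots> = (N - 4) / 2 * (ln a + ln (N - 2) - ln 2 - ln (N - 4)) + (ln b + ln (N - 2) - 3 * ln 2)
          + N / 2 * ln S + (N - 2) / 2 * (ln 2 + ln N - ln (N - 2))"
        unfolding m l1 l2 by simp
      finally show ?thesis by (simp add: field_simps)
    qed
    have "0 < (N - 2) / 2 * (ln P - ln Q)" unfolding key by (rule d)
    moreover have "(N - 2) / 2 > 0" using N by simp
    ultimately have "0 < ln P - ln Q" by (simp only: zero_less_mult_pos)
    then show ?thesis by simp
  qed
  then have QP: "Q < P" using P0 Q0 by simp
  have am: "P * t powr q \<le> a / 2 * t\<^sup>2 + b / 4 * t ^ 4" if t: "t > 0" for t
  proof -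
    have "(a / (2 * (1 - \<theta>))) powr (1 - \<theta>) * (b / (4 * \<theta>) * t\<^sup>2) powr \<theta> \<le> (1 - \<theta>) * (a / (2 * (1 - \<theta>))) + \<theta> * (b / (4 * \<theta>) * t\<^sup>2)"
      by (rule Youngs_inequality_0) (use \<theta> ab t in auto)
    also have "\<dots> = a / 2 + b / 4 * t\<^sup>2" using \<theta> by (simp add: field_simps)
    also have "(a / (2 * (1 - \<theta>))) powr (1 - \<theta>) * (b / (4 * \<theta>) * t\<^sup>2) powr \<theta> = P * t powr (2 * \<theta>)"
    proof -
      have "(b / (4 * \<theta>) * t\<^sup>2) powr \<theta> = (b / (4 * \<theta>)) powr \<theta> * (t\<^sup>2) powr \<theta>" by (rule powr_mult)
      then show ?thesis using square_powr_half[OF t, of "2 * \<theta>"] by (simp add: P_def)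
    qed
    finally have "(P * t powr (2 * \<theta>)) * t\<^sup>2 \<le> (a / 2 + b / 4 * t\<^sup>2) * t\<^sup>2" by (rule mult_right_mono) simp
    moreover have "t powr q = t powr (2 * \<theta>) * t\<^sup>2" unfolding \<theta>(3) powr_add using t by simp
    ultimately show ?thesis by (simp add: algebra_simps power2_eq_square power4_eq_xxxx)
  qed
  show ?thesis
  proof (rule that)
    \<comment> \<open>The Sobolev term \<open>Q * t powr q\<close> is at most the fraction
      \<open>Q / P\<close> of the quadratic and quartic terms; the rest is the coercivity
      constant.\<close>
    show "1 - Q / P > 0" using QP P0 by simp
    fix t :: real assume t: "t \<ge> 0"
    show "(1 - Q / P) * (a / 2 * t\<^sup>2 + b / 4 * t ^ 4) \<le> a / 2 * t\<^sup>2 + b / 4 * t ^ 4 - S powr (- crit_exp n / 2) * t powr crit_exp n / crit_exp n"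
    proof (cases "t = 0")
      case False
      then have "Q / P * (P * t powr q) \<le> Q / P * (a / 2 * t\<^sup>2 + b / 4 * t ^ 4)"
        using am[of t] t P0 Q0 by (intro mult_left_mono) auto
      then have "Q * t powr q \<le> Q / P * (a / 2 * t\<^sup>2 + b / 4 * t ^ 4)" using P0 by simp
      then show ?thesis unfolding q_def[symmetric] by (simp add: Q_def left_diff_distrib)
    qed simp
  qed
qed

text \<open>Dividing the fibre without its subcritical term by \<open>t powr p\<close> gives a
  function \<open>g\<close> that blows up at 0, since p > 2, and at infinity, since p < 4; it
  attains a positive minimum \<open>m\<close>. A subcritical coefficient equal to \<open>m\<close>
  makes the fibre touch 0 from above.\<close>

lemma fibre_minimum:
  fixes A B C q p :: real
  assumes AB: "A > 0" "B > 0" and p: "2 < p" "p < 4" and \<kappa>: "\<kappa> > 0"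
    and lower: "\<And>t. t \<ge> 0 \<Longrightarrow> \<kappa> * (A * t\<^sup>2 + B * t ^ 4) \<le> A * t\<^sup>2 + B * t ^ 4 - C * t powr q"
  obtains t0 m where "t0 > 0" "m > 0" "A * t0\<^sup>2 + B * t0 ^ 4 - C * t0 powr q = m * t0 powr p"
    "\<And>t. t > 0 \<Longrightarrow> m * t powr p \<le> A * t\<^sup>2 + B * t ^ 4 - C * t powr q"
proof -
  define g where "g t = (A * t\<^sup>2 + B * t ^ 4 - C * t powr q) / t powr p" for t
  have gt: "A * t\<^sup>2 + B * t ^ 4 - C * t powr q = g t * t powr p" if "t > 0" for t
    using that by (simp add: g_def)
  have glow: "g t \<ge> \<kappa> * A * t powr (2 - p)" "g t \<ge> \<kappa> * B * t powr (4 - p)" if t: "t > 0" for t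
  proof -
    have t2: "t powr 2 = t\<^sup>2" "t powr 4 = t ^ 4" using t by simp_all
    have "\<kappa> * (A * t\<^sup>2) \<le> \<kappa> * (A * t\<^sup>2 + B * t ^ 4)" "\<kappa> * (B * t ^ 4) \<le> \<kappa> * (A * t\<^sup>2 + B * t ^ 4)"
      using \<kappa> AB t by (auto intro!: mult_left_mono)
    then have l: "\<kappa> * (A * t\<^sup>2) \<le> g t * t powr p" "\<kappa> * (B * t ^ 4) \<le> g t * t powr p"
      using lower[of t] gt[OF t] t by linarith+
    have "\<kappa> * A * t powr (2 - p) = \<kappa> * (A * t\<^sup>2) / t powr p" by (simp add: powr_diff t2)
    also have "\<dots> \<le> g t" using l(1) t by (simp add: pos_divide_le_eq)
    finally show "g t \<ge> \<kappa> * A * t powr (2 - p)" .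
    have "\<kappa> * B * t powr (4 - p) = \<kappa> * (B * t ^ 4) / t powr p" by (simp add: powr_diff t2)
    also have "\<dots> \<le> g t" using l(2) t by (simp add: pos_divide_le_eq)
    finally show "g t \<ge> \<kappa> * B * t powr (4 - p)" .
  qed
  have gpos: "g t > 0" if "t > 0" for t
  proof -
    have "0 < \<kappa> * A * t powr (2 - p)" using that \<kappa> AB by simp
    then show ?thesis using glow(1)[OF that] by linarith
  qed
  \<comment> \<open>The two lower bounds for \<open>g\<close> reach the value \<open>g 1\<close>
    when \<open>t powr (2 - p)\<close> is at least \<open>cA\<close> and when
    \<open>t powr (4 - p)\<close> is at least \<open>cB\<close>. The cut-offs at 1 keep 1 inside the
    compact interval, so its minimum is global.\<close>
  define cA where "cA = g 1 / (\<kappa> * A)"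
  define cB where "cB = g 1 / (\<kappa> * B)"
  have c: "cA > 0" "cB > 0" using gpos[of 1] \<kappa> AB by (auto simp: cA_def cB_def)
  define \<alpha> where "\<alpha> = min 1 (cA powr (1 / (2 - p)))"
  define \<beta> where "\<beta> = max 1 (cB powr (1 / (4 - p)))"
  have \<alpha>: "0 < \<alpha>" "\<alpha> \<le> 1" and \<beta>: "1 \<le> \<beta>" using c by (auto simp: \<alpha>_def \<beta>_def)
  have left: "g t \<ge> g 1" if t: "0 < t" "t \<le> \<alpha>" for t
  proof -
    have "(cA powr (1 / (2 - p))) powr (2 - p) \<le> t powr (2 - p)"
      using t p by (intro powr_mono2') (auto simp: \<alpha>_def)
    then have "cA \<le> t powr (2 - p)" using c p by (simp add: powr_powr)
    then have "\<kappa> * A * cA \<le> \<kappa> * A * t powr (2 - p)" using \<kappa> AB by (intro mult_left_mono) auto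
    then show ?thesis using glow(1)[OF t(1)] \<kappa> AB by (simp add: cA_def)
  qed
  have right: "g t \<ge> g 1" if t: "\<beta> \<le> t" for t
  proof -
    have "(cB powr (1 / (4 - p))) powr (4 - p) \<le> t powr (4 - p)"
      using t p by (intro powr_mono2) (auto simp: \<beta>_def)
    then have "cB \<le> t powr (4 - p)" using c p by (simp add: powr_powr)
    then have "\<kappa> * B * cB \<le> \<kappa> * B * t powr (4 - p)" using \<kappa> AB by (intro mult_left_mono) auto
    moreover have "t > 0" using t \<beta> by linarith
    ultimately show ?thesis using glow(2)[of t] \<kappa> AB by (simp add: cB_def)
  qed
  have cont: "continuous_on {\<alpha>..\<beta>} g" unfolding g_def
    using \<alpha> by (intro continuous_intros) auto
  obtain t0 where t0: "t0 \<in> {\<alpha>..\<beta>}" "\<And>t. t \<in> {\<alpha>..\<beta>} \<Longrightarrow> g t0 \<le> g t"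
    using continuous_attains_inf[of "{\<alpha>..\<beta>}" g] cont \<alpha> \<beta> by auto
  have t0pos: "t0 > 0" using t0(1) \<alpha> by auto
  have min: "g t0 \<le> g t" if "t > 0" for t
  proof -
    have "g t0 \<le> g 1" using t0(2)[of 1] \<alpha> \<beta> by auto
    then show ?thesis using left[OF that] right[of t] t0(2)[of t] by fastforce
  qed
  show ?thesis
  proof (rule that[of t0 "g t0"])
    show "g t0 * t powr p \<le> A * t\<^sup>2 + B * t ^ 4 - C * t powr q" if "t > 0" for t
      unfolding gt[OF that] using min[OF that] by (rule mult_right_mono) simp
  qed (use t0pos gpos gt in auto)
qed

section \<open>Coercivity of the leading part, fibres and the extremal parameter\<close>

locale kirchhoff = sobolev_dom \<Omega> q S for \<Omega> :: "'a::euclidean_space set" and q S +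
  fixes a b p :: real
  assumes a_pos: "a > 0" and b_pos: "b > 0" and p_gt: "2 < p" and p_lt: "p < q"
    and C1_less: "C1 DIM('a) S < a powr ((real DIM('a) - 4) / 2) * b"
begin

abbreviation "E \<equiv> energy \<Omega> a b p"

lemma energy_eq: "E \<mu> u = a / 2 * (nrm u)\<^sup>2 + b / 4 * nrm u ^ 4 - pint \<Omega> q u / q - \<mu> / p * pint \<Omega> p u"
  using Lq_norm_powr[of q \<Omega> u] Lq_norm_powr[of p \<Omega> u] q_bounds p_gt by (simp add: energy_def q_eq)

lemma base_estimate:
  "\<exists>\<kappa>>0. \<forall>w\<in>H01 \<Omega>. \<kappa> * (a / 2 * (nrm w)\<^sup>2 + b / 4 * nrm w ^ 4) \<le> a / 2 * (nrm w)\<^sup>2 + b / 4 * nrm w ^ 4 - pint \<Omega> q w / q"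
proof (rule kirchhoff_coercive[OF N4 S_pos a_pos b_pos C1_less, folded q_eq])
  fix \<kappa> :: real
  assume k: "\<kappa> > 0" "\<And>t. t \<ge> 0 \<Longrightarrow> \<kappa> * (a / 2 * t\<^sup>2 + b / 4 * t ^ 4) \<le> a / 2 * t\<^sup>2 + b / 4 * t ^ 4 - S powr (- q / 2) * t powr q / q"
  have "\<kappa> * (a / 2 * (nrm w)\<^sup>2 + b / 4 * nrm w ^ 4) \<le> a / 2 * (nrm w)\<^sup>2 + b / 4 * nrm w ^ 4 - pint \<Omega> q w / q" if w: "w \<in> H01 \<Omega>" for w
  proof -
    have "pint \<Omega> q w / q \<le> S powr (- q / 2) * nrm w powr q / q"
      using sobolev_inequality(2)[OF w] q_bounds by (simp add: divide_right_mono)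
    then show ?thesis using k(2)[OF H01_norm_nonneg[of \<Omega> w]] by linarith
  qed
  then show ?thesis using k(1) by blast
qed

lemma fiber_eq:
  assumes u: "u \<in> H01 \<Omega>" and t: "t > 0"
  shows "fiber \<Omega> a b p \<mu> u t = (a / 2 * (nrm u)\<^sup>2) * t\<^sup>2 + (b / 4 * nrm u ^ 4) * t ^ 4
    - (pint \<Omega> q u / q) * t powr q - \<mu> * (pint \<Omega> p u / p) * t powr p"
  unfolding fiber_def energy_eq pint_scale H01_norm_scale[OF H01_H1[OF u]]
  using t by (simp add: power_mult_distrib mult_ac)

lemma pint_pos: "u \<in> H01_nonzero \<Omega> \<Longrightarrow> pint \<Omega> p u > 0"
  using pint_eq_0_iff[of u p] pint_nonneg[of \<Omega> p u] p_gt p_lt by (force simp: H01_nonzero_def less_le)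

text \<open>The definite description is resolved to \<open>m / D\<close>, where \<open>m\<close> is
  the minimum from \<open>fibre_minimum\<close> and \<open>D\<close> the coefficient of the
  subcritical term.\<close>

lemma lambda0:
  assumes u: "u \<in> H01_nonzero \<Omega>"
  shows "lambda0 \<Omega> a b p u > 0"
    and "\<exists>t>0. fiber \<Omega> a b p (lambda0 \<Omega> a b p u) u t = 0"
    and "\<And>t. t > 0 \<Longrightarrow> fiber \<Omega> a b p (lambda0 \<Omega> a b p u) u t \<ge> 0"
proof -
  have uH: "u \<in> H01 \<Omega>" using u by (simp add: H01_nonzero_def)
  have n: "nrm u > 0" by (rule nrm_pos[OF u])
  define A where "A = a / 2 * (nrm u)\<^sup>2"
  define B where "B = b / 4 * nrm u ^ 4"
  define C where "C = pint \<Omega> q u / q"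
  define D where "D = pint \<Omega> p u / p"
  have AB: "A > 0" "B > 0" using a_pos b_pos n by (auto simp: A_def B_def)
  have D0: "D > 0" using pint_pos[OF u] p_gt by (simp add: D_def)
  have p4: "p < 4" using p_lt q_bounds by simp
  have f: "fiber \<Omega> a b p \<mu> u t = A * t\<^sup>2 + B * t ^ 4 - C * t powr q - \<mu> * D * t powr p" if "t > 0" for \<mu> t
    using fiber_eq[OF uH that] by (simp add: A_def B_def C_def D_def)
  obtain \<kappa> where k: "\<kappa> > 0"
    "\<forall>w\<in>H01 \<Omega>. \<kappa> * (a / 2 * (nrm w)\<^sup>2 + b / 4 * nrm w ^ 4) \<le> a / 2 * (nrm w)\<^sup>2 + b / 4 * nrm w ^ 4 - pint \<Omega> q w / q"
    using base_estimate by metis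
  have low: "\<kappa> * (A * t\<^sup>2 + B * t ^ 4) \<le> A * t\<^sup>2 + B * t ^ 4 - C * t powr q" if t: "t \<ge> 0" for t
    using k(2)[rule_format, OF H01_scale[OF uH, of t]] t unfolding pint_scale H01_norm_scale[OF H01_H1[OF uH]]
    by (simp add: A_def B_def C_def power_mult_distrib algebra_simps)
  obtain t0 m where t0: "t0 > 0" and m: "m > 0" and eq: "A * t0\<^sup>2 + B * t0 ^ 4 - C * t0 powr q = m * t0 powr p"
    and ge: "\<And>t. t > 0 \<Longrightarrow> m * t powr p \<le> A * t\<^sup>2 + B * t ^ 4 - C * t powr q"
    using fibre_minimum[OF AB p_gt p4 k(1) low] by blast
  define \<mu>0 where "\<mu>0 = m / D"
  have \<mu>D: "\<mu>0 * D = m" and \<mu>0: "\<mu>0 > 0" using D0 m by (auto simp: \<mu>0_def)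
  have f0: "fiber \<Omega> a b p \<mu>0 u t0 = 0" unfolding f[OF t0] \<mu>D using eq by simp
  have fge: "fiber \<Omega> a b p \<mu>0 u t \<ge> 0" if "t > 0" for t unfolding f[OF that] \<mu>D using ge[OF that] by simp
  have "lambda0 \<Omega> a b p u = \<mu>0"
    unfolding lambda0_def
  proof (rule the_equality)
    have inf: "fiber \<Omega> a b p \<mu>0 u t0 = (INF s\<in>{0<..}. fiber \<Omega> a b p \<mu>0 u s)"
      unfolding f0 by (rule cInf_eq_minimum[symmetric]) (use f0 fge t0 in \<open>auto intro!: image_eqI[of _ _ t0]\<close>)
    have "((\<lambda>t. A * t\<^sup>2 + B * t ^ 4 - C * t powr q - \<mu>0 * D * t powr p) has_real_derivative
        (A * (2 * t0) + B * (4 * t0 ^ 3) - C * (q * t0 powr (q - 1)) - \<mu>0 * D * (p * t0 powr (p - 1)))) (at t0)"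
      using t0 by (auto intro!: derivative_eq_intros simp: algebra_simps powr_diff)
    then have "(fiber \<Omega> a b p \<mu>0 u has_real_derivative
        (A * (2 * t0) + B * (4 * t0 ^ 3) - C * (q * t0 powr (q - 1)) - \<mu>0 * D * (p * t0 powr (p - 1)))) (at t0)"
      by (rule has_field_derivative_transform_within_open[of _ _ _ "{0<..}"]) (use t0 f in auto)
    \<comment> \<open>The point \<open>t0\<close> is an interior minimum of the fibre; the
      neighbourhood of radius \<open>t0\<close> stays inside the positive half-line.\<close>
    moreover from this have "A * (2 * t0) + B * (4 * t0 ^ 3) - C * (q * t0 powr (q - 1)) - \<mu>0 * D * (p * t0 powr (p - 1)) = 0"
      by (rule DERIV_local_min[OF _ t0]) (use f0 fge in auto)
    ultimately have "(fiber \<Omega> a b p \<mu>0 u has_real_derivative 0) (at t0)" by simp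
    then show "\<mu>0 > 0 \<and> (\<exists>t>0. fiber \<Omega> a b p \<mu>0 u t = 0 \<and> (fiber \<Omega> a b p \<mu>0 u has_real_derivative 0) (at t) \<and>
        fiber \<Omega> a b p \<mu>0 u t = (INF s\<in>{0<..}. fiber \<Omega> a b p \<mu>0 u s))"
      using \<mu>0 t0 f0 inf by blast
  next
    fix \<mu> assume as: "\<mu> > 0 \<and> (\<exists>t>0. fiber \<Omega> a b p \<mu> u t = 0 \<and> (fiber \<Omega> a b p \<mu> u has_real_derivative 0) (at t) \<and>
        fiber \<Omega> a b p \<mu> u t = (INF s\<in>{0<..}. fiber \<Omega> a b p \<mu> u s))"
    then obtain t where t: "t > 0" "fiber \<Omega> a b p \<mu> u t = 0" "0 = (INF s\<in>{0<..}. fiber \<Omega> a b p \<mu> u s)" by auto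
    \<comment> \<open>The infimum bounds individual values only if the fibre is bounded below.
      Beyond \<open>R\<close> the quartic term outweighs the subcritical one; up to \<open>R\<close>
      the latter is at most its value at \<open>R\<close>.\<close>
    define c where "c = \<mu> * D / (\<kappa> * B)"
    have c0: "c > 0" using as D0 k(1) AB by (simp add: c_def)
    define R where "R = c powr (1 / (4 - p))"
    have bd: "fiber \<Omega> a b p \<mu> u s \<ge> - (\<mu> * D * R powr p)" if s: "s > 0" for s
    proof (cases "s \<le> R")
      case True
      have "0 \<le> \<kappa> * (A * s\<^sup>2 + B * s ^ 4)" using k(1) AB s by simp
      moreover have "\<mu> * D * s powr p \<le> \<mu> * D * R powr p"
        using True s as D0 p_gt by (intro mult_left_mono powr_mono2) auto
      ultimately show ?thesis unfolding f[OF s] using low[of s] s by linarith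
    next
      case False
      have "R powr (4 - p) \<le> s powr (4 - p)" using False p4 by (intro powr_mono2) (auto simp: R_def)
      then have "c \<le> s powr (4 - p)" using c0 p4 by (simp add: R_def powr_powr)
      then have "\<kappa> * B * c \<le> \<kappa> * B * s powr (4 - p)" using k(1) AB by (intro mult_left_mono) auto
      then have "\<mu> * D \<le> \<kappa> * B * s powr (4 - p)" using k(1) AB by (simp add: c_def)
      then have "\<mu> * D * s powr p \<le> \<kappa> * B * s powr (4 - p) * s powr p" by (rule mult_right_mono) simp
      also have "\<dots> = \<kappa> * B * s ^ 4" using s by (simp add: mult.assoc flip: powr_add)
      also have "\<dots> \<le> \<kappa> * (A * s\<^sup>2 + B * s ^ 4)" using k(1) AB by (simp add: distrib_left)
      finally have "0 \<le> fiber \<Omega> a b p \<mu> u s" unfolding f[OF s] using low[of s] s by linarith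
      moreover have "0 \<le> \<mu> * D * R powr p" using as D0 by simp
      ultimately show ?thesis by linarith
    qed
    have nn: "fiber \<Omega> a b p \<mu> u s \<ge> 0" if "s > 0" for s
    proof -
      have "bdd_below (fiber \<Omega> a b p \<mu> u ` {0<..})"
        by (rule bdd_belowI2[of _ "- (\<mu> * D * R powr p)"]) (use bd in simp)
      from cINF_lower[OF this] that have "(INF s\<in>{0<..}. fiber \<Omega> a b p \<mu> u s) \<le> fiber \<Omega> a b p \<mu> u s" by simp
      then show ?thesis by (simp only: t(3)[symmetric])
    qed
    \<comment> \<open>Uniqueness: the zero at \<open>t\<close> gives \<open>m\<close> at most
      \<open>\<mu> * D\<close> since \<open>m\<close> is the minimum of \<open>g\<close>, and
      nonnegativity at \<open>t0\<close>, where the minimum is attained, gives the converse.\<close>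
    have "m * t powr p \<le> \<mu> * D * t powr p" using ge[OF t(1)] t(2) unfolding f[OF t(1)] by linarith
    then have "m \<le> \<mu> * D" using t(1) by simp
    moreover have "\<mu> * D * t0 powr p \<le> m * t0 powr p" using nn[OF t0] eq unfolding f[OF t0] by linarith
    then have "\<mu> * D \<le> m" using t0 by simp
    ultimately show "\<mu> = \<mu>0" using D0 by (simp add: \<mu>0_def field_simps)
  qed
  then show "lambda0 \<Omega> a b p u > 0" "\<exists>t>0. fiber \<Omega> a b p (lambda0 \<Omega> a b p u) u t = 0"
    "\<And>t. t > 0 \<Longrightarrow> fiber \<Omega> a b p (lambda0 \<Omega> a b p u) u t \<ge> 0"
    using \<mu>0 t0 f0 fge by auto
qed

lemma energy_pos:
  assumes u: "u \<in> H01_nonzero \<Omega>" and \<mu>: "\<mu> < lambda0_star \<Omega> a b p"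
  shows "E \<mu> u > 0"
proof -
  have "lambda0_star \<Omega> a b p \<le> lambda0 \<Omega> a b p u"
    unfolding lambda0_star_def by (rule cINF_lower[OF _ u]) (use lambda0(1) in \<open>auto intro!: bdd_belowI2[of _ 0] less_imp_le\<close>)
  then have "\<mu> < lambda0 \<Omega> a b p u" using \<mu> by simp
  then have "\<mu> / p * pint \<Omega> p u < lambda0 \<Omega> a b p u / p * pint \<Omega> p u"
    using pint_pos[OF u] p_gt by (simp add: divide_strict_right_mono)
  moreover have "0 \<le> E (lambda0 \<Omega> a b p u) u" using lambda0(3)[OF u, of 1] by (simp add: fiber_def)
  ultimately show ?thesis unfolding energy_eq by linarith
qed

end

subsection \<open>Local minimizers\<close>

context bounded_dom
begin

text \<open>Both the Sobolev constant and the extremal parameter are infima over this set, and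
  bounds for an infimum need it to be nonempty.\<close>

lemma H01_nonzero_nonempty: "H01_nonzero \<Omega> \<noteq> {}"
proof -
  obtain x where "x \<in> \<Omega>" using dom by (auto simp: bounded_domain_def)
  then obtain c d where cd: "cbox c d \<subseteq> \<Omega>" "x \<in> box c d" using open_contains_cbox[OF open_dom] by metis
  have t: "box_bump c d \<in> test_functions \<Omega>" using box_bump_test_functions[OF cd(1), of 1] by simp
  have "\<not> (AE x in lebesgue_on \<Omega>. box_bump c d x = 0)"
  proof
    assume "AE x in lebesgue_on \<Omega>. box_bump c d x = 0"
    then have "AE x in lebesgue. x \<in> \<Omega> \<longrightarrow> box_bump c d x = 0" using sets_dom by (simp add: AE_restrict_space_iff)
    then have "AE x in lebesgue. x \<notin> box c d"
      by eventually_elim (use box_bump_pos_iff[of c d] cd(1) box_subset_cbox[of c d] in force)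
    then have "negligible (box c d)" by (simp add: negligible_iff_null_sets AE_iff_null_sets)
    then show False using open_not_negligible[of "box c d"] cd(2) by auto
  qed
  then show ?thesis using test_H01[OF t] by (auto simp: H01_nonzero_def)
qed

text \<open>The zero field is a weak gradient of a function that vanishes almost everywhere, and
  weak gradients are unique. Consequently a function with positive gradient norm is nonzero in the
  sense of \<open>H01_nonzero\<close>.\<close>

lemma H01_norm_AE_0:
  assumes u: "u \<in> H01 \<Omega>" and 0: "AE x in lebesgue_on \<Omega>. u x = 0"
  shows "H01_norm \<Omega> u = 0"
proof -
  note uL = H1_L2[OF H01_H1[OF u]]
  have zL: "(\<lambda>x. 0::'a) \<in> L2 \<Omega>"
    by (auto intro: L2_bounded_measurable[OF lmeasurable_dom, of _ 0])
  have "is_weak_gradient \<Omega> u (\<lambda>x. 0)"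
    unfolding is_weak_gradient_def
  proof (intro ballI)
    fix \<phi> i assume \<phi>: "\<phi> \<in> test_functions \<Omega>" and i: "i \<in> (Basis :: 'a set)"
    have [measurable]: "u \<in> borel_measurable (lebesgue_on \<Omega>)" "pd i \<phi> \<in> borel_measurable (lebesgue_on \<Omega>)"
      using L2_measurable[OF uL] L2_measurable[OF test_L2[OF test_functions_pd[OF \<phi> i]]] by auto
    have "(LINT x|lebesgue_on \<Omega>. u x * pd i \<phi> x) = (LINT x|lebesgue_on \<Omega>. 0)"
      by (rule integral_cong_AE) (use 0 in auto)
    then show "(LINT x|lebesgue_on \<Omega>. u x * pd i \<phi> x) = - (LINT x|lebesgue_on \<Omega>. 0 \<bullet> i * \<phi> x)" by simp
  qed
  from weak_grad_AE(2)[OF uL zL this] have "l2 \<Omega> (weak_grad \<Omega> u) = l2 \<Omega> (\<lambda>x. 0::'a)"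
    by (intro l2_cong_AE L2_measurable zL H1_weak_grad H01_H1 u)
  then show ?thesis using l2_scale[of \<Omega> 0 "\<lambda>x. 0::'a"] by (simp add: H01_norm_eq)
qed

end

section \<open>First variation: local minimizers are critical points\<close>

context sobolev_dom
begin

text \<open>The directional derivative of \<open>pint\<close> divided by \<open>r\<close>, which
  cancels the factors \<open>1 / q\<close> and \<open>1 / p\<close> in the energy.\<close>

definition pint_deriv :: "real \<Rightarrow> ('a \<Rightarrow> real) \<Rightarrow> ('a \<Rightarrow> real) \<Rightarrow> real" where
  "pint_deriv r v h = (LINT x|lebesgue_on \<Omega>. \<bar>v x\<bar> powr (r - 1) * sgn (v x) * h x)"

lemma pint_deriv_scale: "pint_deriv r v (\<lambda>x. c * h x) = c * pint_deriv r v h"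
  unfolding pint_deriv_def by (simp add: mult.left_commute)

text \<open>The pointwise tangent inequality, integrated; Young's inequality also dominates the
  mixed term and so makes it integrable.\<close>

lemma pint_tangent:
  assumes v: "v \<in> H01 \<Omega>" and h: "h \<in> H01 \<Omega>" and r: "1 < r" "r \<le> q"
  shows "pint \<Omega> r v + r * pint_deriv r v h \<le> pint \<Omega> r (\<lambda>x. v x + h x)"
proof -
  let ?M = "lebesgue_on \<Omega>"
  have [measurable]: "v \<in> borel_measurable ?M" "h \<in> borel_measurable ?M" using v h by (auto intro: H01_measurable)
  have r0: "0 < r" using r by simp
  have iv: "integrable ?M (\<lambda>x. \<bar>v x\<bar> powr r)" and ih: "integrable ?M (\<lambda>x. \<bar>h x\<bar> powr r)"
    using powr_integrable[OF v r0 r(2)] powr_integrable[OF h r0 r(2)] .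
  have i: "integrable ?M (\<lambda>x. \<bar>v x\<bar> powr (r - 1) * sgn (v x) * h x)"
  proof (rule Bochner_Integration.integrable_bound)
    show "integrable ?M (\<lambda>x. (r - 1) * \<bar>v x\<bar> powr r + \<bar>h x\<bar> powr r)" using iv ih by simp
    show "AE x in ?M. norm (\<bar>v x\<bar> powr (r - 1) * sgn (v x) * h x) \<le> norm ((r - 1) * \<bar>v x\<bar> powr r + \<bar>h x\<bar> powr r)"
    proof (rule AE_I2)
      fix x
      have "norm (\<bar>v x\<bar> powr (r - 1) * sgn (v x) * h x) \<le> \<bar>v x\<bar> powr (r - 1) * \<bar>h x\<bar>"
        by (auto simp: abs_mult sgn_real_def)
      also have "\<dots> \<le> r * (\<bar>v x\<bar> powr (r - 1) * \<bar>h x\<bar>)" using mult_right_mono[of 1 r "\<bar>v x\<bar> powr (r - 1) * \<bar>h x\<bar>"] r by simp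
      also have "\<dots> \<le> (r - 1) * \<bar>v x\<bar> powr r + \<bar>h x\<bar> powr r" using r by (intro powr_Young) auto
      finally show "norm (\<bar>v x\<bar> powr (r - 1) * sgn (v x) * h x) \<le> norm ((r - 1) * \<bar>v x\<bar> powr r + \<bar>h x\<bar> powr r)" by simp
    qed
  qed measurable
  have "pint \<Omega> r v + r * pint_deriv r v h = (LINT x|?M. \<bar>v x\<bar> powr r + r * (\<bar>v x\<bar> powr (r - 1) * sgn (v x) * h x))"
    unfolding pint_def pint_deriv_def using iv i by simp
  also have "\<dots> \<le> pint \<Omega> r (\<lambda>x. v x + h x)"
    unfolding pint_def
    by (rule integral_mono) (use iv i powr_integrable[OF H01_add[OF v h] r0 r(2)] powr_tangent[OF r(1)] in auto)
  finally show ?thesis .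
qed

end

context kirchhoff
begin

definition energy_deriv :: "real \<Rightarrow> ('a \<Rightarrow> real) \<Rightarrow> ('a \<Rightarrow> real) \<Rightarrow> real" where
  "energy_deriv \<mu> v h = a * gip \<Omega> v h + b * (nrm v)\<^sup>2 * gip \<Omega> v h - pint_deriv q v h - \<mu> * pint_deriv p v h"

lemma energy_deriv_scale:
  "v \<in> H01 \<Omega> \<Longrightarrow> h \<in> H01 \<Omega> \<Longrightarrow> energy_deriv \<mu> v (\<lambda>x. c * h x) = c * energy_deriv \<mu> v h"
  using gip_lincomb_left[of h h v c 0] H01_H1[of h] H01_H1[of v]
  by (simp add: energy_deriv_def pint_deriv_scale gip_commute[of v] algebra_simps)

text \<open>The Lebesgue terms enter the energy with a negative sign, so their convexity bounds it above by
  its linearization with a quadratic error; at a local minimizer this one-sided bound suffices.\<close>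

lemma energy_upper:
  assumes v: "v \<in> H01 \<Omega>" and \<mu>: "\<mu> > 0"
  obtains K where "K > 0"
    "\<And>h. h \<in> H01 \<Omega> \<Longrightarrow> nrm h \<le> 1 \<Longrightarrow> E \<mu> (\<lambda>x. v x + h x) \<le> E \<mu> v + energy_deriv \<mu> v h + K * (nrm h)\<^sup>2"
proof
  let ?n = "nrm v"
  have n0: "?n \<ge> 0" by (rule H01_norm_nonneg)
  \<comment> \<open>Collects the second-order terms: \<open>a / 2\<close> from the square, and from
    the fourth power 2 + 4 times \<open>?n^2\<close>, with the cubic and quartic terms reduced to
    squares by \<open>nrm h\<close> at most 1.\<close>
  define K where "K = a / 2 + b / 4 * (6 * ?n\<^sup>2 + 4 * ?n + 1)"
  show "K > 0" using a_pos b_pos n0 by (simp add: K_def add_pos_nonneg)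
  fix h assume h: "h \<in> H01 \<Omega>" and h1: "nrm h \<le> 1"
  let ?s = "nrm h"
  define g where "g = gip \<Omega> v h"
  have s0: "?s \<ge> 0" by (rule H01_norm_nonneg)
  have g: "\<bar>g\<bar> \<le> ?n * ?s" unfolding g_def by (rule gip_Cauchy_Schwarz[OF H01_H1[OF v] H01_H1[OF h]])
  have sq: "(nrm (\<lambda>x. v x + h x))\<^sup>2 = ?n\<^sup>2 + 2 * g + ?s\<^sup>2"
    using gip_lincomb_self[OF H01_H1[OF v] H01_H1[OF h], of 1 1] by (simp add: g_def)
  have "nrm (\<lambda>x. v x + h x) ^ 4 = (?n\<^sup>2 + 2 * g + ?s\<^sup>2)\<^sup>2"
    unfolding sq[symmetric] by simp
  also have "\<dots> = ?n ^ 4 + 4 * ?n\<^sup>2 * g + (2 * ?n\<^sup>2 * ?s\<^sup>2 + 4 * g\<^sup>2 + 4 * g * ?s\<^sup>2 + ?s\<^sup>2 * ?s\<^sup>2)"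
    by (simp add: power2_eq_square power4_eq_xxxx algebra_simps)
  also have "2 * ?n\<^sup>2 * ?s\<^sup>2 + 4 * g\<^sup>2 + 4 * g * ?s\<^sup>2 + ?s\<^sup>2 * ?s\<^sup>2 \<le> 2 * ?n\<^sup>2 * ?s\<^sup>2 + 4 * (?n\<^sup>2 * ?s\<^sup>2) + 4 * ?n * ?s\<^sup>2 + 1 * ?s\<^sup>2"
  proof -
    have "g\<^sup>2 \<le> (?n * ?s)\<^sup>2" using power_mono[OF g, of 2] by simp
    then have 1: "g\<^sup>2 \<le> ?n\<^sup>2 * ?s\<^sup>2" by (simp add: power_mult_distrib)
    have "g \<le> ?n * 1" using g mult_left_mono[OF h1 n0] by linarith
    then have 2: "g * ?s\<^sup>2 \<le> ?n * ?s\<^sup>2" by (intro mult_right_mono) auto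
    have "?s\<^sup>2 \<le> 1" using h1 s0 by (simp add: power_le_one)
    then have 3: "?s\<^sup>2 * ?s\<^sup>2 \<le> 1 * ?s\<^sup>2" by (intro mult_right_mono) auto
    from 1 2 3 show ?thesis by linarith
  qed
  also have "\<dots> = (6 * ?n\<^sup>2 + 4 * ?n + 1) * ?s\<^sup>2" by (simp add: algebra_simps)
  finally have "b / 4 * nrm (\<lambda>x. v x + h x) ^ 4 \<le> b / 4 * (?n ^ 4 + 4 * ?n\<^sup>2 * g + (6 * ?n\<^sup>2 + 4 * ?n + 1) * ?s\<^sup>2)"
    using b_pos by (intro mult_left_mono) auto
  then have Q: "b / 4 * nrm (\<lambda>x. v x + h x) ^ 4 \<le> b / 4 * ?n ^ 4 + b * ?n\<^sup>2 * g + b / 4 * (6 * ?n\<^sup>2 + 4 * ?n + 1) * ?s\<^sup>2"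
    by (simp add: algebra_simps)
  have fld: "X / r + Y \<le> Z / r" if "X + r * Y \<le> Z" "r > 0" for X Y Z r :: real
    using divide_right_mono[OF that(1), of r] that(2) by (simp add: add_divide_distrib)
  have q1: "pint \<Omega> q (\<lambda>x. v x + h x) / q \<ge> pint \<Omega> q v / q + pint_deriv q v h"
    using fld[OF pint_tangent[OF v h, of q]] q_bounds by simp
  have "pint \<Omega> p (\<lambda>x. v x + h x) / p \<ge> pint \<Omega> p v / p + pint_deriv p v h"
    using fld[OF pint_tangent[OF v h, of p]] p_gt p_lt by simp
  then have p1: "\<mu> * (pint \<Omega> p (\<lambda>x. v x + h x) / p) \<ge> \<mu> * (pint \<Omega> p v / p + pint_deriv p v h)"
    using \<mu> by (intro mult_left_mono) auto
  show "E \<mu> (\<lambda>x. v x + h x) \<le> E \<mu> v + energy_deriv \<mu> v h + K * ?s\<^sup>2"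
    using Q q1 p1 unfolding energy_eq sq energy_deriv_def K_def g_def[symmetric]
    by (simp add: algebra_simps)
qed

text \<open>Minimality against the one-sided quadratic bound forces the homogeneous form
  \<open>energy_deriv\<close> to be nonnegative in every direction; applied to \<open>h\<close> and
  \<open>-h\<close> it vanishes. Then the increment lies between 0 and \<open>K * (nrm h)^2\<close>,
  which is the Frechet condition.\<close>

lemma local_minimizer_solves:
  assumes \<mu>: "\<mu> > 0" and m: "H01_local_minimizer \<Omega> (E \<mu>) v"
  shows "solves_P \<Omega> a b p \<mu> v"
proof -
  from m obtain r where v: "v \<in> H01 \<Omega>" and r: "r > 0"
    and min: "\<And>w. w \<in> H01 \<Omega> \<Longrightarrow> nrm (\<lambda>x. w x - v x) < r \<Longrightarrow> E \<mu> v \<le> E \<mu> w"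
    by (auto simp: H01_local_minimizer_def)
  have mh: "E \<mu> v \<le> E \<mu> (\<lambda>x. v x + h x)" if "h \<in> H01 \<Omega>" "nrm h < r" for h
    by (rule min) (use that H01_add[OF v] in auto)
  obtain K where K: "K > 0"
    "\<And>h. h \<in> H01 \<Omega> \<Longrightarrow> nrm h \<le> 1 \<Longrightarrow> E \<mu> (\<lambda>x. v x + h x) \<le> E \<mu> v + energy_deriv \<mu> v h + K * (nrm h)\<^sup>2"
    using energy_upper[OF v \<mu>] by metis
  have nn: "energy_deriv \<mu> v h \<ge> 0" if h: "h \<in> H01 \<Omega>" for h
  proof (rule ccontr)
    let ?L = "energy_deriv \<mu> v h"
    assume "\<not> ?L \<ge> 0"
    then have L: "?L < 0" by simp
    define s where "s = nrm h + 1"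
    have s: "s > 0" "nrm h < s" using H01_norm_nonneg[of \<Omega> h] by (auto simp: s_def)
    \<comment> \<open>The first two bounds keep \<open>t * h\<close> within the radius
      \<open>r\<close> and the unit ball, the third makes the quadratic term at most half of the
      linear decrease. The \<open>+ 1\<close> in \<open>s\<close> allows direction \<open>h\<close>
      to have norm 0.\<close>
    define t where "t = min (min (r / s) (1 / s)) (- ?L / (2 * K * s\<^sup>2))"
    have t0: "t > 0" using r s(1) L K(1) by (simp add: t_def divide_neg_pos)
    have t1: "t * s \<le> r" "t * s \<le> 1" "t * (2 * K * s\<^sup>2) \<le> - ?L"
    proof -
      have "t \<le> r / s" "t \<le> 1 / s" "t \<le> - ?L / (2 * K * s\<^sup>2)" unfolding t_def by linarith+
      moreover have "2 * K * s\<^sup>2 > 0" using K(1) s(1) by simp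
      ultimately show "t * s \<le> r" "t * s \<le> 1" "t * (2 * K * s\<^sup>2) \<le> - ?L" using s(1) by (auto simp only: pos_le_divide_eq)
    qed
    have th: "(\<lambda>x. t * h x) \<in> H01 \<Omega>" by (rule H01_scale[OF h])
    have nth: "nrm (\<lambda>x. t * h x) = t * nrm h" using H01_norm_scale[OF H01_H1[OF h], of t] t0 by simp
    have lt: "t * nrm h < t * s" using s t0 by simp
    have "E \<mu> v \<le> E \<mu> (\<lambda>x. v x + t * h x)" by (rule mh[OF th]) (use nth lt t1 in linarith)
    also have "\<dots> \<le> E \<mu> v + t * ?L + K * (t * nrm h)\<^sup>2"
      using K(2)[OF th] nth lt t1 by (simp add: energy_deriv_scale[OF v h])
    also have "(t * nrm h)\<^sup>2 \<le> (t * s)\<^sup>2" using lt t0 H01_norm_nonneg[of \<Omega> h] by (intro power_mono) auto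
    finally have "0 \<le> t * ?L + K * (t * s)\<^sup>2" using K(1) by simp
    also have "\<dots> = t * (?L + t * (2 * K * s\<^sup>2) / 2)" by (simp add: power2_eq_square algebra_simps)
    finally have "0 \<le> ?L + t * (2 * K * s\<^sup>2) / 2" using t0 by (simp add: zero_le_mult_iff)
    then show False using t1(3) L by linarith
  qed
  have z: "energy_deriv \<mu> v h = 0" if h: "h \<in> H01 \<Omega>" for h
    using nn[OF h] nn[OF H01_scale[OF h, of "-1"]] energy_deriv_scale[OF v h, of \<mu> "-1"] by simp
  show ?thesis unfolding solves_P_def H01_critical_point_def
  proof (intro conjI allI impI v)
    fix e :: real assume e: "e > 0"
    show "\<exists>d>0. \<forall>h\<in>H01 \<Omega>. nrm h < d \<longrightarrow> \<bar>E \<mu> (\<lambda>x. v x + h x) - E \<mu> v\<bar> \<le> e * nrm h"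
    proof (intro exI[of _ "min (min r 1) (e / K)"] conjI ballI impI)
      show "min (min r 1) (e / K) > 0" using r e K(1) by simp
      fix h assume h: "h \<in> H01 \<Omega>" and d: "nrm h < min (min r 1) (e / K)"
      have "K * nrm h \<le> e" using d K(1) by (simp add: field_simps)
      then have "K * nrm h * nrm h \<le> e * nrm h" by (rule mult_right_mono) (rule H01_norm_nonneg)
      moreover have "E \<mu> (\<lambda>x. v x + h x) \<le> E \<mu> v + K * (nrm h)\<^sup>2" using K(2)[OF h] z[OF h] d by simp
      moreover have "E \<mu> v \<le> E \<mu> (\<lambda>x. v x + h x)" using mh[OF h] d by simp
      ultimately show "\<bar>E \<mu> (\<lambda>x. v x + h x) - E \<mu> v\<bar> \<le> e * nrm h" by (simp add: power2_eq_square mult.assoc)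
    qed
  qed
qed

text \<open>Quadratic growth near 0 comes from p > 2 and coercivity from p < 4. The constants depend
  on the upper bound for the parameter only, since a smaller parameter raises the energy.\<close>

lemma energy_bounds:
  obtains c \<rho> R where "c > 0" "\<rho> > 0" "R > 0"
    "\<And>w. w \<in> H01 \<Omega> \<Longrightarrow> 2 * c * (nrm w)\<^sup>2 \<le> a / 2 * (nrm w)\<^sup>2 + b / 4 * nrm w ^ 4 - pint \<Omega> q w / q"
    "\<And>\<mu> u. \<mu> \<le> \<Lambda> \<Longrightarrow> u \<in> H01 \<Omega> \<Longrightarrow> nrm u \<le> \<rho> \<Longrightarrow> c * (nrm u)\<^sup>2 \<le> E \<mu> u"
    "\<And>\<mu> u. \<mu> \<le> \<Lambda> \<Longrightarrow> u \<in> H01 \<Omega> \<Longrightarrow> E \<mu> u \<le> 1 \<Longrightarrow> nrm u \<le> R"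
proof -
  obtain \<kappa> where k: "\<kappa> > 0"
    "\<forall>w\<in>H01 \<Omega>. \<kappa> * (a / 2 * (nrm w)\<^sup>2 + b / 4 * nrm w ^ 4) \<le> a / 2 * (nrm w)\<^sup>2 + b / 4 * nrm w ^ 4 - pint \<Omega> q w / q"
    using base_estimate by metis
  have pq: "0 < p" "p \<le> q" "p < 4" using p_gt p_lt q_bounds by auto
  obtain K where K: "K > 0" "\<And>u. u \<in> H01 \<Omega> \<Longrightarrow> pint \<Omega> p u \<le> K * nrm u powr p"
    using embedding[OF pq(1,2)] by metis
  define F where "F = (\<bar>\<Lambda>\<bar> + 1) / p * K"
  have F0: "F > 0" using K(1) pq(1) by (simp add: F_def)
  have low: "\<kappa> * (a / 2) * (nrm u)\<^sup>2 + \<kappa> * (b / 4) * nrm u ^ 4 - F * nrm u powr p \<le> E \<mu> u"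
    if u: "u \<in> H01 \<Omega>" and \<mu>: "\<mu> \<le> \<Lambda>" for u \<mu>
  proof -
    have "\<mu> / p * pint \<Omega> p u \<le> (\<bar>\<Lambda>\<bar> + 1) / p * pint \<Omega> p u"
      using \<mu> pq(1) by (intro mult_right_mono divide_right_mono pint_nonneg) auto
    also have "\<dots> \<le> (\<bar>\<Lambda>\<bar> + 1) / p * (K * nrm u powr p)" using K(2)[OF u] pq(1) by (intro mult_left_mono) auto
    finally have "\<mu> / p * pint \<Omega> p u \<le> F * nrm u powr p" by (simp add: F_def)
    then show ?thesis using k(2)[rule_format, OF u] unfolding energy_eq by (simp add: distrib_left)
  qed
  \<comment> \<open>The quadratic part has coefficient \<open>2 * c\<close>. On the ball of radius
    \<open>\<rho>\<close>, where \<open>F * \<rho> powr (p - 2) = c\<close>, one half pays for the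
    subcritical term and the other remains.\<close>
  define c where "c = \<kappa> * a / 4"
  have c: "c > 0" using k(1) a_pos by (simp add: c_def)
  define \<rho> where "\<rho> = (c / F) powr (1 / (p - 2))"
  have \<rho>: "\<rho> > 0" using c F0 by (simp add: \<rho>_def)
  \<comment> \<open>Beyond \<open>T\<close> the quartic term absorbs the subcritical one, so energy
    at most 1 would force \<open>2 * c * (nrm u)^2\<close> to be at most 1; this fails beyond
    \<open>1 / c + 1\<close>.\<close>
  define T where "T = (4 * F / (\<kappa> * b)) powr (1 / (4 - p))"
  define R where "R = max T (1 / c + 1)"
  have R: "R > 0" using c by (simp add: R_def less_max_iff_disj add_pos_pos)
  show ?thesis
  proof (rule that[OF c \<rho> R])
    fix w assume w: "w \<in> H01 \<Omega>"
    have "0 \<le> \<kappa> * (b / 4 * nrm w ^ 4)" using k(1) b_pos by simp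
    then show "2 * c * (nrm w)\<^sup>2 \<le> a / 2 * (nrm w)\<^sup>2 + b / 4 * nrm w ^ 4 - pint \<Omega> q w / q"
      using k(2)[rule_format, OF w] by (simp add: c_def algebra_simps)
  next
    fix \<mu> u assume \<mu>: "\<mu> \<le> \<Lambda>" and u: "u \<in> H01 \<Omega>" and n: "nrm u \<le> \<rho>"
    have n0: "nrm u \<ge> 0" by (rule H01_norm_nonneg)
    have "F * nrm u powr p \<le> c * (nrm u)\<^sup>2"
    proof (cases "nrm u = 0")
      case False
      then have np: "nrm u > 0" using n0 by simp
      have "nrm u powr (p - 2) \<le> \<rho> powr (p - 2)" using n np p_gt by (intro powr_mono2) auto
      also have "\<dots> = c / F" using c F0 p_gt by (simp add: \<rho>_def powr_powr)
      finally have "F * nrm u powr (p - 2) \<le> c" using F0 by (simp add: field_simps)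
      then have "F * nrm u powr (p - 2) * (nrm u)\<^sup>2 \<le> c * (nrm u)\<^sup>2" by (rule mult_right_mono) simp
      moreover have "nrm u powr (p - 2) * (nrm u)\<^sup>2 = nrm u powr p" using np by (simp add: powr_diff)
      ultimately show ?thesis by (simp add: mult.assoc)
    qed simp
    moreover have "0 \<le> \<kappa> * (b / 4) * nrm u ^ 4" using k(1) b_pos by simp
    ultimately show "c * (nrm u)\<^sup>2 \<le> E \<mu> u" using low[OF u \<mu>] by (simp add: c_def)
  next
    fix \<mu> u assume \<mu>: "\<mu> \<le> \<Lambda>" and u: "u \<in> H01 \<Omega>" and e: "E \<mu> u \<le> 1"
    show "nrm u \<le> R"
    proof (rule ccontr)
      assume "\<not> nrm u \<le> R"
      then have n: "nrm u > T" "nrm u > 1 / c + 1" by (auto simp: R_def)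
      then have n1: "nrm u > 1" using c by (simp add: less_trans[OF _ n(2)])
      have "T powr (4 - p) \<le> nrm u powr (4 - p)" using n pq by (intro powr_mono2) (auto simp: T_def)
      moreover have "T powr (4 - p) = 4 * F / (\<kappa> * b)" using F0 k(1) b_pos pq by (simp add: T_def powr_powr)
      ultimately have "4 * F / (\<kappa> * b) \<le> nrm u powr (4 - p)" by simp
      then have "F \<le> \<kappa> * (b / 4) * nrm u powr (4 - p)" using k(1) b_pos by (simp add: field_simps)
      then have "F * nrm u powr p \<le> \<kappa> * (b / 4) * nrm u powr (4 - p) * nrm u powr p" by (rule mult_right_mono) simp
      also have "\<dots> = \<kappa> * (b / 4) * nrm u ^ 4" using n1 by (simp add: mult.assoc flip: powr_add)
      finally have "\<kappa> * (a / 2) * (nrm u)\<^sup>2 \<le> 1" using low[OF u \<mu>] e by linarith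
      then have "2 * c * (nrm u)\<^sup>2 \<le> 1" by (simp add: c_def)
      moreover have "nrm u \<le> (nrm u)\<^sup>2" using n1 by (simp add: power2_eq_square)
      then have "c * nrm u \<le> c * (nrm u)\<^sup>2" using c by (intro mult_left_mono) auto
      moreover have "c * (1 / c + 1) < c * nrm u" using n(2) c by (intro mult_strict_left_mono) auto
      then have "1 < c * nrm u" using c by (simp add: distrib_left)
      ultimately show False by linarith
    qed
  qed
qed

text \<open>Along a bounded sequence, the energy drops to that of the weak limit by at least a multiple of
  the squared distance: the excess carries only Sobolev-critical mass, which \<open>C1\<close> controls.\<close>

lemma energy_splitting:
  assumes u: "\<And>n. u n \<in> H01 \<Omega>" and R: "\<And>n. nrm (u n) \<le> R" and \<mu>: "\<mu> > 0"
    and c: "\<And>w. w \<in> H01 \<Omega> \<Longrightarrow> 2 * c * (nrm w)\<^sup>2 \<le> a / 2 * (nrm w)\<^sup>2 + b / 4 * nrm w ^ 4 - pint \<Omega> q w / q"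
  shows "\<exists>(r::nat\<Rightarrow>nat) v. strict_mono r \<and> v \<in> H01 \<Omega> \<and> (\<forall>e>0. \<forall>\<^sub>F n in sequentially.
    E \<mu> v + 2 * c * (nrm (\<lambda>x. u (r n) x - v x))\<^sup>2 \<le> E \<mu> (u (r n)) + e)"
proof (rule compactness[OF u R p_gt p_lt])
  fix r :: "nat \<Rightarrow> nat" and v
  assume r: "strict_mono r" and v: "v \<in> H01 \<Omega>"
    and lim: "\<And>e. e > 0 \<Longrightarrow> \<forall>\<^sub>F n in sequentially.
        (nrm v)\<^sup>2 + (nrm (\<lambda>x. u (r n) x - v x))\<^sup>2 \<le> (nrm (u (r n)))\<^sup>2 + e \<and>
        pint \<Omega> q (u (r n)) \<le> pint \<Omega> q v + pint \<Omega> q (\<lambda>x. u (r n) x - v x) + e \<and>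
        pint \<Omega> p (u (r n)) \<le> pint \<Omega> p v + e"
  \<comment> \<open>The sum of the factors with which an error \<open>d\<close> in the three limits
    enters the energy; \<open>2 * R^2 + 1\<close> comes from squaring, with \<open>d\<close> at most
    1.\<close>
  define G where "G = a / 2 + b / 4 * (2 * R\<^sup>2 + 1) + 1 / q + \<mu> / p"
  have G: "G > 0" using a_pos b_pos \<mu> p_gt q_bounds by (simp add: G_def add_pos_nonneg)
  show ?thesis
  proof (intro exI[of _ r] exI[of _ v] conjI r v allI impI)
    fix e :: real assume e: "e > 0"
    define d where "d = min 1 (e / G)"
    have d: "d > 0" "d \<le> 1" "d * G \<le> e" using e G by (auto simp: d_def min_def field_simps)
    from lim[OF d(1)]
    show "\<forall>\<^sub>F n in sequentially. E \<mu> v + 2 * c * (nrm (\<lambda>x. u (r n) x - v x))\<^sup>2 \<le> E \<mu> (u (r n)) + e"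
    proof eventually_elim
      fix n
      define w where "w = (\<lambda>x. u (r n) x - v x)"
      define U where "U = nrm (u (r n))"
      assume "(nrm v)\<^sup>2 + (nrm (\<lambda>x. u (r n) x - v x))\<^sup>2 \<le> (nrm (u (r n)))\<^sup>2 + d \<and>
        pint \<Omega> q (u (r n)) \<le> pint \<Omega> q v + pint \<Omega> q (\<lambda>x. u (r n) x - v x) + d \<and>
        pint \<Omega> p (u (r n)) \<le> pint \<Omega> p v + d"
      then have 1: "(nrm v)\<^sup>2 + (nrm w)\<^sup>2 \<le> U\<^sup>2 + d" and 2: "pint \<Omega> q (u (r n)) \<le> pint \<Omega> q v + pint \<Omega> q w + d"
        and 3: "pint \<Omega> p (u (r n)) \<le> pint \<Omega> p v + d" by (auto simp: w_def U_def)
      have w: "w \<in> H01 \<Omega>" unfolding w_def by (rule H01_diff[OF u v])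
      have U: "0 \<le> U" "U \<le> R" using R by (auto simp: U_def H01_norm_nonneg)
      \<comment> \<open>The nonlocal fourth power is superadditive along the splitting of the
        squared norm: the mixed product is nonnegative and may be dropped, so the defect keeps its
        own full quartic term.\<close>
      have four: "nrm v ^ 4 + nrm w ^ 4 \<le> U ^ 4 + d * (2 * R\<^sup>2 + 1)"
      proof -
        have p4: "x ^ 4 = (x\<^sup>2)\<^sup>2" for x :: real by simp
        have "nrm v ^ 4 + nrm w ^ 4 \<le> ((nrm v)\<^sup>2 + (nrm w)\<^sup>2)\<^sup>2" unfolding p4 by (simp add: power2_sum)
        also have "\<dots> \<le> (U\<^sup>2 + d)\<^sup>2" using 1 by (intro power_mono) auto
        also have "\<dots> = U ^ 4 + d * (2 * U\<^sup>2 + d)" unfolding p4 by (simp add: power2_eq_square algebra_simps)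
        also have "\<dots> \<le> U ^ 4 + d * (2 * R\<^sup>2 + 1)" using d U by (intro add_left_mono mult_left_mono add_mono power_mono) auto
        finally show ?thesis .
      qed
      have A: "a / 2 * (nrm v)\<^sup>2 + a / 2 * (nrm w)\<^sup>2 \<le> a / 2 * U\<^sup>2 + d * (a / 2)"
        using mult_left_mono[OF 1, of "a / 2"] a_pos by (simp add: distrib_left mult.commute)
      have B: "b / 4 * nrm v ^ 4 + b / 4 * nrm w ^ 4 \<le> b / 4 * U ^ 4 + d * (b / 4 * (2 * R\<^sup>2 + 1))"
        using mult_left_mono[OF four, of "b / 4"] b_pos by (simp add: distrib_left mult_ac)
      have C: "pint \<Omega> q (u (r n)) / q \<le> pint \<Omega> q v / q + pint \<Omega> q w / q + d * (1 / q)"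
        using divide_right_mono[OF 2, of q] q_bounds by (simp add: add_divide_distrib)
      have D: "\<mu> / p * pint \<Omega> p (u (r n)) \<le> \<mu> / p * pint \<Omega> p v + d * (\<mu> / p)"
        using mult_left_mono[OF 3, of "\<mu> / p"] \<mu> p_gt by (simp add: distrib_left mult.commute)
      have "d * G = d * (a / 2) + d * (b / 4 * (2 * R\<^sup>2 + 1)) + d * (1 / q) + d * (\<mu> / p)"
        by (simp add: G_def distrib_left)
      then have "E \<mu> v + 2 * c * (nrm w)\<^sup>2 \<le> E \<mu> (u (r n)) + d * G"
        unfolding energy_eq U_def[symmetric] using A B C D c[OF w] by linarith
      then show "E \<mu> v + 2 * c * (nrm (\<lambda>x. u (r n) x - v x))\<^sup>2 \<le> E \<mu> (u (r n)) + e"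
        using d(3) by (simp add: w_def)
    qed
  qed
qed

lemma exists_local_minimizer:
  "\<exists>\<epsilon>>0. \<forall>\<mu>>0. lambda0_star \<Omega> a b p - \<epsilon> < \<mu> \<and> \<mu> < lambda0_star \<Omega> a b p \<longrightarrow>
    (\<exists>u\<in>H01_nonzero \<Omega>. H01_local_minimizer \<Omega> (E \<mu>) u)"
proof -
  define ls where "ls = lambda0_star \<Omega> a b p"
  obtain c \<rho> R where c: "c > 0" and \<rho>: "\<rho> > 0" and R: "R > 0"
    and base: "\<And>w. w \<in> H01 \<Omega> \<Longrightarrow> 2 * c * (nrm w)\<^sup>2 \<le> a / 2 * (nrm w)\<^sup>2 + b / 4 * nrm w ^ 4 - pint \<Omega> q w / q"
    and small: "\<And>\<mu> u. \<mu> \<le> ls + 1 \<Longrightarrow> u \<in> H01 \<Omega> \<Longrightarrow> nrm u \<le> \<rho> \<Longrightarrow> c * (nrm u)\<^sup>2 \<le> E \<mu> u"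
    and coer: "\<And>\<mu> u. \<mu> \<le> ls + 1 \<Longrightarrow> u \<in> H01 \<Omega> \<Longrightarrow> E \<mu> u \<le> 1 \<Longrightarrow> nrm u \<le> R"
    using energy_bounds[of "ls + 1"] by metis
  have pq: "0 < p" "p \<le> q" using p_gt p_lt by auto
  obtain K where K: "K > 0" "\<And>u. u \<in> H01 \<Omega> \<Longrightarrow> pint \<Omega> p u \<le> K * nrm u powr p"
    using embedding[OF pq] by metis
  \<comment> \<open>The energy is affine in the parameter with slope
    \<open>- pint \<Omega> p w / p\<close>. On the ball of radius \<open>R\<close> the slope is at
    most \<open>H\<close> in absolute value, so lowering the parameter by at most
    \<open>2 * \<epsilon>\<close> raises the energy by at most \<open>2 * \<epsilon> * H\<close>,
    hence by at most \<open>\<tau>\<close>.\<close>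
  define H where "H = K * R powr p / p"
  have H: "H > 0" using K(1) R pq by (simp add: H_def)
  \<comment> \<open>With this bound a near-minimizer is within \<open>\<rho> / 2\<close> of its weak
    limit, which thus has norm at least \<open>\<rho> / 2\<close>; between \<open>\<rho> / 2\<close>
    and \<open>\<rho>\<close> the energy would be at least \<open>c * \<rho>^2 / 4\<close>, more
    than \<open>\<tau>\<close>. The cap 1/2 keeps the energies of the minimizing sequence at most 1,
    where coercivity applies.\<close>
  define \<tau> where "\<tau> = min (1 / 2) (c * \<rho>\<^sup>2 / 8)"
  have \<tau>: "\<tau> > 0" "\<tau> \<le> 1 / 2" "8 * \<tau> \<le> c * \<rho>\<^sup>2" using c \<rho> by (auto simp: \<tau>_def)
  define \<epsilon> where "\<epsilon> = min 1 (\<tau> / (2 * H))"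
  have \<epsilon>: "\<epsilon> > 0" "\<epsilon> \<le> 1" "2 * \<epsilon> * H \<le> \<tau>" using \<tau>(1) H by (auto simp: \<epsilon>_def min_def field_simps)
  have "\<exists>u\<in>H01_nonzero \<Omega>. H01_local_minimizer \<Omega> (E \<mu>) u" if \<mu>: "\<mu> > 0" "ls - \<epsilon> < \<mu>" "\<mu> < ls" for \<mu>
  proof -
    have \<mu>1: "\<mu> \<le> ls + 1" using \<mu> by simp
    have pos: "E \<mu> u > 0" if "u \<in> H01_nonzero \<Omega>" for u
      using energy_pos[OF that] \<mu>(3) by (simp add: ls_def)
    define X where "X = {w \<in> H01 \<Omega>. nrm w \<ge> \<rho>}"
    have XN: "w \<in> H01_nonzero \<Omega>" if "w \<in> X" for w
      using that \<rho> H01_norm_AE_0[of w] by (auto simp: X_def H01_nonzero_def)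
    define m where "m = (INF w\<in>X. E \<mu> w)"
    have bdd: "bdd_below (E \<mu> ` X)" using pos XN by (intro bdd_belowI2[of _ 0]) (auto intro: less_imp_le)
    have mle: "m \<le> E \<mu> w" if "w \<in> X" for w unfolding m_def by (rule cINF_lower[OF bdd that])
    obtain w where w: "w \<in> X" "E \<mu> w \<le> \<tau>"
    proof -
      have "lambda0 \<Omega> a b p ` H01_nonzero \<Omega> \<noteq> {}" using H01_nonzero_nonempty by simp
      moreover have "Inf (lambda0 \<Omega> a b p ` H01_nonzero \<Omega>) < ls + \<epsilon>" using \<epsilon>(1) by (simp add: ls_def lambda0_star_def)
      ultimately obtain u where u: "u \<in> H01_nonzero \<Omega>" and l: "lambda0 \<Omega> a b p u < ls + \<epsilon>"
        using cInf_lessD[of "lambda0 \<Omega> a b p ` H01_nonzero \<Omega>" "ls + \<epsilon>"] by auto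
      let ?l = "lambda0 \<Omega> a b p u"
      have l1: "?l \<le> ls + 1" using l \<epsilon> by simp
      have uH: "u \<in> H01 \<Omega>" using u by (simp add: H01_nonzero_def)
      obtain t where t: "t > 0" "fiber \<Omega> a b p ?l u t = 0" using lambda0(2)[OF u] by blast
      define w where "w = (\<lambda>x. t * u x)"
      have wH: "w \<in> H01 \<Omega>" unfolding w_def by (rule H01_scale[OF uH])
      have nw: "nrm w > 0" unfolding w_def using H01_norm_scale[OF H01_H1[OF uH], of t] t(1) nrm_pos[OF u] by simp
      have E0: "E ?l w = 0" using t(2) by (simp add: fiber_def w_def)
      \<comment> \<open>A zero of the energy for the parameter \<open>?l\<close>, slightly above the
        infimum; the small-ball bound still holds for this parameter and excludes the ball.\<close>
      have "nrm w > \<rho>"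
      proof (rule ccontr)
        assume "\<not> nrm w > \<rho>"
        then have "c * (nrm w)\<^sup>2 \<le> 0" using small[OF l1 wH] E0 by simp
        moreover have "c * (nrm w)\<^sup>2 > 0" using c nw by simp
        ultimately show False by linarith
      qed
      then have wX: "w \<in> X" using wH by (simp add: X_def)
      have nR: "nrm w \<le> R" using coer[OF l1 wH] E0 by simp
      have "E \<mu> w = E ?l w + (?l - \<mu>) / p * pint \<Omega> p w" unfolding energy_eq by (simp add: left_diff_distrib diff_divide_distrib)
      also have "\<dots> = (?l - \<mu>) / p * pint \<Omega> p w" by (simp add: E0)
      also have "\<dots> \<le> (2 * \<epsilon>) / p * (K * R powr p)"
      proof (intro mult_mono)
        show "(?l - \<mu>) / p \<le> 2 * \<epsilon> / p" using l \<mu> pq by (intro divide_right_mono) auto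
        have "nrm w powr p \<le> R powr p" using nR nw pq by (intro powr_mono2) auto
        then have "K * nrm w powr p \<le> K * R powr p" using K(1) by (intro mult_left_mono) auto
        then show "pint \<Omega> p w \<le> K * R powr p" using K(2)[OF wH] by linarith
      qed (use \<epsilon> pq pint_nonneg in auto)
      also have "\<dots> = 2 * \<epsilon> * H" by (simp add: H_def)
      finally have "E \<mu> w \<le> \<tau>" using \<epsilon>(3) by linarith
      then show ?thesis using that wX by blast
    qed
    have m\<tau>: "m \<le> \<tau>" using mle[OF w(1)] w(2) by linarith
    have "\<exists>u\<in>X. E \<mu> u < m + \<tau> / real (Suc n)" for n
    proof -
      have "\<tau> / real (Suc n) > 0" using \<tau>(1) by simp
      then have "(INF w\<in>X. E \<mu> w) < m + \<tau> / real (Suc n)" by (simp add: m_def)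
      then show ?thesis using cINF_less_iff[OF _ bdd] w(1) by blast
    qed
    then obtain u where uX: "\<And>n. u n \<in> X" and uE: "\<And>n. E \<mu> (u n) < m + \<tau> / real (Suc n)" by metis
    have uH: "u n \<in> H01 \<Omega>" for n using uX by (simp add: X_def)
    have \<tau>n: "\<tau> / real (Suc n) \<le> \<tau>" for n using \<tau>(1) by (simp add: divide_le_eq)
    have uR: "nrm (u n) \<le> R" for n
      by (rule coer[OF \<mu>1 uH]) (use uE[of n] \<tau>n[of n] m\<tau> \<tau>(2) in linarith)
    have "\<exists>(r::nat\<Rightarrow>nat) v. strict_mono r \<and> v \<in> H01 \<Omega> \<and> (\<forall>e>0. \<forall>\<^sub>F n in sequentially.
        E \<mu> v + 2 * c * (nrm (\<lambda>x. u (r n) x - v x))\<^sup>2 \<le> E \<mu> (u (r n)) + e)"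
      by (rule energy_splitting) (rule uH uR \<mu>(1) base, assumption?)+
    then obtain r :: "nat \<Rightarrow> nat" and v where
      rv: "strict_mono r \<and> v \<in> H01 \<Omega> \<and> (\<forall>e>0. \<forall>\<^sub>F n in sequentially.
        E \<mu> v + 2 * c * (nrm (\<lambda>x. u (r n) x - v x))\<^sup>2 \<le> E \<mu> (u (r n)) + e)"
      by (elim exE) (rule that)
    then have r: "strict_mono r" and v: "v \<in> H01 \<Omega>"
      and split: "\<And>e. e > 0 \<Longrightarrow> \<forall>\<^sub>F n in sequentially. E \<mu> v + 2 * c * (nrm (\<lambda>x. u (r n) x - v x))\<^sup>2 \<le> E \<mu> (u (r n)) + e"
      by simp_all
    have lim: "\<exists>n. E \<mu> v + 2 * c * (nrm (\<lambda>x. u (r n) x - v x))\<^sup>2 \<le> m + e" if e: "e > 0" for e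
    proof -
      have "e / 2 > 0" using e by simp
      moreover have "\<forall>\<^sub>F n in sequentially. \<tau> / real (Suc n) < e / 2"
      proof -
        have "(\<lambda>n. \<tau> * inverse (real (Suc n))) \<longlonglongrightarrow> \<tau> * 0" by (intro tendsto_intros LIMSEQ_inverse_real_of_nat)
        then have "(\<lambda>n. \<tau> / real (Suc n)) \<longlonglongrightarrow> 0" by (simp add: divide_inverse)
        then show ?thesis by (rule order_tendstoD(2)) (use e in simp)
      qed
      ultimately have "\<forall>\<^sub>F n in sequentially. E \<mu> v + 2 * c * (nrm (\<lambda>x. u (r n) x - v x))\<^sup>2 \<le> E \<mu> (u (r n)) + e / 2 \<and> \<tau> / real (Suc n) < e / 2"
        using split by (intro eventually_conj) auto
      then obtain n where n: "E \<mu> v + 2 * c * (nrm (\<lambda>x. u (r n) x - v x))\<^sup>2 \<le> E \<mu> (u (r n)) + e / 2" "\<tau> / real (Suc n) < e / 2"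
        by (auto simp: eventually_sequentially)
      have "\<tau> / real (Suc (r n)) \<le> \<tau> / real (Suc n)"
        using seq_suble[OF r, of n] \<tau>(1) by (intro divide_left_mono) auto
      then show ?thesis using n uE[of "r n"] by (intro exI[of _ n]) linarith
    qed
    have vE: "E \<mu> v \<le> m"
    proof (rule field_le_epsilon)
      fix e :: real assume "e > 0"
      then obtain n where n: "E \<mu> v + 2 * c * (nrm (\<lambda>x. u (r n) x - v x))\<^sup>2 \<le> m + e" using lim by blast
      have "0 \<le> 2 * c * (nrm (\<lambda>x. u (r n) x - v x))\<^sup>2" using c by simp
      then show "E \<mu> v \<le> m + e" using n by linarith
    qed
    \<comment> \<open>At this stage the weak limit may still be zero, where
      \<open>energy_pos\<close> is silent; its gradient norm is then 0 and the small-ball bound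
      applies.\<close>
    have vE0: "E \<mu> v \<ge> 0"
    proof (cases "v \<in> H01_nonzero \<Omega>")
      case False
      then have ae: "AE x in lebesgue_on \<Omega>. v x = 0" using v by (simp add: H01_nonzero_def)
      have "nrm v = 0" by (rule H01_norm_AE_0[OF v ae])
      then show ?thesis using small[OF \<mu>1 v] \<rho> by simp
    qed (use pos in \<open>auto intro: less_imp_le\<close>)
    obtain n where "E \<mu> v + 2 * c * (nrm (\<lambda>x. u (r n) x - v x))\<^sup>2 \<le> m + \<tau>" using lim[OF \<tau>(1)] by blast
    then have n: "2 * c * (nrm (\<lambda>x. u (r n) x - v x))\<^sup>2 \<le> 2 * \<tau>" using vE0 m\<tau> by linarith
    have "nrm (\<lambda>x. u (r n) x - v x) \<le> \<rho> / 2"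
    proof (rule power2_le_imp_le)
      have "c * (\<rho> / 2)\<^sup>2 = c * \<rho>\<^sup>2 / 4" by (simp add: power_divide)
      then have "c * (nrm (\<lambda>x. u (r n) x - v x))\<^sup>2 \<le> c * (\<rho> / 2)\<^sup>2" using n \<tau>(1,3) by linarith
      then show "(nrm (\<lambda>x. u (r n) x - v x))\<^sup>2 \<le> (\<rho> / 2)\<^sup>2" using c by (simp only: mult_le_cancel_left_pos)
    qed (use \<rho> in simp)
    moreover have "nrm (u (r n)) \<le> nrm (\<lambda>x. u (r n) x - v x) + nrm v"
      using H01_norm_triangle[OF H01_diff[OF uH v] v] by simp
    moreover have "nrm (u (r n)) \<ge> \<rho>" using uX by (simp add: X_def)
    ultimately have v2: "nrm v \<ge> \<rho> / 2" by linarith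
    have v\<rho>: "nrm v > \<rho>"
    proof (rule ccontr)
      assume "\<not> nrm v > \<rho>"
      then have 1: "c * (nrm v)\<^sup>2 \<le> E \<mu> v" using small[OF \<mu>1 v] by simp
      have "c * (\<rho> / 2)\<^sup>2 \<le> c * (nrm v)\<^sup>2" using v2 c \<rho> by (intro mult_left_mono power_mono) auto
      then have "c * \<rho>\<^sup>2 \<le> 4 * \<tau>" using 1 vE m\<tau> by (simp add: power_divide)
      then show False using \<tau> by linarith
    qed
    have vX: "v \<in> X" using v v\<rho> by (simp add: X_def)
    have "H01_local_minimizer \<Omega> (E \<mu>) v"
      unfolding H01_local_minimizer_def
    \<comment> \<open>Because the norm of \<open>v\<close> exceeds \<open>\<rho>\<close> strictly, a
      whole ball around \<open>v\<close> stays in \<open>X\<close>, where \<open>v\<close> is a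
      minimizer.\<close>
    proof (intro conjI v exI[of _ "nrm v - \<rho>"] ballI impI)
      show "nrm v - \<rho> > 0" using v\<rho> by simp
      fix z assume z: "z \<in> H01 \<Omega>" "nrm (\<lambda>x. z x - v x) < nrm v - \<rho>"
      have "nrm v \<le> nrm z + nrm (\<lambda>x. z x - v x)"
        using H01_norm_triangle_diff[OF z(1) H01_diff[OF z(1) v]] by simp
      then have "z \<in> X" using z by (simp add: X_def)
      then show "E \<mu> v \<le> E \<mu> z" using mle[of z] vE by linarith
    qed
    then show ?thesis using XN[OF vX] by blast
  qed
  then show ?thesis using \<epsilon>(1) unfolding ls_def by blast
qed

end

text \<open>If the Sobolev constant vanished, then \<open>C2\<close> would be \<open>0\<close> (division by \<open>0\<close>), against the
  upper bound on \<open>a\<close> and \<open>b\<close>; so the Sobolev inequality is part of the hypotheses.\<close>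

lemma sobolev_const_pos:
  assumes "bounded_domain \<Omega>" and "0 < C2 n (sobolev_const \<Omega>)"
  shows "0 < sobolev_const \<Omega>"
proof -
  interpret bounded_dom \<Omega> by standard fact
  have "0 \<le> sobolev_const \<Omega>"
    unfolding sobolev_const_def using H01_nonzero_nonempty by (intro cINF_greatest) auto
  moreover have "sobolev_const \<Omega> \<noteq> 0" using assms(2) by (auto simp: C2_def)
  ultimately show ?thesis by simp
qed

theorem theorem1p6:
  fixes \<Omega> :: "(real ^ 'n) set" and a b p :: real
  assumes "CARD('n) > 4"
    and "bounded_domain \<Omega>"
    and "a > 0" and "b > 0"
    and "2 < p" and "p < crit_exp CARD('n)"
    and "C1 CARD('n) (sobolev_const \<Omega>) < a powr ((real CARD('n) - 4) / 2) * b"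
    and "a powr ((real CARD('n) - 4) / 2) * b < C2 CARD('n) (sobolev_const \<Omega>)"
  shows "\<exists>\<epsilon>>0. \<forall>\<mu>>0.
      lambda0_star \<Omega> a b p - \<epsilon> < \<mu> \<and> \<mu> < lambda0_star \<Omega> a b p \<longrightarrow>
        (\<exists>u\<in>H01_nonzero \<Omega>. solves_P \<Omega> a b p \<mu> u
            \<and> H01_local_minimizer \<Omega> (energy \<Omega> a b p \<mu>) u
            \<and> energy \<Omega> a b p \<mu> u > 0)
        \<and> (\<forall>u\<in>H01_nonzero \<Omega>. energy \<Omega> a b p \<mu> u > 0)"
proof -
  have "0 < a powr ((real CARD('n) - 4) / 2) * b" using assms(3,4) by simp
  then have S: "0 < sobolev_const \<Omega>"
    using assms(8) by (intro sobolev_const_pos[OF assms(2), of "CARD('n)"]) linarith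
  interpret kirchhoff \<Omega> "crit_exp CARD('n)" "sobolev_const \<Omega>" a b p
    by standard (use assms S in simp_all)
  show ?thesis
    using exists_local_minimizer local_minimizer_solves energy_pos by meson
qed

end
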